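(* Let $\mathscr{C}$ be a $2d$-Calabi-Yau $(d+2)$-angulated category that is $K$-linear, Hom-finite and Krull-Schmidt. Let $T$ and $U$ be two basic Oppermann-Thomas cluster tilting objects of $\mathscr{C}$, with $\mathscr{T}=\mathrm{add}(T)$, $\mathscr{U}=\mathrm{add}(U)$ and $\Gamma_T=\mathrm{End}(T)$. Suppose that $d$ is odd, and that $U$ is mutable at the indecomposable summand $u$ with mutation $u^*$ such that $u$ and $u^*$ form an exchange pair, with exchange $(d+2)$-angles $$u^*\to e_d\to\cdots\to e_1\to u\xrightarrow{\delta}\Sigma^du^*,\qquad u\to f_d\to\cdots\to f_1\to u^*\xrightarrow{\epsilon}\Sigma^du.$$ Then either (i) or (ii) below is true. (i) $c_{\mathscr{T}}(u,\mathscr{U})([t])\ge 0$ for all $t\in\mathscr{T}$ and $$c_{\mathscr{T}}(u,\mathscr{U})([t])=\dim_K\mathrm{Hom}_{\Gamma_T}(F_T(t),\mathrm{Im}(\delta_* )),$$ where $\delta_*=F_T(\delta)$. (ii) $c_{\mathscr{T}}(u,\mathscr{U})([t])\le 0$ for all $t\in\mathscr{T}$ and $$c_{\mathscr{T}}(u,\mathscr{U})([t])=-\dim_K\mathrm{Hom}_{\Gamma_T}(F_T(t),\mathrm{Im}(\epsilon_* )),$$ where $\epsilon_*=F_T(\epsilon)$.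
   Context: Throughout, $K$ is an algebraically closed field and $d$ is a positive integer. **$(d+2)$-angulated categories (Geiss-Keller-Oppermann).** Let $\mathscr{C}$ be an additive category with an automorphism $\Sigma^d$ (not assumed to be the $d$-th power of another functor). A $\Sigma^d$-sequence is a diagram $c^0\xrightarrow{\gamma^0}c^1\xrightarrow{\gamma^1}\cdots\to c^{d+1}\xrightarrow{\gamma^{d+1}}\Sigma^d(c^0)$. A $(d+2)$-angulated category is such a $\mathscr{C}$ together with a class of $\Sigma^d$-sequences, called $(d+2)$-angles, such that: (N1) the class is closed under sums and summands, contains $c\xrightarrow{\mathrm{id}}c\to0\to\cdots\to0\to\Sigma^d(c)$ for each $c$, and each morphism $c^0\to c^1$ is the first morphism of some $(d+2)$-angle; (N2) a $\Sigma^d$-sequence $c^0\xrightarrow{\gamma^0}c^1\xrightarrow{\gamma^1}\cdots\to c^{d+1}\xrightarrow{\gamma^{d+1}}\Sigma^d(c^0)$ is a $(d+2)$-angle if and only if its left rotation $c^1\xrightarrow{\gamma^1}c^2\to\cdots\to c^{d+1}\xrightarrow{\gamma^{d+1}}\Sigma^d(c^0)\xrightarrow{(-1)^d\Sigma^d(\gamma^0)}\Sigma^d(c^1)$ is; (N3) given $(d+2)$-angles $b^\bullet$ and $c^\bullet$ with morphisms $\beta^i,\gamma^i$, and $\varphi^0:b^0\to c^0$, $\varphi^1:b^1\to c^1$ with $\varphi^1\beta^0=\gamma^0\varphi^0$, there are $\varphi^i:b^i\to c^i$ ($2\le i\le d+1$) completing $\varphi^0,\varphi^1,\Sigma^d(\varphi^0)$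 to a morphism of $\Sigma^d$-sequences; (N4) (octahedral axiom) in (N3) the $\varphi^i$ can be chosen so that the mapping cone $b^1\oplus c^0\to b^2\oplus c^1\to\cdots\to\Sigma^d b^0\oplus c^{d+1}\to\Sigma^d b^1\oplus\Sigma^d c^0$, with morphisms $\begin{pmatrix}-\beta^{i+1}&0\\ \varphi^{i+1}&\gamma^i\end{pmatrix}$ for $0\le i\le d$ and last morphism $\begin{pmatrix}-\Sigma^d\beta^0&0\\ \Sigma^d\varphi^0&\gamma^{d+1}\end{pmatrix}$, is a $(d+2)$-angle. $\mathscr{C}$ is $2d$-Calabi-Yau if it has a Serre functor (an auto-equivalence $S$ with isomorphisms $\mathrm{Hom}_{\mathscr{C}}(Y,SX)\cong D\,\mathrm{Hom}_{\mathscr{C}}(X,Y)$ natural in $X,Y$, where $D=\mathrm{Hom}_K(-,K)$) isomorphic to $\Sigma^{2d}:=(\Sigma^d)^2$. **Oppermann-Thomas cluster tilting.** An object $T$ is an Oppermann-Thomas cluster tilting object if, with $\mathscr{T}=\mathrm{add}(T)$: (i) $\mathrm{Hom}_{\mathscr{C}}(\mathscr{T},\Sigma^d\mathscr{T})=0$; (ii) for every $c\in\mathscr{C}$ there is a $(d+2)$-angle $t_d\to t_{d-1}\to\cdots\to t_0\to c\to\Sigma^d(t_d)$ with all $t_i\in\mathscr{T}$. It is basic if its indecomposable summands are pairwise non-isomorphic. $\mathrm{Indec}(\mathscr{T})$ is the set of indecomposables of $\mathscr{T}$ up to isomorphism. **The functor $F_T$.** With $\Gamma_T=\mathrm{End}(T)$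 and $\mathrm{mod}\,\Gamma_T$ the category of (finite-dimensional) right $\Gamma_T$-modules, $F_T:\mathscr{C}\to\mathrm{mod}\,\Gamma_T$ is $F_T(x)=\mathrm{Hom}_{\mathscr{C}}(T,x)$. **Mutation and exchange pairs.** Let $U$ be a basic Oppermann-Thomas cluster tilting object with indecomposable summands $u_1,\dots,u_m$. $U$ is mutable at $u\in\{u_1,\dots,u_m\}$ with mutation $u^*$ if $u^*$ is an indecomposable object of $\mathscr{C}$ such that the object with indecomposable summands $(\{u_1,\dots,u_m\}\setminus\{u\})\cup\{u^*\}$ is also an Oppermann-Thomas cluster tilting object. In that case $u,u^*$ form an exchange pair if $\mathrm{Ext}^d(u,u^* )=\mathrm{Hom}_{\mathscr{C}}(u,\Sigma^du^* )$ and $\mathrm{Ext}^d(u^*,u)=\mathrm{Hom}_{\mathscr{C}}(u^*,\Sigma^du)$ both have dimension $1$ over $K$ and there exist two $(d+2)$-angles $u^*\to e_d\to\cdots\to e_1\to u\xrightarrow{\delta}\Sigma^du^*$ and $u\to f_d\to\cdots\to f_1\to u^*\xrightarrow{\epsilon}\Sigma^du$ in which each $e_i$ and $f_i$ is a direct sum of indecomposables from $\mathrm{Indec}(\mathscr{U})\setminus\{u\}$. **Index and $c$-vector.** $K_0^{\mathrm{split}}(\mathscr{T})$ is the abelian group generated by objects of $\mathscr{T}$ modulo $[t]=[t_0]+[t_1]$ for $t\cong t_0\oplus t_1$; it is free on $[t]$, $t\in\mathrm{Indec}(\mathscr{T})$. The index of $c\in\mathscr{C}$ is $\mathrm{Ind}_{\mathscr{T}}(c)=\sum_{i=0}^d(-1)^i[t_i]\in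 K_0^{\mathrm{split}}(\mathscr{T})$ for any $(d+2)$-angle as in (ii); it is well defined. For an abelian group $A$, $A^*=\mathrm{Hom}(A,\mathbb{Z})$. For $u\in\mathrm{Indec}(\mathscr{U})$ the homological $c$-vector of $(u,\mathscr{U})$ with respect to $\mathscr{T}$ is the element $c_{\mathscr{T}}(u,\mathscr{U})\in K_0^{\mathrm{split}}(\mathscr{T})^*$ determined by $c_{\mathscr{T}}(u,\mathscr{U})(\mathrm{Ind}_{\mathscr{T}}(v))=\delta_{uv}$ (Kronecker delta) for all $v\in\mathrm{Indec}(\mathscr{U})$; it exists and is unique because the $\mathrm{Ind}_{\mathscr{T}}(v)$, $v\in\mathrm{Indec}(\mathscr{U})$, form a basis of $K_0^{\mathrm{split}}(\mathscr{T})$. *)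

theory Defs
  imports
    "HOL-Algebra.Free_Abelian_Groups"
    "HOL-Algebra.Elementary_Groups"
    "HOL-Library.Function_Algebras"
    "HOL-Computational_Algebra.Polynomial"
begin

section \<open>Linear categories\<close>

text \<open>
  The objects of a \<open>K\<close>-linear category are the elements of the type \<open>'o\<close>. Its Hom spaces are
  subspaces of one ambient \<open>K\<close>-vector space \<open>'m\<close>, and all zero morphisms are the vector \<open>0\<close>.
  No generality is lost: an arbitrary small \<open>K\<close>-linear category is of this form for
  \<open>'m\<close> the direct sum of all its Hom spaces. Elements of \<open>'m\<close> have no domain or codomain of their
  own, which is why most notions below mention the objects explicitly; \<open>g \<cdot> f\<close> (first \<open>f\<close>,
  then \<open>g\<close>) is constrained only on composable pairs.
\<close>

record ('o, 'm, 'k) lincat =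
  Hom :: "'o \<Rightarrow> 'o \<Rightarrow> 'm set"
  cmp :: "'m \<Rightarrow> 'm \<Rightarrow> 'm"  (infixl \<open>\<cdot>\<index>\<close> 70)
  ident :: "'o \<Rightarrow> 'm"  (\<open>Id\<index>\<close>)
  scl :: "'k \<Rightarrow> 'm \<Rightarrow> 'm"

locale linear_category = vector_space "scl C"
  for C :: "('o, 'm::ab_group_add, 'k::field, 'z) lincat_scheme" (structure) +
  assumes Hom_subspace: "subspace (Hom C x y)"
    and cmp_closed: "f \<in> Hom C x y \<Longrightarrow> g \<in> Hom C y z \<Longrightarrow> g \<cdot> f \<in> Hom C x z"
    and cmp_assoc: "f \<in> Hom C w x \<Longrightarrow> g \<in> Hom C x y \<Longrightarrow> h \<in> Hom C y z \<Longrightarrow>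
      (h \<cdot> g) \<cdot> f = h \<cdot> (g \<cdot> f)"
    and ident_closed: "Id x \<in> Hom C x x"
    and cmp_ident_left: "f \<in> Hom C x y \<Longrightarrow> Id y \<cdot> f = f"
    and cmp_ident_right: "f \<in> Hom C x y \<Longrightarrow> f \<cdot> Id x = f"
    and cmp_add_left: "f \<in> Hom C x y \<Longrightarrow> g \<in> Hom C y z \<Longrightarrow> g' \<in> Hom C y z \<Longrightarrow>
      (g + g') \<cdot> f = g \<cdot> f + g' \<cdot> f"
    and cmp_add_right: "f \<in> Hom C x y \<Longrightarrow> f' \<in> Hom C x y \<Longrightarrow> g \<in> Hom C y z \<Longrightarrow>
      g \<cdot> (f + f') = g \<cdot> f + g \<cdot> f'"
    and cmp_scl_left: "f \<in> Hom C x y \<Longrightarrow> g \<in> Hom C y z \<Longrightarrow> scl C a g \<cdot> f = scl C a (g \<cdot> f)"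
    and cmp_scl_right: "f \<in> Hom C x y \<Longrightarrow> g \<in> Hom C y z \<Longrightarrow> g \<cdot> scl C a f = scl C a (g \<cdot> f)"

definition hom_finite :: "('o, 'm::ab_group_add, 'k::field, 'z) lincat_scheme \<Rightarrow> bool" where
  "hom_finite C \<longleftrightarrow>
    (\<forall>x y. \<exists>B. finite B \<and> B \<subseteq> Hom C x y \<and> Hom C x y = Modules.module.span (scl C) B)"

definition hom_dim :: "('o, 'm::ab_group_add, 'k::field, 'z) lincat_scheme \<Rightarrow> 'o \<Rightarrow> 'o \<Rightarrow> nat" where
  "hom_dim C x y = vector_space.dim (scl C) (Hom C x y)"

definition is_iso :: "('o, 'm, 'k, 'z) lincat_scheme \<Rightarrow> 'o \<Rightarrow> 'o \<Rightarrow> 'm \<Rightarrow> bool" where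
  "is_iso C x y f \<longleftrightarrow> f \<in> Hom C x y \<and>
    (\<exists>g \<in> Hom C y x. g \<cdot>\<^bsub>C\<^esub> f = Id\<^bsub>C\<^esub> x \<and> f \<cdot>\<^bsub>C\<^esub> g = Id\<^bsub>C\<^esub> y)"

definition isomorphic :: "('o, 'm, 'k, 'z) lincat_scheme \<Rightarrow> 'o \<Rightarrow> 'o \<Rightarrow> bool" where
  "isomorphic C x y \<longleftrightarrow> (\<exists>f. is_iso C x y f)"

definition zero_object :: "('o, 'm::ab_group_add, 'k, 'z) lincat_scheme \<Rightarrow> 'o \<Rightarrow> bool" where
  "zero_object C z \<longleftrightarrow> (\<forall>x. Hom C z x = {0} \<and> Hom C x z = {0})"

text \<open>
  \<open>x\<close> is the biproduct of the objects \<open>xs ! 0, \<dots>, xs ! (n - 1)\<close>, with injections \<open>\<iota> i\<close> and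
  projections \<open>\<pi> i\<close>. No biproducts are chosen: \<open>direct_sum C [y, z] x\<close> is \<open>x \<cong> y \<oplus> z\<close>.
\<close>

definition biproduct ::
    "('o, 'm::ab_group_add, 'k, 'z) lincat_scheme \<Rightarrow> 'o list \<Rightarrow> 'o \<Rightarrow> (nat \<Rightarrow> 'm) \<Rightarrow> (nat \<Rightarrow> 'm) \<Rightarrow> bool" where
  "biproduct C xs x \<iota> \<pi> \<longleftrightarrow>
    (\<forall>i < length xs. \<iota> i \<in> Hom C (xs ! i) x \<and> \<pi> i \<in> Hom C x (xs ! i)) \<and>
    (\<forall>i < length xs. \<forall>j < length xs. \<pi> j \<cdot>\<^bsub>C\<^esub> \<iota> i = (if i = j then Id\<^bsub>C\<^esub> (xs ! i) else 0)) \<and>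
    (\<Sum>i < length xs. \<iota> i \<cdot>\<^bsub>C\<^esub> \<pi> i) = Id\<^bsub>C\<^esub> x"

definition direct_sum :: "('o, 'm::ab_group_add, 'k, 'z) lincat_scheme \<Rightarrow> 'o list \<Rightarrow> 'o \<Rightarrow> bool" where
  "direct_sum C xs x \<longleftrightarrow> (\<exists>\<iota> \<pi>. biproduct C xs x \<iota> \<pi>)"

locale additive_linear_category = linear_category +
  assumes ex_zero_object: "\<exists>z. zero_object C z"
    and ex_direct_sum: "\<exists>z. direct_sum C [x, y] z"

definition local_End :: "('o, 'm::ab_group_add, 'k, 'z) lincat_scheme \<Rightarrow> 'o \<Rightarrow> bool" where
  "local_End C x \<longleftrightarrow> Id\<^bsub>C\<^esub> x \<noteq> 0 \<and>
    (\<forall>f \<in> Hom C x x. \<forall>g \<in> Hom C x x. is_iso C x x (f + g) \<longrightarrow> is_iso C x x f \<or> is_iso C x x g)"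

definition krull_schmidt :: "('o, 'm::ab_group_add, 'k, 'z) lincat_scheme \<Rightarrow> bool" where
  "krull_schmidt C \<longleftrightarrow> (\<forall>x. \<exists>xs. direct_sum C xs x \<and> (\<forall>y \<in> set xs. local_End C y))"

definition summand :: "('o, 'm::ab_group_add, 'k, 'z) lincat_scheme \<Rightarrow> 'o \<Rightarrow> 'o \<Rightarrow> bool" where
  "summand C y x \<longleftrightarrow> (\<exists>z. direct_sum C [y, z] x)"

definition indecomposable :: "('o, 'm::ab_group_add, 'k, 'z) lincat_scheme \<Rightarrow> 'o \<Rightarrow> bool" where
  "indecomposable C x \<longleftrightarrow> \<not> zero_object C x \<and>
    (\<forall>y z. direct_sum C [y, z] x \<longrightarrow> zero_object C y \<or> zero_object C z)"

definition basic :: "('o, 'm::ab_group_add, 'k, 'z) lincat_scheme \<Rightarrow> 'o \<Rightarrow> bool" where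
  "basic C x \<longleftrightarrow> (\<forall>xs. direct_sum C xs x \<and> (\<forall>y \<in> set xs. indecomposable C y) \<longrightarrow>
    (\<forall>i < length xs. \<forall>j < length xs. i \<noteq> j \<longrightarrow> \<not> isomorphic C (xs ! i) (xs ! j)))"

definition addcat :: "('o, 'm::ab_group_add, 'k, 'z) lincat_scheme \<Rightarrow> 'o \<Rightarrow> 'o set" where
  "addcat C x = {y. \<exists>n w. direct_sum C (replicate n x) w \<and> summand C y w}"

text \<open>
  A set of indecomposables "up to isomorphism" is represented by the corresponding isomorphism-closed
  set of objects; in the presence of such sets, equality of objects becomes \<^const>\<open>isomorphic\<close>.
\<close>

definition Indec :: "('o, 'm::ab_group_add, 'k, 'z) lincat_scheme \<Rightarrow> 'o set \<Rightarrow> 'o set" where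
  "Indec C A = {x \<in> A. indecomposable C x}"

definition indec_summands :: "('o, 'm::ab_group_add, 'k, 'z) lincat_scheme \<Rightarrow> 'o \<Rightarrow> 'o set" where
  "indec_summands C x = {y. indecomposable C y \<and> summand C y x}"


section \<open>Endofunctors and Serre functors\<close>

definition is_functor :: "('o, 'm, 'k, 'z) lincat_scheme \<Rightarrow> ('o \<Rightarrow> 'o) \<Rightarrow> ('m \<Rightarrow> 'm) \<Rightarrow> bool" where
  "is_functor C Fo Fm \<longleftrightarrow>
    (\<forall>x y. \<forall>f \<in> Hom C x y. Fm f \<in> Hom C (Fo x) (Fo y)) \<and>
    (\<forall>x. Fm (Id\<^bsub>C\<^esub> x) = Id\<^bsub>C\<^esub> (Fo x)) \<and>
    (\<forall>x y z. \<forall>f \<in> Hom C x y. \<forall>g \<in> Hom C y z. Fm (g \<cdot>\<^bsub>C\<^esub> f) = Fm g \<cdot>\<^bsub>C\<^esub> Fm f)"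

definition linear_automorphism ::
    "('o, 'm::ab_group_add, 'k::field, 'z) lincat_scheme \<Rightarrow> ('o \<Rightarrow> 'o) \<Rightarrow> ('m \<Rightarrow> 'm) \<Rightarrow> bool" where
  "linear_automorphism C Fo Fm \<longleftrightarrow> is_functor C Fo Fm \<and> bij Fo \<and>
    (\<forall>x y. bij_betw Fm (Hom C x y) (Hom C (Fo x) (Fo y))) \<and>
    (\<forall>x y. \<forall>f \<in> Hom C x y. \<forall>g \<in> Hom C x y. Fm (f + g) = Fm f + Fm g) \<and>
    (\<forall>x y a. \<forall>f \<in> Hom C x y. Fm (scl C a f) = scl C a (Fm f))"

definition nat_iso ::
    "('o, 'm, 'k, 'z) lincat_scheme \<Rightarrow> ('o \<Rightarrow> 'o) \<Rightarrow> ('m \<Rightarrow> 'm) \<Rightarrow> ('o \<Rightarrow> 'o) \<Rightarrow> ('m \<Rightarrow> 'm) \<Rightarrow> bool" where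
  "nat_iso C Fo Fm Go Gm \<longleftrightarrow> (\<exists>\<eta>. (\<forall>x. is_iso C (Fo x) (Go x) (\<eta> x)) \<and>
    (\<forall>x y. \<forall>f \<in> Hom C x y. \<eta> y \<cdot>\<^bsub>C\<^esub> Fm f = Gm f \<cdot>\<^bsub>C\<^esub> \<eta> x))"

definition auto_equivalence :: "('o, 'm, 'k, 'z) lincat_scheme \<Rightarrow> ('o \<Rightarrow> 'o) \<Rightarrow> ('m \<Rightarrow> 'm) \<Rightarrow> bool" where
  "auto_equivalence C Fo Fm \<longleftrightarrow> is_functor C Fo Fm \<and>
    (\<exists>Go Gm. is_functor C Go Gm \<and>
      nat_iso C (Go \<circ> Fo) (Gm \<circ> Fm) id id \<and> nat_iso C (Fo \<circ> Go) (Fm \<circ> Gm) id id)"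

text \<open>
  Functionals on a subspace \<open>V\<close> of \<open>'m\<close> are extended by \<open>0\<close> outside \<open>V\<close>, so that each is a
  single function and the vector space operations are pointwise.
\<close>

definition dual_space ::
    "('o, 'm::ab_group_add, 'k::field, 'z) lincat_scheme \<Rightarrow> 'm set \<Rightarrow> ('m \<Rightarrow> 'k) set" where
  "dual_space C V = {l.
    (\<forall>v \<in> V. \<forall>w \<in> V. l (v + w) = l v + l w) \<and>
    (\<forall>a. \<forall>v \<in> V. l (scl C a v) = a * l v) \<and>
    (\<forall>v. v \<notin> V \<longrightarrow> l v = 0)}"

definition serre_functor ::
    "('o, 'm::ab_group_add, 'k::field, 'z) lincat_scheme \<Rightarrow> ('o \<Rightarrow> 'o) \<Rightarrow> ('m \<Rightarrow> 'm) \<Rightarrow> bool" where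
  "serre_functor C So Sm \<longleftrightarrow> auto_equivalence C So Sm \<and>
    (\<exists>\<Phi> :: 'o \<Rightarrow> 'o \<Rightarrow> 'm \<Rightarrow> 'm \<Rightarrow> 'k.
      (\<forall>x y. bij_betw (\<Phi> x y) (Hom C y (So x)) (dual_space C (Hom C x y))) \<and>
      (\<forall>x y. \<forall>f \<in> Hom C y (So x). \<forall>g \<in> Hom C y (So x). \<forall>h.
        \<Phi> x y (f + g) h = \<Phi> x y f h + \<Phi> x y g h) \<and>
      (\<forall>x y a. \<forall>f \<in> Hom C y (So x). \<forall>h. \<Phi> x y (scl C a f) h = a * \<Phi> x y f h) \<and>
      (\<forall>x x' y. \<forall>p \<in> Hom C x x'. \<forall>f \<in> Hom C y (So x). \<forall>h \<in> Hom C x' y.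
        \<Phi> x' y (Sm p \<cdot>\<^bsub>C\<^esub> f) h = \<Phi> x y f (h \<cdot>\<^bsub>C\<^esub> p)) \<and>
      (\<forall>x y y'. \<forall>q \<in> Hom C y' y. \<forall>f \<in> Hom C y (So x). \<forall>h \<in> Hom C x y'.
        \<Phi> x y' (f \<cdot>\<^bsub>C\<^esub> q) h = \<Phi> x y f (q \<cdot>\<^bsub>C\<^esub> h)))"


section \<open>\<open>(d+2)\<close>-angulated categories\<close>

text \<open>
  \<open>shO\<close>, \<open>shM\<close> are the automorphism \<open>\<Sigma>\<^sup>d\<close> on objects and on morphisms. The sequence
  \<open>c\<^sup>0 \<rightarrow> \<dots> \<rightarrow> c\<^sup>d\<^sup>+\<^sup>1 \<rightarrow> \<Sigma>\<^sup>d c\<^sup>0\<close> is the pair of the list of its objects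
  \<open>c\<^sup>0, \<dots>, c\<^sup>d\<^sup>+\<^sup>1\<close> and the list of its morphisms \<open>\<gamma>\<^sup>0, \<dots>, \<gamma>\<^sup>d\<^sup>+\<^sup>1\<close>; the final
  object is left implicit.
\<close>

type_synonym ('o, 'm) seq = "'o list \<times> 'm list"

record ('o, 'm, 'k) angcat = "('o, 'm, 'k) lincat" +
  shO :: "'o \<Rightarrow> 'o"
  shM :: "'m \<Rightarrow> 'm"
  angles :: "('o, 'm) seq set"

definition is_seq :: "('o, 'm, 'k, 'z) angcat_scheme \<Rightarrow> nat \<Rightarrow> ('o, 'm) seq \<Rightarrow> bool" where
  "is_seq C d = (\<lambda>(cs, \<gamma>). length cs = d + 2 \<and> length \<gamma> = d + 2 \<and>
    (\<forall>i \<le> d. \<gamma> ! i \<in> Hom C (cs ! i) (cs ! (i + 1))) \<and>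
    \<gamma> ! (d + 1) \<in> Hom C (cs ! (d + 1)) (shO C (cs ! 0)))"

definition seq_mor ::
    "('o, 'm, 'k, 'z) angcat_scheme \<Rightarrow> nat \<Rightarrow> ('o, 'm) seq \<Rightarrow> ('o, 'm) seq \<Rightarrow> 'm list \<Rightarrow> bool" where
  "seq_mor C d = (\<lambda>(bs, \<beta>) (cs, \<gamma>) \<phi>. length \<phi> = d + 2 \<and>
    (\<forall>i \<le> d + 1. \<phi> ! i \<in> Hom C (bs ! i) (cs ! i)) \<and>
    (\<forall>i \<le> d. \<phi> ! (i + 1) \<cdot>\<^bsub>C\<^esub> \<beta> ! i = \<gamma> ! i \<cdot>\<^bsub>C\<^esub> \<phi> ! i) \<and>
    shM C (\<phi> ! 0) \<cdot>\<^bsub>C\<^esub> \<beta> ! (d + 1) = \<gamma> ! (d + 1) \<cdot>\<^bsub>C\<^esub> \<phi> ! (d + 1))"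

definition seq_direct_sum ::
    "('o, 'm::ab_group_add, 'k, 'z) angcat_scheme \<Rightarrow> nat \<Rightarrow>
      ('o, 'm) seq \<Rightarrow> ('o, 'm) seq \<Rightarrow> ('o, 'm) seq \<Rightarrow> bool" where
  "seq_direct_sum C d b c e \<longleftrightarrow> (\<exists>\<iota>\<^sub>1 \<iota>\<^sub>2 \<pi>\<^sub>1 \<pi>\<^sub>2.
    seq_mor C d b e \<iota>\<^sub>1 \<and> seq_mor C d c e \<iota>\<^sub>2 \<and> seq_mor C d e b \<pi>\<^sub>1 \<and> seq_mor C d e c \<pi>\<^sub>2 \<and>
    (\<forall>i \<le> d + 1. biproduct C [fst b ! i, fst c ! i] (fst e ! i)
      (\<lambda>k. [\<iota>\<^sub>1 ! i, \<iota>\<^sub>2 ! i] ! k) (\<lambda>k. [\<pi>\<^sub>1 ! i, \<pi>\<^sub>2 ! i] ! k)))"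

definition rotate_left ::
    "('o, 'm::ab_group_add, 'k::field, 'z) angcat_scheme \<Rightarrow> nat \<Rightarrow> ('o, 'm) seq \<Rightarrow> ('o, 'm) seq" where
  "rotate_left C d = (\<lambda>(cs, \<gamma>).
    (tl cs @ [shO C (hd cs)], tl \<gamma> @ [scl C ((-1) ^ d) (shM C (hd \<gamma>))]))"

text \<open>
  \<open>e\<close> is a mapping cone of \<open>\<phi> : b \<rightarrow> c\<close>. The object \<open>es ! i\<close> is a biproduct of
  \<open>b\<^sup>i\<^sup>+\<^sup>1\<close> and \<open>c\<^sup>i\<close>, with injections \<open>\<iota>\<^sub>1 i\<close>, \<open>\<iota>\<^sub>2 i\<close> and projections \<open>\<pi>\<^sub>1 i\<close>, \<open>\<pi>\<^sub>2 i\<close>, where the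
  lists \<open>bs\<close>, \<open>\<beta>\<close>, \<open>\<phi>\<close> are prolonged by \<open>\<Sigma>\<^sup>d b\<^sup>0\<close>, \<open>\<Sigma>\<^sup>d \<beta>\<^sup>0\<close>, \<open>\<Sigma>\<^sup>d \<phi>\<^sup>0\<close>. The target
  \<open>\<Sigma>\<^sup>d b\<^sup>1 \<oplus> \<Sigma>\<^sup>d c\<^sup>0\<close> of the last morphism is \<open>\<Sigma>\<^sup>d\<close> applied to the biproduct at index \<open>0\<close>.
\<close>

definition mapping_cone ::
    "('o, 'm::ab_group_add, 'k, 'z) angcat_scheme \<Rightarrow> nat \<Rightarrow>
      ('o, 'm) seq \<Rightarrow> ('o, 'm) seq \<Rightarrow> 'm list \<Rightarrow> ('o, 'm) seq \<Rightarrow> bool" where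
  "mapping_cone C d = (\<lambda>(bs, \<beta>) (cs, \<gamma>) \<phi> (es, \<eta>).
    length es = d + 2 \<and> length \<eta> = d + 2 \<and>
    (let bs' = bs @ [shO C (bs ! 0)]; \<beta>' = \<beta> @ [shM C (\<beta> ! 0)]; \<phi>' = \<phi> @ [shM C (\<phi> ! 0)] in
      \<exists>\<iota>\<^sub>1 \<iota>\<^sub>2 \<pi>\<^sub>1 \<pi>\<^sub>2 :: nat \<Rightarrow> 'm.
        (\<forall>i \<le> d + 1. biproduct C [bs' ! (i + 1), cs ! i] (es ! i)
          (\<lambda>k. [\<iota>\<^sub>1 i, \<iota>\<^sub>2 i] ! k) (\<lambda>k. [\<pi>\<^sub>1 i, \<pi>\<^sub>2 i] ! k)) \<and>
        \<iota>\<^sub>1 (d + 2) = shM C (\<iota>\<^sub>1 0) \<and> \<iota>\<^sub>2 (d + 2) = shM C (\<iota>\<^sub>2 0) \<and>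
        (\<forall>i \<le> d + 1. \<eta> ! i =
          \<iota>\<^sub>1 (i + 1) \<cdot>\<^bsub>C\<^esub> (- (\<beta>' ! (i + 1))) \<cdot>\<^bsub>C\<^esub> \<pi>\<^sub>1 i +
          \<iota>\<^sub>2 (i + 1) \<cdot>\<^bsub>C\<^esub> (\<phi>' ! (i + 1)) \<cdot>\<^bsub>C\<^esub> \<pi>\<^sub>1 i +
          \<iota>\<^sub>2 (i + 1) \<cdot>\<^bsub>C\<^esub> (\<gamma> ! i) \<cdot>\<^bsub>C\<^esub> \<pi>\<^sub>2 i)))"

locale angulated_category = additive_linear_category C
  for C :: "('o, 'm::ab_group_add, 'k::field, 'z) angcat_scheme" (structure) +
  fixes d :: nat
  assumes d_pos: "d > 0"
    and shift: "linear_automorphism C (shO C) (shM C)"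
    and angles_seq: "c \<in> angles C \<Longrightarrow> is_seq C d c"
    and N1_sum: "b \<in> angles C \<Longrightarrow> c \<in> angles C \<Longrightarrow> is_seq C d e \<Longrightarrow> seq_direct_sum C d b c e \<Longrightarrow>
      e \<in> angles C"
    and N1_summand: "e \<in> angles C \<Longrightarrow> is_seq C d b \<Longrightarrow> is_seq C d c \<Longrightarrow> seq_direct_sum C d b c e \<Longrightarrow>
      b \<in> angles C \<and> c \<in> angles C"
    and N1_ident: "zero_object C z \<Longrightarrow> ([x, x] @ replicate d z, [Id x] @ replicate (d + 1) 0) \<in> angles C"
    and N1_ex: "f \<in> Hom C x y \<Longrightarrow> \<exists>cs \<gamma>. (x # y # cs, f # \<gamma>) \<in> angles C"
    and N2: "is_seq C d c \<Longrightarrow> c \<in> angles C \<longleftrightarrow> rotate_left C d c \<in> angles C"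
    and N3: "(bs, \<beta>) \<in> angles C \<Longrightarrow> (cs, \<gamma>) \<in> angles C \<Longrightarrow>
      \<phi>\<^sub>0 \<in> Hom C (bs ! 0) (cs ! 0) \<Longrightarrow> \<phi>\<^sub>1 \<in> Hom C (bs ! 1) (cs ! 1) \<Longrightarrow> \<phi>\<^sub>1 \<cdot> \<beta> ! 0 = \<gamma> ! 0 \<cdot> \<phi>\<^sub>0 \<Longrightarrow>
      \<exists>\<phi>. seq_mor C d (bs, \<beta>) (cs, \<gamma>) (\<phi>\<^sub>0 # \<phi>\<^sub>1 # \<phi>)"
    and N4: "(bs, \<beta>) \<in> angles C \<Longrightarrow> (cs, \<gamma>) \<in> angles C \<Longrightarrow>
      \<phi>\<^sub>0 \<in> Hom C (bs ! 0) (cs ! 0) \<Longrightarrow> \<phi>\<^sub>1 \<in> Hom C (bs ! 1) (cs ! 1) \<Longrightarrow> \<phi>\<^sub>1 \<cdot> \<beta> ! 0 = \<gamma> ! 0 \<cdot> \<phi>\<^sub>0 \<Longrightarrow>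
      \<exists>\<phi>. seq_mor C d (bs, \<beta>) (cs, \<gamma>) (\<phi>\<^sub>0 # \<phi>\<^sub>1 # \<phi>) \<and>
        (\<forall>e. mapping_cone C d (bs, \<beta>) (cs, \<gamma>) (\<phi>\<^sub>0 # \<phi>\<^sub>1 # \<phi>) e \<longrightarrow> e \<in> angles C)"

text \<open>\<open>2d\<close>-Calabi-Yau; the number \<open>d\<close> enters only through \<open>\<Sigma>\<^sup>d\<close>.\<close>

definition calabi_yau_2d :: "('o, 'm::ab_group_add, 'k::field, 'z) angcat_scheme \<Rightarrow> bool" where
  "calabi_yau_2d C \<longleftrightarrow> (\<exists>So Sm. serre_functor C So Sm \<and>
    nat_iso C So Sm (shO C \<circ> shO C) (shM C \<circ> shM C))"


section \<open>Oppermann-Thomas cluster tilting objects and mutation\<close>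

text \<open>\<open>ts = [t\<^sub>d, \<dots>, t\<^sub>0]\<close>, so \<open>t\<^sub>i\<close> is \<open>ts ! (d - i)\<close>.\<close>

definition resolution ::
    "('o, 'm, 'k, 'z) angcat_scheme \<Rightarrow> nat \<Rightarrow> 'o set \<Rightarrow> 'o list \<Rightarrow> 'o \<Rightarrow> bool" where
  "resolution C d A ts c \<longleftrightarrow> length ts = d + 1 \<and> set ts \<subseteq> A \<and> (\<exists>\<gamma>. (ts @ [c], \<gamma>) \<in> angles C)"

definition OT_cluster_tilting :: "('o, 'm::ab_group_add, 'k, 'z) angcat_scheme \<Rightarrow> nat \<Rightarrow> 'o \<Rightarrow> bool" where
  "OT_cluster_tilting C d T \<longleftrightarrow>
    (\<forall>t \<in> addcat C T. \<forall>t' \<in> addcat C T. Hom C t (shO C t') = {0}) \<and>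
    (\<forall>c. \<exists>ts. resolution C d (addcat C T) ts c)"

definition is_mutation ::
    "('o, 'm::ab_group_add, 'k, 'z) angcat_scheme \<Rightarrow> nat \<Rightarrow> 'o \<Rightarrow> 'o \<Rightarrow> 'o \<Rightarrow> bool" where
  "is_mutation C d U u u' \<longleftrightarrow> u \<in> indec_summands C U \<and> indecomposable C u' \<and>
    (\<exists>V. basic C V \<and> OT_cluster_tilting C d V \<and>
      indec_summands C V =
        {v \<in> indec_summands C U. \<not> isomorphic C v u} \<union> {v. isomorphic C v u'})"

text \<open>
  \<open>\<delta>\<close> is the last morphism of an angle \<open>a \<rightarrow> e\<^sub>d \<rightarrow> \<dots> \<rightarrow> e\<^sub>1 \<rightarrow> b \<rightarrow> \<Sigma>\<^sup>d a\<close> in which each \<open>e\<^sub>i\<close> is a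
  direct sum of objects of \<open>E\<close>.
\<close>

definition angle_through ::
    "('o, 'm::ab_group_add, 'k, 'z) angcat_scheme \<Rightarrow> nat \<Rightarrow> 'o set \<Rightarrow> 'o \<Rightarrow> 'o \<Rightarrow> 'm \<Rightarrow> bool" where
  "angle_through C d E a b \<delta> \<longleftrightarrow> (\<exists>es \<gamma>. length es = d \<and>
    ([a] @ es @ [b], \<gamma> @ [\<delta>]) \<in> angles C \<and>
    (\<forall>e \<in> set es. \<exists>xs. set xs \<subseteq> E \<and> direct_sum C xs e))"

text \<open>Exchange angles for \<open>u, u'\<close>: the middle terms avoid \<open>u\<close>, for both angles.\<close>

definition exchange_angles ::
    "('o, 'm::ab_group_add, 'k, 'z) angcat_scheme \<Rightarrow> nat \<Rightarrow> 'o \<Rightarrow> 'o \<Rightarrow> 'o \<Rightarrow> 'm \<Rightarrow> 'm \<Rightarrow> bool" where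
  "exchange_angles C d U u u' \<delta> \<epsilon> \<longleftrightarrow>
    (let E = {v \<in> Indec C (addcat C U). \<not> isomorphic C v u}
     in angle_through C d E u' u \<delta> \<and> angle_through C d E u u' \<epsilon>)"

definition exchange_pair ::
    "('o, 'm::ab_group_add, 'k::field, 'z) angcat_scheme \<Rightarrow> nat \<Rightarrow> 'o \<Rightarrow> 'o \<Rightarrow> 'o \<Rightarrow> bool" where
  "exchange_pair C d U u u' \<longleftrightarrow>
    hom_dim C u (shO C u') = 1 \<and> hom_dim C u' (shO C u) = 1 \<and>
    (\<exists>\<delta> \<epsilon>. exchange_angles C d U u u' \<delta> \<epsilon>)"


section \<open>The functor \<open>F\<^sub>T\<close>\<close>

text \<open>
  \<open>F\<^sub>T x = Hom(T, x)\<close> is a right module over \<open>\<Gamma>\<^sub>T = End(T)\<close>, acting by precomposition. All modules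
  needed are submodules of some \<open>F\<^sub>T x\<close>, hence subspaces of \<open>'m\<close> with this action. Module
  homomorphisms out of \<open>M\<close> are extended by \<open>0\<close> outside \<open>M\<close>, which makes them a \<open>K\<close>-vector space under
  pointwise operations; additivity and \<open>\<Gamma>\<^sub>T\<close>-equivariance already imply \<open>K\<close>-linearity on \<open>M\<close>.
\<close>

definition F_obj :: "('o, 'm, 'k, 'z) lincat_scheme \<Rightarrow> 'o \<Rightarrow> 'o \<Rightarrow> 'm set" where
  "F_obj C T x = Hom C T x"

definition F_mor :: "('o, 'm, 'k, 'z) lincat_scheme \<Rightarrow> 'm \<Rightarrow> 'm \<Rightarrow> 'm" where
  "F_mor C f = (\<lambda>h. f \<cdot>\<^bsub>C\<^esub> h)"

definition F_image :: "('o, 'm, 'k, 'z) lincat_scheme \<Rightarrow> 'o \<Rightarrow> 'o \<Rightarrow> 'm \<Rightarrow> 'm set" where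
  "F_image C T x f = F_mor C f ` F_obj C T x"

definition End_hom ::
    "('o, 'm::ab_group_add, 'k, 'z) lincat_scheme \<Rightarrow> 'o \<Rightarrow> 'm set \<Rightarrow> 'm set \<Rightarrow> ('m \<Rightarrow> 'm) set" where
  "End_hom C T M N = {\<psi>.
    (\<forall>m \<in> M. \<psi> m \<in> N) \<and>
    (\<forall>m \<in> M. \<forall>m' \<in> M. \<psi> (m + m') = \<psi> m + \<psi> m') \<and>
    (\<forall>m \<in> M. \<forall>g \<in> Hom C T T. \<psi> (m \<cdot>\<^bsub>C\<^esub> g) = \<psi> m \<cdot>\<^bsub>C\<^esub> g) \<and>
    (\<forall>m. m \<notin> M \<longrightarrow> \<psi> m = 0)}"

definition fun_scl ::
    "('o, 'm, 'k, 'z) lincat_scheme \<Rightarrow> 'k \<Rightarrow> ('m \<Rightarrow> 'm) \<Rightarrow> 'm \<Rightarrow> 'm" where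
  "fun_scl C a \<psi> = (\<lambda>m. scl C a (\<psi> m))"

lemma (in linear_category) vector_space_fun_scl: "vector_space (fun_scl C)"
  by unfold_locales (auto simp: fun_scl_def fun_eq_iff scale_right_distrib scale_left_distrib)

definition End_hom_dim ::
    "('o, 'm::ab_group_add, 'k::field, 'z) lincat_scheme \<Rightarrow> 'o \<Rightarrow> 'm set \<Rightarrow> 'm set \<Rightarrow> nat" where
  "End_hom_dim C T M N = vector_space.dim (fun_scl C) (End_hom C T M N)"


section \<open>Split Grothendieck groups, indices and \<open>c\<close>-vectors\<close>

text \<open>
  The library writes free abelian groups and their quotients multiplicatively: \<open>\<otimes>\<close> is the addition
  of \<open>K\<^sub>0\<close>, and \<open>x [^] n\<close> is the multiple \<open>n x\<close>.
\<close>

definition K0_relations ::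
    "('o, 'm::ab_group_add, 'k, 'z) lincat_scheme \<Rightarrow> 'o set \<Rightarrow> ('o \<Rightarrow>\<^sub>0 int) set" where
  "K0_relations C A = {frag_of t - (frag_of t\<^sub>0 + frag_of t\<^sub>1) | t t\<^sub>0 t\<^sub>1.
    t \<in> A \<and> t\<^sub>0 \<in> A \<and> t\<^sub>1 \<in> A \<and> direct_sum C [t\<^sub>0, t\<^sub>1] t}"

definition K0_kernel ::
    "('o, 'm::ab_group_add, 'k, 'z) lincat_scheme \<Rightarrow> 'o set \<Rightarrow> ('o \<Rightarrow>\<^sub>0 int) set" where
  "K0_kernel C A = generate (free_Abelian_group A) (K0_relations C A)"

definition K0_split ::
    "('o, 'm::ab_group_add, 'k, 'z) lincat_scheme \<Rightarrow> 'o set \<Rightarrow> ('o \<Rightarrow>\<^sub>0 int) set monoid" where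
  "K0_split C A = free_Abelian_group A Mod K0_kernel C A"

definition K0_class ::
    "('o, 'm::ab_group_add, 'k, 'z) lincat_scheme \<Rightarrow> 'o set \<Rightarrow> 'o \<Rightarrow> ('o \<Rightarrow>\<^sub>0 int) set" where
  "K0_class C A t = K0_kernel C A #>\<^bsub>free_Abelian_group A\<^esub> frag_of t"

text \<open>\<open>A\<^sup>* = Hom(A, \<int>)\<close>; extensionality makes each homomorphism a single function.\<close>

definition dual_group :: "('a, 'b) monoid_scheme \<Rightarrow> ('a \<Rightarrow> int) set" where
  "dual_group A = hom A integer_group \<inter> extensional (carrier A)"

definition index ::
    "('o, 'm::ab_group_add, 'k, 'z) angcat_scheme \<Rightarrow> nat \<Rightarrow> 'o \<Rightarrow> 'o \<Rightarrow> ('o \<Rightarrow>\<^sub>0 int) set" where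
  "index C d T c = (THE k. \<exists>ts. resolution C d (addcat C T) ts c \<and>
    k = (\<Otimes>\<^bsub>K0_split C (addcat C T)\<^esub>i \<in> {..d}.
      K0_class C (addcat C T) (ts ! (d - i)) [^]\<^bsub>K0_split C (addcat C T)\<^esub> ((-1) ^ i :: int)))"

definition c_vector ::
    "('o, 'm::ab_group_add, 'k, 'z) angcat_scheme \<Rightarrow> nat \<Rightarrow> 'o \<Rightarrow> 'o \<Rightarrow> 'o \<Rightarrow> ('o \<Rightarrow>\<^sub>0 int) set \<Rightarrow> int" where
  "c_vector C d T U u = (THE c. c \<in> dual_group (K0_split C (addcat C T)) \<and>
    (\<forall>v \<in> Indec C (addcat C U). c (index C d T v) = (if isomorphic C v u then 1 else 0)))"

end

theory Submission
  imports Defs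
begin

text \<open>
  For \<open>t\<close> in \<open>add T\<close> write \<open>M(t)\<close> for the image \<open>\<delta> Hom(t, u)\<close> of \<open>Hom(t, u)\<close> in \<open>Hom(t, \<Sigma>\<^sup>d u')\<close> and \<open>N(t)\<close>
  for \<open>\<epsilon> Hom(t, u')\<close>. As \<open>F\<^sub>T t\<close> is projective, \<open>dim M(t)\<close> and \<open>dim N(t)\<close> are the dimensions in the
  theorem (\<open>End_hom_dim_eq\<close>), and both are additive in \<open>t\<close>. The claim is that \<open>dim M\<close> is the
  \<open>c\<close>-vector if \<open>\<delta>\<^sub>* \<noteq> 0\<close>, and that \<open>- dim N\<close> is if \<open>\<delta>\<^sub>* = 0\<close>.

  \<^emph>\<open>Values on indices.\<close> Let \<open>t\<^sub>d \<rightarrow> \<dots> \<rightarrow> t\<^sub>0 \<rightarrow> v \<rightarrow> \<Sigma>\<^sup>d t\<^sub>d\<close> be a resolution of an indecomposable \<open>v\<close> of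
  \<open>add U\<close>. The value of \<open>dim M\<close> on the index of \<open>v\<close> is the Euler characteristic of the complex
  \<open>M(t\<^sub>0) \<rightarrow> \<dots> \<rightarrow> M(t\<^sub>d)\<close>. Now \<open>M\<close> is the image of one map of the long exact sequence of the exchange
  angle, and the functors \<open>Hom(-, e\<^sub>i)\<close> in that sequence are exact on the resolution as
  \<open>Hom(v, \<Sigma>\<^sup>d e\<^sub>i) = 0\<close>. Shifting along both angles, a cocycle at \<open>t\<^sub>i\<close> becomes one beyond \<open>t\<^sub>d\<close>
  (\<open>cocycle_coboundary\<close>), so only the two ends contribute (\<open>post_image_euler\<close>): the maps
  \<open>t\<^sub>0 \<rightarrow> v \<rightarrow> u \<rightarrow> \<Sigma>\<^sup>d u'\<close> at \<open>t\<^sub>0\<close>, and the cokernel of \<open>M(t\<^sub>d\<^sub>-\<^sub>1) \<rightarrow> M(t\<^sub>d)\<close>. For \<open>\<delta>\<^sub>* \<noteq> 0\<close> the former are a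
  line if \<open>v \<cong> u\<close> and zero otherwise, and the latter vanishes by \<open>Hom(v, \<Sigma>\<^sup>d u) = 0\<close> (\<open>dual_delta\<close>). For
  \<open>N\<close> in place of \<open>M\<close> the contribution at \<open>t\<^sub>0\<close> is zero. The one at \<open>t\<^sub>d\<close> is
  zero unless \<open>v \<cong> u\<close>, by \<open>Hom(v, \<Sigma>\<^sup>d u') = 0\<close>. If \<open>v \<cong> u\<close> and \<open>\<delta>\<^sub>* = 0\<close>, then \<open>v \<cong> u \<rightarrow> \<Sigma>\<^sup>d u'\<close> factors
  through \<open>\<Sigma>\<^sup>d t\<^sub>d\<close>, which gives a line at \<open>t\<^sub>d\<close>, where the sign is \<open>(-1)\<^sup>d = -1\<close> (\<open>dual_epsilon\<close>).

  \<^emph>\<open>Uniqueness.\<close> The \<open>c\<close>-vector must also be determined by these values. From the octahedral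
  axiom one obtains pushouts of angles (\<open>angle_pushout\<close>). The pushout of two resolutions of one object
  lies in \<open>add T\<close>, where angles split, so the index is well defined (\<open>exact_complex_altsum\<close>,
  \<open>res_unique\<close>). Hence every additive \<open>f\<close> on \<open>add T\<close> extends along resolutions to all objects. The
  extension is additive on direct sums and, by repeated pushouts, on the angles whose last morphism
  is killed by \<open>F\<^sub>T\<close> (\<open>res_sum_angle\<close>). A \<open>U\<close>-resolution of \<open>\<Sigma>\<^sup>d t\<close>, rotated to
  \<open>t \<rightarrow> u\<^sub>d \<rightarrow> \<dots> \<rightarrow> u\<^sub>0 \<rightarrow> \<Sigma>\<^sup>d t\<close>, is such an angle for \<open>t\<close> in \<open>add T\<close>, so \<open>f\<close> is determined by its values on
  the indices of the indecomposables of \<open>add U\<close> (\<open>res_sum_determines\<close>, \<open>c_vector_eqI\<close>).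
\<close>

section \<open>Linear categories and biproducts\<close>

context linear_category
begin

lemma zero_in: "0 \<in> Hom C x y"
  using subspace_0[OF Hom_subspace] .

lemma add_in: "f \<in> Hom C x y \<Longrightarrow> g \<in> Hom C x y \<Longrightarrow> f + g \<in> Hom C x y"
  using subspace_add[OF Hom_subspace] .

lemma diff_in: "f \<in> Hom C x y \<Longrightarrow> g \<in> Hom C x y \<Longrightarrow> f - g \<in> Hom C x y"
  using subspace_diff[OF Hom_subspace] .

lemma minus_in: "f \<in> Hom C x y \<Longrightarrow> - f \<in> Hom C x y"
  using subspace_neg[OF Hom_subspace] .

lemma scl_in: "f \<in> Hom C x y \<Longrightarrow> scl C a f \<in> Hom C x y"
  using subspace_scale[OF Hom_subspace] .

lemma sum_in: "(\<And>i. i \<in> I \<Longrightarrow> f i \<in> Hom C x y) \<Longrightarrow> (\<Sum>i\<in>I. f i) \<in> Hom C x y"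
  using subspace_sum[OF Hom_subspace] .

lemma cmp_zero_right: "g \<in> Hom C y z \<Longrightarrow> g \<cdot> 0 = 0"
  using cmp_add_right[of 0 y y 0 g z] by (simp add: zero_in)

lemma cmp_zero_left: "f \<in> Hom C x y \<Longrightarrow> 0 \<cdot> f = 0"
  using cmp_add_left[of f x y 0 y 0] by (simp add: zero_in)

lemma cmp_minus_right: "f \<in> Hom C x y \<Longrightarrow> g \<in> Hom C y z \<Longrightarrow> g \<cdot> (- f) = - (g \<cdot> f)"
  using cmp_add_right[of f x y "- f" g z] by (simp add: minus_in cmp_zero_right eq_neg_iff_add_eq_0 add.commute)

lemma cmp_minus_left: "f \<in> Hom C x y \<Longrightarrow> g \<in> Hom C y z \<Longrightarrow> (- g) \<cdot> f = - (g \<cdot> f)"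
  using cmp_add_left[of f x y g z "- g"] by (simp add: minus_in cmp_zero_left eq_neg_iff_add_eq_0 add.commute)

lemma cmp_diff_right: "f \<in> Hom C x y \<Longrightarrow> f' \<in> Hom C x y \<Longrightarrow> g \<in> Hom C y z \<Longrightarrow>
    g \<cdot> (f - f') = g \<cdot> f - g \<cdot> f'"
  using cmp_add_right[of f x y "- f'" g z] by (simp add: minus_in cmp_minus_right)

lemma cmp_diff_left: "f \<in> Hom C x y \<Longrightarrow> g \<in> Hom C y z \<Longrightarrow> g' \<in> Hom C y z \<Longrightarrow>
    (g - g') \<cdot> f = g \<cdot> f - g' \<cdot> f"
  using cmp_add_left[of f x y g z "- g'"] by (simp add: minus_in cmp_minus_left)

lemma cmp_sum_right:
  assumes "g \<in> Hom C y z" "\<And>i. i \<in> I \<Longrightarrow> f i \<in> Hom C x y"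
  shows "g \<cdot> (\<Sum>i\<in>I. f i) = (\<Sum>i\<in>I. g \<cdot> f i)"
  using assms(2)
proof (induction I rule: infinite_finite_induct)
  case (insert j J)
  then show ?case
    using cmp_add_right[of "f j" x y "sum f J" g z] assms(1) by (simp add: sum_in)
qed (auto simp: cmp_zero_right[OF assms(1)])

lemma cmp_sum_left:
  assumes "f \<in> Hom C x y" "\<And>i. i \<in> I \<Longrightarrow> g i \<in> Hom C y z"
  shows "(\<Sum>i\<in>I. g i) \<cdot> f = (\<Sum>i\<in>I. g i \<cdot> f)"
  using assms(2)
proof (induction I rule: infinite_finite_induct)
  case (insert j J)
  then show ?case
    using cmp_add_left[of f x y "g j" z "sum g J"] assms(1) by (simp add: sum_in)
qed (auto simp: cmp_zero_left[OF assms(1)])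

lemma zero_objectD: "zero_object C z \<Longrightarrow> f \<in> Hom C z x \<Longrightarrow> f = 0"
  "zero_object C z \<Longrightarrow> f \<in> Hom C x z \<Longrightarrow> f = 0"
  by (auto simp: zero_object_def)

lemma zero_objectI:
  assumes "Id x = 0"
  shows "zero_object C x"
proof -
  have "f = 0" if "f \<in> Hom C x y" for f y
    using cmp_ident_right[OF that] cmp_zero_right[OF that] assms by simp
  moreover have "f = 0" if "f \<in> Hom C y x" for f y
    using cmp_ident_left[OF that] cmp_zero_left[OF that] assms by simp
  ultimately show ?thesis
    unfolding zero_object_def using zero_in by blast
qed

lemma zero_object_iff: "zero_object C x \<longleftrightarrow> Id x = 0"
  using zero_objectI zero_objectD(1) ident_closed by blast

definition biproduct2 :: "'o \<Rightarrow> 'o \<Rightarrow> 'o \<Rightarrow> 'm \<Rightarrow> 'm \<Rightarrow> 'm \<Rightarrow> 'm \<Rightarrow> bool" where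
  "biproduct2 x y z i j p q \<longleftrightarrow>
    i \<in> Hom C x z \<and> j \<in> Hom C y z \<and> p \<in> Hom C z x \<and> q \<in> Hom C z y \<and>
    p \<cdot> i = Id x \<and> q \<cdot> j = Id y \<and> q \<cdot> i = 0 \<and> p \<cdot> j = 0 \<and> i \<cdot> p + j \<cdot> q = Id z"

lemma biproduct2D:
  assumes "biproduct2 x y z i j p q"
  shows "i \<in> Hom C x z" "j \<in> Hom C y z" "p \<in> Hom C z x" "q \<in> Hom C z y"
    "p \<cdot> i = Id x" "q \<cdot> j = Id y" "q \<cdot> i = 0" "p \<cdot> j = 0" "i \<cdot> p + j \<cdot> q = Id z"
  using assms by (auto simp: biproduct2_def)

lemma biproduct_pair_iff:
  "biproduct C [x, y] z (\<lambda>k. [i, j] ! k) (\<lambda>k. [p, q] ! k) \<longleftrightarrow> biproduct2 x y z i j p q"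
  unfolding biproduct_def biproduct2_def
  by (simp add: numeral_2_eq_2 All_less_Suc lessThan_Suc) (auto simp: add.commute)

lemma direct_sum_pair_iff: "direct_sum C [x, y] z \<longleftrightarrow> (\<exists>i j p q. biproduct2 x y z i j p q)"
proof
  assume "direct_sum C [x, y] z"
  then obtain \<iota> \<pi> where "biproduct C [x, y] z \<iota> \<pi>" by (auto simp: direct_sum_def)
  then have "biproduct2 x y z (\<iota> 0) (\<iota> 1) (\<pi> 0) (\<pi> 1)"
    unfolding biproduct_def biproduct2_def
    by (simp add: numeral_2_eq_2 All_less_Suc lessThan_Suc) (auto simp: add.commute)
  then show "\<exists>i j p q. biproduct2 x y z i j p q" by blast
next
  assume "\<exists>i j p q. biproduct2 x y z i j p q"
  then show "direct_sum C [x, y] z"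
    by (auto simp: direct_sum_def simp flip: biproduct_pair_iff)
qed

lemma biproduct2_swap: "biproduct2 x y z i j p q \<Longrightarrow> biproduct2 y x z j i q p"
  by (auto simp: biproduct2_def add.commute)

lemma isomorphic_sym: "isomorphic C x y \<Longrightarrow> isomorphic C y x"
  unfolding isomorphic_def is_iso_def by blast

lemma isomorphicE:
  assumes "isomorphic C x y"
  obtains f g where "f \<in> Hom C x y" "g \<in> Hom C y x" "g \<cdot> f = Id x" "f \<cdot> g = Id y"
  using assms unfolding isomorphic_def is_iso_def by blast

lemma isomorphicI:
  "f \<in> Hom C x y \<Longrightarrow> g \<in> Hom C y x \<Longrightarrow> g \<cdot> f = Id x \<Longrightarrow> f \<cdot> g = Id y \<Longrightarrow> isomorphic C x y"
  unfolding isomorphic_def is_iso_def by blast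

lemma isomorphic_refl: "isomorphic C x x"
  by (rule isomorphicI[of "Id x" x x "Id x"]) (auto simp: ident_closed cmp_ident_left[OF ident_closed])

lemma section_retraction_cmp:
  assumes "i \<in> Hom C x y" "p \<in> Hom C y x" "p \<cdot> i = Id x"
    and "j \<in> Hom C y z" "q \<in> Hom C z y" "q \<cdot> j = Id y"
  shows "(p \<cdot> q) \<cdot> (j \<cdot> i) = Id x"
proof -
  have "(p \<cdot> q) \<cdot> (j \<cdot> i) = p \<cdot> (q \<cdot> (j \<cdot> i))"
    using cmp_assoc cmp_closed assms by blast
  also have "q \<cdot> (j \<cdot> i) = (q \<cdot> j) \<cdot> i"
    using cmp_assoc assms by metis
  finally show ?thesis using assms by (simp add: cmp_ident_left)
qed

lemma isomorphic_trans:
  assumes "isomorphic C x y" "isomorphic C y z"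
  shows "isomorphic C x z"
proof -
  obtain f g where fg: "f \<in> Hom C x y" "g \<in> Hom C y x" "g \<cdot> f = Id x" "f \<cdot> g = Id y"
    using assms(1) by (elim isomorphicE)
  obtain h k where hk: "h \<in> Hom C y z" "k \<in> Hom C z y" "k \<cdot> h = Id y" "h \<cdot> k = Id z"
    using assms(2) by (elim isomorphicE)
  show ?thesis
    using section_retraction_cmp[OF fg(1-3) hk(1-3)] section_retraction_cmp[OF hk(2,1,4) fg(2,1,4)] fg hk
    by (intro isomorphicI[of "h \<cdot> f" _ _ "g \<cdot> k"]) (auto intro: cmp_closed)
qed

lemma biproduct_inj_proj:
  assumes "biproduct C xs x \<iota> \<pi>" "i < length xs"
  shows "\<iota> i \<in> Hom C (xs ! i) x" "\<pi> i \<in> Hom C x (xs ! i)" "\<pi> i \<cdot> \<iota> i = Id (xs ! i)"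
  using assms by (auto simp: biproduct_def)

lemma biproduct_ortho:
  assumes "biproduct C xs x \<iota> \<pi>" "i < length xs" "j < length xs" "i \<noteq> j"
  shows "\<pi> j \<cdot> \<iota> i = 0"
  using assms by (auto simp: biproduct_def)

lemma biproduct_expand_right:
  assumes "biproduct C xs x \<iota> \<pi>" "f \<in> Hom C y x"
  shows "f = (\<Sum>i<length xs. \<iota> i \<cdot> (\<pi> i \<cdot> f))"
proof -
  note b = biproduct_inj_proj[OF assms(1)]
  have "f = (\<Sum>i<length xs. \<iota> i \<cdot> \<pi> i) \<cdot> f"
    using assms by (simp add: biproduct_def cmp_ident_left)
  also have "\<dots> = (\<Sum>i<length xs. (\<iota> i \<cdot> \<pi> i) \<cdot> f)"
    by (rule cmp_sum_left[OF assms(2)]) (use b in \<open>auto intro: cmp_closed\<close>)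
  also have "\<dots> = (\<Sum>i<length xs. \<iota> i \<cdot> (\<pi> i \<cdot> f))"
    using cmp_assoc[OF assms(2) b(2) b(1)] by (intro sum.cong) auto
  finally show ?thesis .
qed

lemma direct_sum_unique:
  assumes "direct_sum C xs x" "direct_sum C xs y"
  shows "isomorphic C x y"
proof -
  obtain \<iota> \<pi> \<iota>' \<pi>' where 1: "biproduct C xs x \<iota> \<pi>" and 2: "biproduct C xs y \<iota>' \<pi>'"
    using assms by (auto simp: direct_sum_def)
  have *: "(\<Sum>i<length xs. \<iota> i \<cdot> \<pi>' i) \<in> Hom C y x \<and>
      (\<Sum>i<length xs. \<iota>' i \<cdot> \<pi> i) \<cdot> (\<Sum>i<length xs. \<iota> i \<cdot> \<pi>' i) = Id y"
    if 1: "biproduct C xs x \<iota> \<pi>" and 2: "biproduct C xs y \<iota>' \<pi>'" for \<iota> \<pi> \<iota>' \<pi>' x y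
  proof -
    note b1 = biproduct_inj_proj[OF 1] and b2 = biproduct_inj_proj[OF 2]
    have c1: "\<iota> i \<cdot> \<pi>' i \<in> Hom C y x" "\<iota>' i \<cdot> \<pi> i \<in> Hom C x y" if "i < length xs" for i
      using cmp_closed[OF b2(2) b1(1), of i] cmp_closed[OF b1(2) b2(1), of i] that by auto
    have s: "(\<Sum>i<length xs. \<iota> i \<cdot> \<pi>' i) \<in> Hom C y x"
      using c1 by (auto intro: sum_in)
    have step: "(\<iota>' i \<cdot> \<pi> i) \<cdot> (\<iota> j \<cdot> \<pi>' j) = (if i = j then \<iota>' i \<cdot> \<pi>' i else 0)"
      if i: "i < length xs" and j: "j < length xs" for i j
    proof -
      have "(\<iota>' i \<cdot> \<pi> i) \<cdot> (\<iota> j \<cdot> \<pi>' j) = \<iota>' i \<cdot> (\<pi> i \<cdot> (\<iota> j \<cdot> \<pi>' j))"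
        using cmp_assoc[OF c1(1)[OF j] b1(2)[OF i] b2(1)[OF i]] .
      also have "\<pi> i \<cdot> (\<iota> j \<cdot> \<pi>' j) = (\<pi> i \<cdot> \<iota> j) \<cdot> \<pi>' j"
        using cmp_assoc[OF b2(2)[OF j] b1(1)[OF j] b1(2)[OF i]] by simp
      also have "\<dots> = (if i = j then \<pi>' j else 0)"
        using b1(3)[OF i] biproduct_ortho[OF 1 j i] b2(2)[OF j]
        by (auto simp: cmp_ident_left cmp_zero_left)
      finally show ?thesis using cmp_zero_right[OF b2(1)[OF i]] by auto
    qed
    have "(\<Sum>i<length xs. \<iota>' i \<cdot> \<pi> i) \<cdot> (\<Sum>i<length xs. \<iota> i \<cdot> \<pi>' i)
        = (\<Sum>i<length xs. (\<iota>' i \<cdot> \<pi> i) \<cdot> (\<Sum>j<length xs. \<iota> j \<cdot> \<pi>' j))"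
      by (rule cmp_sum_left[OF s]) (use c1 in auto)
    also have "\<dots> = (\<Sum>i<length xs. \<Sum>j<length xs. (\<iota>' i \<cdot> \<pi> i) \<cdot> (\<iota> j \<cdot> \<pi>' j))"
      by (intro sum.cong refl cmp_sum_right) (use c1 in auto)
    also have "\<dots> = (\<Sum>i<length xs. \<Sum>j<length xs. if i = j then \<iota>' i \<cdot> \<pi>' i else 0)"
      by (intro sum.cong refl) (use step in auto)
    also have "\<dots> = (\<Sum>i<length xs. \<iota>' i \<cdot> \<pi>' i)" by simp
    finally show ?thesis using s 2 by (simp add: biproduct_def)
  qed
  show ?thesis
    using *[OF 1 2] *[OF 2 1] by (auto intro: isomorphicI)
qed

lemma direct_sum_iso:
  assumes "direct_sum C xs x" "isomorphic C x y"
  shows "direct_sum C xs y"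
proof -
  obtain \<iota> \<pi> where 1: "biproduct C xs x \<iota> \<pi>"
    using assms by (auto simp: direct_sum_def)
  obtain f g where f: "f \<in> Hom C x y" "g \<in> Hom C y x" "g \<cdot> f = Id x" "f \<cdot> g = Id y"
    using assms(2) by (elim isomorphicE)
  note b = biproduct_inj_proj[OF 1]
  have "(\<pi> j \<cdot> g) \<cdot> (f \<cdot> \<iota> i) = \<pi> j \<cdot> \<iota> i" if "i < length xs" "j < length xs" for i j
  proof -
    have "(\<pi> j \<cdot> g) \<cdot> (f \<cdot> \<iota> i) = \<pi> j \<cdot> (g \<cdot> (f \<cdot> \<iota> i))"
      using cmp_assoc[OF cmp_closed f(2) b(2)] b f that by blast
    also have "g \<cdot> (f \<cdot> \<iota> i) = (g \<cdot> f) \<cdot> \<iota> i"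
      using cmp_assoc[OF b(1) f(1,2)] that by simp
    finally show ?thesis using cmp_ident_left[OF b(1)[OF that(1)]] by (simp add: f)
  qed
  moreover have "(\<Sum>i<length xs. (f \<cdot> \<iota> i) \<cdot> (\<pi> i \<cdot> g)) = Id y"
  proof -
    have g: "g = (\<Sum>i<length xs. \<iota> i \<cdot> (\<pi> i \<cdot> g))"
      by (rule biproduct_expand_right[OF 1 f(2)])
    have "f \<cdot> g = (\<Sum>i<length xs. f \<cdot> (\<iota> i \<cdot> (\<pi> i \<cdot> g)))"
      by (subst g, rule cmp_sum_right[OF f(1)]) (use b f in \<open>auto intro!: cmp_closed\<close>)
    also have "\<dots> = (\<Sum>i<length xs. (f \<cdot> \<iota> i) \<cdot> (\<pi> i \<cdot> g))"
      using cmp_assoc[OF cmp_closed[OF f(2) b(2)] b(1) f(1)] by (intro sum.cong) auto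
    finally show ?thesis using f by simp
  qed
  ultimately have "biproduct C xs y (\<lambda>i. f \<cdot> \<iota> i) (\<lambda>i. \<pi> i \<cdot> g)"
    using 1 b f unfolding biproduct_def by (auto intro: cmp_closed)
  then show ?thesis by (auto simp: direct_sum_def)
qed

end

lemma sum_lessThan_add:
  fixes f :: "nat \<Rightarrow> 'a::comm_monoid_add"
  shows "(\<Sum>k<n + m. f k) = (\<Sum>k<n. f k) + (\<Sum>k<m. f (n + k))"
  by (induction m) (auto simp: add.assoc)

context linear_category
begin

lemma cmp_section_retraction:
  assumes "r \<in> Hom C a w" "l \<in> Hom C w b" "i \<in> Hom C w x" "p \<in> Hom C x w"
  shows "(l \<cdot> p) \<cdot> (i \<cdot> r) = l \<cdot> ((p \<cdot> i) \<cdot> r)"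
proof -
  have "(l \<cdot> p) \<cdot> (i \<cdot> r) = l \<cdot> (p \<cdot> (i \<cdot> r))"
    using cmp_assoc[OF cmp_closed[OF assms(1,3)] assms(4,2)] .
  also have "p \<cdot> (i \<cdot> r) = (p \<cdot> i) \<cdot> r"
    using cmp_assoc[OF assms(1,3,4)] by simp
  finally show ?thesis .
qed

lemma direct_sum_append:
  assumes "direct_sum C xs x" "direct_sum C ys y" "direct_sum C [x, y] z"
  shows "direct_sum C (xs @ ys) z"
proof -
  obtain \<iota> \<pi> \<iota>' \<pi>' where 1: "biproduct C xs x \<iota> \<pi>" and 2: "biproduct C ys y \<iota>' \<pi>'"
    using assms by (auto simp: direct_sum_def)
  obtain i j p q where bip: "biproduct2 x y z i j p q"
    using assms(3) by (auto simp: direct_sum_pair_iff)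
  note h = biproduct2D(1-4)[OF bip] and e = biproduct2D(5-9)[OF bip]
  note b1 = biproduct_inj_proj[OF 1] and b2 = biproduct_inj_proj[OF 2]
  let ?n = "length xs" and ?m = "length ys"
  define I where "I k = (if k < ?n then i \<cdot> \<iota> k else j \<cdot> \<iota>' (k - ?n))" for k
  define P where "P k = (if k < ?n then \<pi> k \<cdot> p else \<pi>' (k - ?n) \<cdot> q)" for k
  have ty: "I k \<in> Hom C ((xs @ ys) ! k) z" "P k \<in> Hom C z ((xs @ ys) ! k)" if "k < ?n + ?m" for k
    using that cmp_closed[OF b1(1) h(1), of k] cmp_closed[OF b2(1) h(2), of "k - ?n"]
      cmp_closed[OF h(3) b1(2), of k] cmp_closed[OF h(4) b2(2), of "k - ?n"]
    by (auto simp: I_def P_def nth_append)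
  have pp: "(\<pi> l \<cdot> p) \<cdot> (i \<cdot> \<iota> k) = \<pi> l \<cdot> \<iota> k" if "l < ?n" "k < ?n" for k l
    using cmp_section_retraction[OF b1(1)[OF that(2)] b1(2)[OF that(1)] h(1,3)] b1 that
    by (simp add: e cmp_ident_left[OF b1(1)[OF that(2)]])
  have qq: "(\<pi>' l \<cdot> q) \<cdot> (j \<cdot> \<iota>' k) = \<pi>' l \<cdot> \<iota>' k" if "l < ?m" "k < ?m" for k l
    using cmp_section_retraction[OF b2(1)[OF that(2)] b2(2)[OF that(1)] h(2,4)] b2 that
    by (simp add: e cmp_ident_left[OF b2(1)[OF that(2)]])
  have zero: "(l \<cdot> s) \<cdot> (t \<cdot> r) = 0"
    if "l \<in> Hom C c d" "s \<in> Hom C b c" "t \<in> Hom C a b" "r \<in> Hom C a' a" "s \<cdot> t = 0"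
    for l s t r a' a b c d
    using cmp_assoc[OF cmp_closed[OF that(4,3)] that(2,1)] cmp_assoc[OF that(4,3,2)] that(5)
      cmp_zero_left[OF that(4)] cmp_zero_right[OF that(1)] by simp
  have ortho: "P l \<cdot> I k = (if k = l then Id ((xs @ ys) ! k) else 0)" if k: "k < ?n + ?m" and l: "l < ?n + ?m" for k l
  proof (cases "k < ?n"; cases "l < ?n")
    assume *: "k < ?n" "l < ?n"
    show ?thesis using pp[OF *(2,1)] b1(3) biproduct_ortho[OF 1 *] * by (auto simp: I_def P_def nth_append)
  next
    assume *: "k < ?n" "\<not> l < ?n"
    then show ?thesis
      using zero[OF b2(2) h(4) h(1) b1(1), of "l - ?n" k] l e by (auto simp: I_def P_def)
  next
    assume *: "\<not> k < ?n" "l < ?n"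
    then show ?thesis
      using zero[OF b1(2) h(3) h(2) b2(1), of l "k - ?n"] k e by (auto simp: I_def P_def)
  next
    assume *: "\<not> k < ?n" "\<not> l < ?n"
    then have **: "k - ?n < ?m" "l - ?n < ?m" using k l by auto
    show ?thesis using qq[OF **(2,1)] b2(3)[OF **(1)] biproduct_ortho[OF 2 **] *
      by (auto simp: I_def P_def nth_append)
  qed
  have 3: "(\<Sum>k<?n. (i \<cdot> \<iota> k) \<cdot> (\<pi> k \<cdot> p)) = i \<cdot> p"
  proof -
    have "i \<cdot> p = i \<cdot> (\<Sum>k<?n. \<iota> k \<cdot> (\<pi> k \<cdot> p))"
      using biproduct_expand_right[OF 1 h(3)] by simp
    also have "\<dots> = (\<Sum>k<?n. i \<cdot> (\<iota> k \<cdot> (\<pi> k \<cdot> p)))"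
      by (rule cmp_sum_right[OF h(1)]) (use b1 h in \<open>auto intro!: cmp_closed\<close>)
    also have "\<dots> = (\<Sum>k<?n. (i \<cdot> \<iota> k) \<cdot> (\<pi> k \<cdot> p))"
      using cmp_assoc[OF cmp_closed[OF h(3) b1(2)] b1(1) h(1)] by (intro sum.cong) auto
    finally show ?thesis by simp
  qed
  have 4: "(\<Sum>k<?m. (j \<cdot> \<iota>' k) \<cdot> (\<pi>' k \<cdot> q)) = j \<cdot> q"
  proof -
    have "j \<cdot> q = j \<cdot> (\<Sum>k<?m. \<iota>' k \<cdot> (\<pi>' k \<cdot> q))"
      using biproduct_expand_right[OF 2 h(4)] by simp
    also have "\<dots> = (\<Sum>k<?m. j \<cdot> (\<iota>' k \<cdot> (\<pi>' k \<cdot> q)))"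
      by (rule cmp_sum_right[OF h(2)]) (use b2 h in \<open>auto intro!: cmp_closed\<close>)
    also have "\<dots> = (\<Sum>k<?m. (j \<cdot> \<iota>' k) \<cdot> (\<pi>' k \<cdot> q))"
      using cmp_assoc[OF cmp_closed[OF h(4) b2(2)] b2(1) h(2)] by (intro sum.cong) auto
    finally show ?thesis by simp
  qed
  have "(\<Sum>k<?n + ?m. I k \<cdot> P k) = i \<cdot> p + j \<cdot> q"
    unfolding sum_lessThan_add 3[symmetric] 4[symmetric] by (simp add: I_def P_def)
  then have "biproduct C (xs @ ys) z I P"
    unfolding biproduct_def using ty ortho e by auto
  then show ?thesis by (auto simp: direct_sum_def)
qed

lemma direct_sum_Nil_iff: "direct_sum C [] z \<longleftrightarrow> zero_object C z"
  by (auto simp: direct_sum_def biproduct_def zero_object_iff)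

lemma direct_sum_single: "direct_sum C [x] x"
  unfolding direct_sum_def biproduct_def
  by (intro exI[of _ "\<lambda>_. Id x"]) (auto simp: ident_closed cmp_ident_left[OF ident_closed])

lemma biproduct2_zero: "zero_object C z \<Longrightarrow> biproduct2 x z x (Id x) 0 (Id x) 0"
  by (auto simp: biproduct2_def ident_closed zero_in cmp_ident_left[OF ident_closed] zero_object_iff
      cmp_ident_left[OF zero_in] cmp_ident_right[OF zero_in] cmp_zero_left[OF zero_in]
      cmp_zero_left[OF ident_closed] cmp_zero_right[OF ident_closed])

lemma direct_sum_zero: "zero_object C z \<Longrightarrow> isomorphic C x y \<Longrightarrow> direct_sum C [x, z] y"
  using biproduct2_zero direct_sum_iso direct_sum_pair_iff by metis

lemma direct_sum_zeroD: "zero_object C z \<Longrightarrow> direct_sum C [x, z] y \<Longrightarrow> isomorphic C x y"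
  using direct_sum_zero[OF _ isomorphic_refl] direct_sum_unique by metis

lemma direct_sum_pair_swap: "direct_sum C [x, y] z \<Longrightarrow> direct_sum C [y, x] z"
  using biproduct2_swap direct_sum_pair_iff by metis

end

context additive_linear_category
begin

lemma ex_direct_sum_list: "\<exists>x. direct_sum C xs x"
proof (induction xs)
  case Nil
  then show ?case using ex_zero_object by (auto simp: direct_sum_Nil_iff)
next
  case (Cons a xs)
  then obtain x where "direct_sum C xs x" by blast
  moreover obtain z where "direct_sum C [a, x] z" using ex_direct_sum by blast
  ultimately show ?case using direct_sum_append[OF direct_sum_single, of xs x a z] by auto
qed

lemma direct_sum_regroup:
  assumes "direct_sum C (xs @ ys) z" "direct_sum C xs x" "direct_sum C ys y"
  shows "direct_sum C [x, y] z"
  using assms direct_sum_append direct_sum_unique direct_sum_iso ex_direct_sum by metis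

lemma direct_sum_swap:
  assumes "direct_sum C (as @ xs @ ys @ bs) z"
  shows "direct_sum C (as @ ys @ xs @ bs) z"
proof -
  obtain a b x y xy r where 1: "direct_sum C as a" "direct_sum C bs b" "direct_sum C xs x"
    "direct_sum C ys y" "direct_sum C [x, y] xy" "direct_sum C [xy, b] r"
    using ex_direct_sum_list ex_direct_sum by metis
  have "direct_sum C (xs @ ys) xy" "direct_sum C (ys @ xs) xy"
    using direct_sum_append 1 direct_sum_pair_swap by blast+
  then have 2: "direct_sum C (xs @ ys @ bs) r" "direct_sum C (ys @ xs @ bs) r"
    using direct_sum_append 1 by (metis append.assoc)+
  then have "direct_sum C [a, r] z"
    using direct_sum_regroup[OF assms] 1 by simp
  then show ?thesis
    using direct_sum_append 1 2 by blast
qed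

lemma summand_nth:
  assumes "direct_sum C xs x" "i < length xs"
  shows "summand C (xs ! i) x"
proof -
  have "xs = take i xs @ [xs ! i] @ drop (Suc i) xs"
    using assms(2) by (simp add: id_take_nth_drop)
  then have "direct_sum C ([] @ take i xs @ [xs ! i] @ drop (Suc i) xs) x"
    using assms(1) by simp
  then have "direct_sum C ([xs ! i] @ take i xs @ drop (Suc i) xs) x"
    using direct_sum_swap[of "[]" "take i xs" "[xs ! i]" "drop (Suc i) xs"] by simp
  moreover obtain y where "direct_sum C (take i xs @ drop (Suc i) xs) y"
    using ex_direct_sum_list by blast
  ultimately show ?thesis
    using direct_sum_regroup direct_sum_single unfolding summand_def by blast
qed

lemma summand_trans:
  assumes "summand C x y" "summand C y w"
  shows "summand C x w"
proof -
  obtain a b where 1: "direct_sum C [x, a] y" "direct_sum C [y, b] w"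
    using assms by (auto simp: summand_def)
  then have "direct_sum C ([x] @ [a, b]) w"
    using direct_sum_append[OF 1(1) direct_sum_single 1(2)] by simp
  moreover obtain c where "direct_sum C [a, b] c"
    using ex_direct_sum by blast
  ultimately show ?thesis
    using direct_sum_regroup direct_sum_single unfolding summand_def by blast
qed

lemma summand_iso: "isomorphic C x y \<Longrightarrow> summand C x y"
  using direct_sum_zero ex_zero_object unfolding summand_def by blast

lemma addcatI_power: "direct_sum C (replicate n x) w \<Longrightarrow> w \<in> addcat C x"
  unfolding addcat_def using summand_iso isomorphic_refl by blast

lemma addcat_summand: "x \<in> addcat C t \<Longrightarrow> summand C y x \<Longrightarrow> y \<in> addcat C t"
  unfolding addcat_def using summand_trans by blast

lemma addcat_iso: "x \<in> addcat C t \<Longrightarrow> isomorphic C x y \<Longrightarrow> y \<in> addcat C t"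
  using addcat_summand summand_iso isomorphic_sym by blast

lemma addcat_zero: "zero_object C z \<Longrightarrow> z \<in> addcat C t"
  using addcatI_power[of 0] by (simp add: direct_sum_Nil_iff)

lemma addcat_self: "t \<in> addcat C t"
  using addcatI_power[of 1] by (simp add: direct_sum_single)

lemma addcat_sum:
  assumes "x \<in> addcat C t" "y \<in> addcat C t" "direct_sum C [x, y] z"
  shows "z \<in> addcat C t"
proof -
  obtain n w x' where 1: "direct_sum C (replicate n t) w" "direct_sum C [x, x'] w"
    using assms(1) by (auto simp: addcat_def summand_def)
  obtain m v y' where 2: "direct_sum C (replicate m t) v" "direct_sum C [y, y'] v"
    using assms(2) by (auto simp: addcat_def summand_def)
  obtain s z' where 3: "direct_sum C [w, v] s" "direct_sum C [x', y'] z'"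
    using ex_direct_sum by metis
  have "direct_sum C ([x] @ [x'] @ [y] @ [y']) s"
    using direct_sum_append[OF 1(2) 2(2) 3(1)] by simp
  then have "direct_sum C ([x, y] @ [x', y']) s"
    using direct_sum_swap[of "[x]" "[x']" "[y]" "[y']"] by auto
  then have "direct_sum C [z, z'] s"
    using direct_sum_regroup assms(3) 3(2) by blast
  moreover have "direct_sum C (replicate (n + m) t) s"
    using direct_sum_append[OF 1(1) 2(1) 3(1)] by (simp add: replicate_add)
  ultimately show ?thesis
    using addcatI_power addcat_summand unfolding summand_def by blast
qed

lemma addcat_direct_sum: "direct_sum C xs x \<Longrightarrow> set xs \<subseteq> addcat C t \<Longrightarrow> x \<in> addcat C t"
proof (induction xs arbitrary: x)
  case Nil
  then show ?case using addcat_zero by (simp add: direct_sum_Nil_iff)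
next
  case (Cons a xs)
  obtain y where y: "direct_sum C xs y" using ex_direct_sum_list by blast
  then have "direct_sum C [a, y] x"
    using direct_sum_regroup[of "[a]" xs x a y] Cons.prems(1) direct_sum_single by simp
  then show ?case using addcat_sum[of a t y x] Cons.IH[OF y] Cons.prems(2) by simp
qed

text \<open>A member of \<open>add t\<close> is a retract of a power of \<open>t\<close>, written here as a partition of its identity.\<close>

lemma addcat_retract:
  assumes "x \<in> addcat C t"
  shows "\<exists>(n :: nat) a b. (\<forall>k<n. a k \<in> Hom C t x \<and> b k \<in> Hom C x t) \<and> (\<Sum>k<n. a k \<cdot> b k) = Id x"
proof -
  obtain n w y where 1: "direct_sum C (replicate n t) w" "direct_sum C [x, y] w"
    using assms by (auto simp: addcat_def summand_def)
  obtain \<iota> \<pi> where 2: "biproduct C (replicate n t) w \<iota> \<pi>"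
    using 1(1) unfolding direct_sum_def by blast
  obtain i j p q where "biproduct2 x y w i j p q"
    using 1(2) by (auto simp: direct_sum_pair_iff)
  then have h: "i \<in> Hom C x w" "p \<in> Hom C w x" "p \<cdot> i = Id x"
    by (auto simp: biproduct2_def)
  have b: "\<iota> k \<in> Hom C t w" "\<pi> k \<in> Hom C w t" if "k < n" for k
    using biproduct_inj_proj[OF 2, of k] that by auto
  have "p \<cdot> i = p \<cdot> (\<Sum>k<n. \<iota> k \<cdot> (\<pi> k \<cdot> i))"
    using biproduct_expand_right[OF 2 h(1)] by simp
  also have "\<dots> = (\<Sum>k<n. p \<cdot> (\<iota> k \<cdot> (\<pi> k \<cdot> i)))"
    by (rule cmp_sum_right[OF h(2)]) (use b h in \<open>auto intro!: cmp_closed\<close>)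
  also have "\<dots> = (\<Sum>k<n. (p \<cdot> \<iota> k) \<cdot> (\<pi> k \<cdot> i))"
    using cmp_assoc[OF cmp_closed[OF h(1) b(2)] b(1) h(2)] by (intro sum.cong) auto
  finally show ?thesis
    using b h by (intro exI[of _ n] exI[of _ "\<lambda>k. p \<cdot> \<iota> k"] exI[of _ "\<lambda>k. \<pi> k \<cdot> i"])
      (auto intro: cmp_closed)
qed

end

section \<open>Indecomposable objects of Krull-Schmidt categories\<close>

context additive_linear_category
begin

lemma idempotent_iso:
  assumes "is_iso C x x e" "e \<cdot> e = e"
  shows "e = Id x"
proof -
  obtain g where e: "e \<in> Hom C x x" and g: "g \<in> Hom C x x" "g \<cdot> e = Id x"
    using assms(1) by (auto simp: is_iso_def)
  have "e = (g \<cdot> e) \<cdot> e" using e g cmp_ident_left by simp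
  also have "\<dots> = g \<cdot> (e \<cdot> e)" using cmp_assoc e g by blast
  finally show ?thesis using assms g by simp
qed

lemma local_End_idempotent:
  assumes "local_End C x" "e \<in> Hom C x x" "e \<cdot> e = e"
  shows "e = 0 \<or> e = Id x"
proof -
  have *: "Id x - e \<in> Hom C x x" using diff_in ident_closed assms by blast
  have "is_iso C x x (Id x)"
    unfolding is_iso_def using ident_closed cmp_ident_left by blast
  then have "is_iso C x x (e + (Id x - e))" by simp
  then consider "is_iso C x x e" | "is_iso C x x (Id x - e)"
    using assms * unfolding local_End_def by blast
  then show ?thesis
  proof cases
    case 2
    have "(Id x - e) \<cdot> (Id x - e) = Id x - e"
      using cmp_diff_left[OF * ident_closed assms(2)] cmp_diff_right[OF ident_closed assms(2,2)]
        cmp_ident_left[OF *] cmp_ident_right[OF assms(2)] assms(3) by simp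
    then have "Id x - e = Id x" using idempotent_iso[OF 2] by blast
    then show ?thesis by simp
  qed (use idempotent_iso assms in blast)
qed

lemma local_End_indecomposable:
  assumes "local_End C x"
  shows "indecomposable C x"
  unfolding indecomposable_def
proof (intro conjI allI impI)
  show "\<not> zero_object C x" using assms by (simp add: local_End_def zero_object_iff)
next
  fix y z assume "direct_sum C [y, z] x"
  then obtain i j p q where bip: "biproduct2 y z x i j p q"
    by (auto simp: direct_sum_pair_iff)
  note h = biproduct2D(1-4)[OF bip] and e = biproduct2D(5-9)[OF bip]
  have "(i \<cdot> p) \<cdot> (i \<cdot> p) = i \<cdot> p"
    using cmp_section_retraction[OF h(3,1,1,3)] e h cmp_ident_left by simp
  then consider "i \<cdot> p = 0" | "i \<cdot> p = Id x"
    using local_End_idempotent[OF assms cmp_closed[OF h(3,1)]] by blast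
  then show "zero_object C y \<or> zero_object C z"
  proof cases
    case 1
    have "(p \<cdot> i) \<cdot> (p \<cdot> i) = p \<cdot> ((i \<cdot> p) \<cdot> i)"
      by (rule cmp_section_retraction[OF h(1,3,3,1)])
    also have "\<dots> = 0" using 1 h cmp_zero_left cmp_zero_right by simp
    finally show ?thesis using e by (simp add: zero_object_iff cmp_ident_left[OF ident_closed])
  next
    case 2
    then have "j \<cdot> q = 0" using e by simp
    moreover have "(q \<cdot> j) \<cdot> (q \<cdot> j) = q \<cdot> ((j \<cdot> q) \<cdot> j)"
      by (rule cmp_section_retraction[OF h(2,4,4,2)])
    ultimately have "(q \<cdot> j) \<cdot> (q \<cdot> j) = 0" using h cmp_zero_left cmp_zero_right by simp
    then show ?thesis using e by (simp add: zero_object_iff cmp_ident_left[OF ident_closed])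
  qed
qed

lemma indecomposable_iso_local:
  assumes "krull_schmidt C" "indecomposable C y"
  obtains a where "local_End C a" "isomorphic C a y"
proof -
  obtain xs where xs: "direct_sum C xs y" "\<forall>x\<in>set xs. local_End C x"
    using assms(1) by (auto simp: krull_schmidt_def)
  show thesis
  proof (cases xs)
    case Nil
    then show ?thesis using xs assms(2) by (simp add: direct_sum_Nil_iff indecomposable_def)
  next
    case (Cons a as)
    obtain s where "direct_sum C as s" using ex_direct_sum_list by blast
    then have 1: "direct_sum C [a, s] y"
      using direct_sum_regroup[of "[a]" as y a s] xs(1) Cons direct_sum_single by simp
    have "\<not> zero_object C a" using xs(2) Cons by (simp add: local_End_def zero_object_iff)
    then have "zero_object C s" using assms(2) 1 by (auto simp: indecomposable_def)
    then show ?thesis using that[of a] direct_sum_zeroD[OF _ 1] xs(2) Cons by simp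
  qed
qed

lemma local_End_sum:
  assumes "local_End C x" "finite I" "\<And>i. i \<in> I \<Longrightarrow> f i \<in> Hom C x x" "is_iso C x x (\<Sum>i\<in>I. f i)"
  shows "\<exists>i\<in>I. is_iso C x x (f i)"
  using assms(2-)
proof (induction I)
  case empty
  then obtain g where g: "g \<in> Hom C x x" "g \<cdot> 0 = Id x"
    by (auto simp: is_iso_def)
  then show ?case using assms(1) cmp_zero_right[OF g(1)] by (simp add: local_End_def)
next
  case (insert j J)
  then have "is_iso C x x (f j) \<or> is_iso C x x (\<Sum>i\<in>J. f i)"
    using assms(1) sum_in[of J f x x] unfolding local_End_def by simp
  then show ?case using insert by auto
qed

text \<open>
  The retraction gives an idempotent of \<open>y\<close>, which is trivial as \<open>y\<close> has a local endomorphism ring.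
\<close>

lemma local_End_retract_iso:
  assumes "local_End C x" "local_End C y" "f \<in> Hom C x y" "g \<in> Hom C y x" "is_iso C x x (g \<cdot> f)"
  shows "isomorphic C x y"
proof -
  obtain h where h: "h \<in> Hom C x x" "h \<cdot> (g \<cdot> f) = Id x"
    using assms(5) by (auto simp: is_iso_def)
  define s where "s = h \<cdot> g"
  have s: "s \<in> Hom C y x" "s \<cdot> f = Id x"
    unfolding s_def using cmp_closed[OF assms(4) h(1)] cmp_assoc[OF assms(3,4) h(1)] h by auto
  have "(f \<cdot> s) \<cdot> (f \<cdot> s) = f \<cdot> s"
    using cmp_section_retraction[OF s(1) assms(3) assms(3) s(1)] s cmp_ident_left by simp
  then consider "f \<cdot> s = 0" | "f \<cdot> s = Id y"
    using local_End_idempotent[OF assms(2) cmp_closed[OF s(1) assms(3)]] by blast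
  then show ?thesis
  proof cases
    case 1
    have "(s \<cdot> f) \<cdot> (s \<cdot> f) = s \<cdot> ((f \<cdot> s) \<cdot> f)"
      by (rule cmp_section_retraction[OF assms(3) s(1) s(1) assms(3)])
    also have "\<dots> = 0" using 1 cmp_zero_left[OF assms(3)] cmp_zero_right[OF s(1)] by simp
    finally have "Id x = 0" using s by (simp add: cmp_ident_left[OF ident_closed])
    then show ?thesis using assms(1) by (simp add: local_End_def)
  next
    case 2
    then show ?thesis using isomorphicI assms(3) s by blast
  qed
qed

text \<open>
  The identity of \<open>v\<close> is a sum of maps through the indecomposable summands of \<open>x\<close>. By locality one of
  these maps is invertible, and \<open>v\<close> is isomorphic to that summand.
\<close>

lemma indecomposable_in_addcat:
  assumes "krull_schmidt C" "v \<in> addcat C x" "indecomposable C v"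
  shows "summand C v x"
proof -
  obtain a where a: "local_End C a" "isomorphic C a v"
    using indecomposable_iso_local assms by blast
  have "a \<in> addcat C x"
    using addcat_iso assms(2) a(2) isomorphic_sym by blast
  then obtain n :: nat and l r where "\<forall>k<n. l k \<in> Hom C x a \<and> r k \<in> Hom C a x"
    and lr3: "(\<Sum>k<n. l k \<cdot> r k) = Id a"
    using addcat_retract by blast
  then have lr: "\<And>k. k < n \<Longrightarrow> l k \<in> Hom C x a" "\<And>k. k < n \<Longrightarrow> r k \<in> Hom C a x"
    by auto
  obtain xs \<iota> \<pi> where xs: "biproduct C xs x \<iota> \<pi>" "\<forall>y\<in>set xs. local_End C y"
    using assms(1) unfolding krull_schmidt_def direct_sum_def by blast
  note b = biproduct_inj_proj[OF xs(1)]
  have "is_iso C a a (\<Sum>k<n. l k \<cdot> r k)"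
    unfolding lr3 is_iso_def using ident_closed cmp_ident_left by blast
  then obtain k where k: "k < n" "is_iso C a a (l k \<cdot> r k)"
    using local_End_sum[OF a(1), of "{..<n}" "\<lambda>k. l k \<cdot> r k"] lr by (auto intro: cmp_closed)
  have "r k = (\<Sum>i<length xs. \<iota> i \<cdot> (\<pi> i \<cdot> r k))"
    by (rule biproduct_expand_right[OF xs(1) lr(2)[OF k(1)]])
  then have "l k \<cdot> r k = l k \<cdot> (\<Sum>i<length xs. \<iota> i \<cdot> (\<pi> i \<cdot> r k))" by simp
  also have "\<dots> = (\<Sum>i<length xs. l k \<cdot> (\<iota> i \<cdot> (\<pi> i \<cdot> r k)))"
    by (rule cmp_sum_right[OF lr(1)]) (use b lr k in \<open>auto intro!: cmp_closed\<close>)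
  also have "\<dots> = (\<Sum>i<length xs. (l k \<cdot> \<iota> i) \<cdot> (\<pi> i \<cdot> r k))"
    using cmp_assoc[OF cmp_closed[OF lr(2)[OF k(1)] b(2)] b(1) lr(1)[OF k(1)]] by (intro sum.cong) auto
  finally have sum: "l k \<cdot> r k = (\<Sum>i<length xs. (l k \<cdot> \<iota> i) \<cdot> (\<pi> i \<cdot> r k))" .
  have ty: "l k \<cdot> \<iota> i \<in> Hom C (xs ! i) a" "\<pi> i \<cdot> r k \<in> Hom C a (xs ! i)" if "i < length xs" for i
    using cmp_closed[OF b(1)[OF that] lr(1)[OF k(1)]] cmp_closed[OF lr(2)[OF k(1)] b(2)[OF that]] by auto
  then have "(l k \<cdot> \<iota> i) \<cdot> (\<pi> i \<cdot> r k) \<in> Hom C a a" if "i < length xs" for i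
    using cmp_closed that by blast
  then have "\<exists>i\<in>{..<length xs}. is_iso C a a ((l k \<cdot> \<iota> i) \<cdot> (\<pi> i \<cdot> r k))"
    using k(2) unfolding sum by (intro local_End_sum[OF a(1)]) simp_all
  then obtain i where i: "i < length xs" "is_iso C a a ((l k \<cdot> \<iota> i) \<cdot> (\<pi> i \<cdot> r k))"
    by auto
  have "isomorphic C a (xs ! i)"
    using local_End_retract_iso[OF a(1) _ ty(2)[OF i(1)] ty(1)[OF i(1)] i(2)] xs(2) i(1) by simp
  then have "isomorphic C v (xs ! i)"
    using a isomorphic_sym isomorphic_trans by blast
  moreover have "summand C (xs ! i) x"
    using summand_nth xs(1) i(1) unfolding direct_sum_def by blast
  ultimately show ?thesis using summand_iso summand_trans by blast
qed

lemma addcat_decompose: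
  assumes "krull_schmidt C" "x \<in> addcat C t"
  obtains xs where "direct_sum C xs x" "set xs \<subseteq> Indec C (addcat C t)"
proof -
  obtain xs where xs: "direct_sum C xs x" "\<forall>y\<in>set xs. local_End C y"
    using assms(1) by (auto simp: krull_schmidt_def)
  have "y \<in> Indec C (addcat C t)" if "y \<in> set xs" for y
    using that xs local_End_indecomposable summand_nth[OF xs(1)] addcat_summand[OF assms(2)]
    by (auto simp: Indec_def in_set_conv_nth)
  then show ?thesis using that xs(1) by blast
qed

end

section \<open>Angles as helices\<close>

context angulated_category
begin

lemma sh_in: "f \<in> Hom C x y \<Longrightarrow> shM C f \<in> Hom C (shO C x) (shO C y)"
  and sh_cmp: "f \<in> Hom C x y \<Longrightarrow> g \<in> Hom C y z \<Longrightarrow> shM C (g \<cdot> f) = shM C g \<cdot> shM C f"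
  and sh_ident: "shM C (Id x) = Id (shO C x)"
  and sh_add: "f \<in> Hom C x y \<Longrightarrow> g \<in> Hom C x y \<Longrightarrow> shM C (f + g) = shM C f + shM C g"
  and sh_scl: "f \<in> Hom C x y \<Longrightarrow> shM C (scl C c f) = scl C c (shM C f)"
  and bij_shO: "bij (shO C)"
  and bij_shM: "bij_betw (shM C) (Hom C x y) (Hom C (shO C x) (shO C y))"
  using shift unfolding linear_automorphism_def is_functor_def by blast+

lemma sh_surj: "h \<in> Hom C (shO C x) (shO C y) \<Longrightarrow> \<exists>f\<in>Hom C x y. h = shM C f"
  using bij_betw_imp_surj_on[OF bij_shM, of x y] by blast

lemma sh_eq_iff: "f \<in> Hom C x y \<Longrightarrow> g \<in> Hom C x y \<Longrightarrow> shM C f = shM C g \<longleftrightarrow> f = g"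
  using bij_betw_imp_inj_on[OF bij_shM, of x y] by (auto simp: inj_on_def)

lemma shO_eq_iff: "shO C x = shO C y \<longleftrightarrow> x = y"
  using bij_shO by (simp add: bij_def inj_def) blast

lemma shO_surj: "\<exists>x. y = shO C x"
  using bij_shO by (metis bij_pointE)

lemma sh_zero: "shM C 0 = 0"
  using sh_add[OF zero_in zero_in] by simp

lemma sh_minus: "f \<in> Hom C x y \<Longrightarrow> shM C (- f) = - shM C f"
  using sh_add[of f x y "- f"] by (simp add: minus_in sh_zero eq_neg_iff_add_eq_0 add.commute)

lemma sh_diff: "f \<in> Hom C x y \<Longrightarrow> g \<in> Hom C x y \<Longrightarrow> shM C (f - g) = shM C f - shM C g"
  using sh_add[of f x y "- g"] by (simp add: minus_in sh_minus)

lemma sh_biproduct2: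
  assumes "biproduct2 x y z i j p q"
  shows "biproduct2 (shO C x) (shO C y) (shO C z) (shM C i) (shM C j) (shM C p) (shM C q)"
proof -
  note h = biproduct2D(1-4)[OF assms] and e = biproduct2D(5-9)[OF assms]
  have "shM C i \<cdot> shM C p + shM C j \<cdot> shM C q = shM C (i \<cdot> p + j \<cdot> q)"
    using sh_add[of "i \<cdot> p" z z "j \<cdot> q"] cmp_closed h by (simp add: sh_cmp[OF h(3,1)] sh_cmp[OF h(4,2)])
  then show ?thesis
    unfolding biproduct2_def using h sh_in
    by (simp add: sh_cmp[OF h(1,3), symmetric] sh_cmp[OF h(2,4), symmetric] sh_cmp[OF h(1,4), symmetric]
        sh_cmp[OF h(2,3), symmetric] e sh_ident sh_zero)
qed

abbreviation eps :: 'k where "eps \<equiv> (-1) ^ d"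

lemma scl_eps_eps: "scl C eps (scl C eps f) = f"
  by (simp add: flip: power_mult_distrib)

text \<open>
  A \<open>\<Sigma>\<^sup>d\<close>-sequence as two functions, whose values beyond the indices \<open>d + 2\<close> and \<open>d + 1\<close> do not matter.
\<close>

definition closed_seq :: "(nat \<Rightarrow> 'o) \<Rightarrow> (nat \<Rightarrow> 'm) \<Rightarrow> bool" where
  "closed_seq x m \<longleftrightarrow> x (d + 2) = shO C (x 0) \<and> (\<forall>i\<le>d + 1. m i \<in> Hom C (x i) (x (Suc i)))"

text \<open>
  A \<open>\<Sigma>\<^sup>d\<close>-sequence together with all its left rotations: the window of length \<open>d + 2\<close> at \<open>k\<close> is the
  \<open>k\<close>-th rotation. The sign is the one of the rotation axiom.
\<close>

definition helix :: "(nat \<Rightarrow> 'o) \<Rightarrow> (nat \<Rightarrow> 'm) \<Rightarrow> bool" where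
  "helix x m \<longleftrightarrow> (\<forall>i. m i \<in> Hom C (x i) (x (Suc i)) \<and>
     x (i + (d + 2)) = shO C (x i) \<and> m (i + (d + 2)) = scl C eps (shM C (m i)))"

definition window :: "nat \<Rightarrow> (nat \<Rightarrow> 'o) \<Rightarrow> (nat \<Rightarrow> 'm) \<Rightarrow> ('o, 'm) seq" where
  "window k x m = (map (\<lambda>i. x (k + i)) [0..<d + 2], map (\<lambda>i. m (k + i)) [0..<d + 2])"

definition angle :: "(nat \<Rightarrow> 'o) \<Rightarrow> (nat \<Rightarrow> 'm) \<Rightarrow> bool" where
  "angle x m \<longleftrightarrow> helix x m \<and> window 0 x m \<in> angles C"

lemma helixD:
  assumes "helix x m"
  shows "m i \<in> Hom C (x i) (x (Suc i))" "x (i + (d + 2)) = shO C (x i)"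
    "m (i + (d + 2)) = scl C eps (shM C (m i))"
  using assms unfolding helix_def by auto

lemma angle_helix: "angle x m \<Longrightarrow> helix x m"
  by (simp add: angle_def)

lemmas angle_in = helixD(1)[OF angle_helix]

lemma angle_shO:
  assumes "angle x m"
  shows "k = i + (d + 2) \<Longrightarrow> x k = shO C (x i)"
    "k = i + (d + 2) \<Longrightarrow> m k = scl C eps (shM C (m i))"
  using helixD[OF angle_helix[OF assms]] by auto

lemma helix_closed_seq: "helix x m \<Longrightarrow> closed_seq x m"
  unfolding closed_seq_def using helixD(1)[of x m] helixD(2)[of x m 0] by simp

lemma is_seq_closed: "closed_seq x m \<Longrightarrow> is_seq C d (window 0 x m)"
  unfolding closed_seq_def is_seq_def window_def by (auto simp: nth_append simp del: upt_Suc)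

lemma is_seq_window:
  assumes "helix x m"
  shows "is_seq C d (window k x m)"
proof -
  have "closed_seq (\<lambda>i. x (k + i)) (\<lambda>i. m (k + i))"
    unfolding closed_seq_def using helixD(1)[OF assms] helixD(2)[OF assms, of k]
    by (simp add: add.assoc)
  from is_seq_closed[OF this] show ?thesis by (simp add: window_def)
qed

lemma map_upt_shift: "map (\<lambda>i. f (k + i)) [0..<n] = map f [k..<k + n]"
  by (rule nth_equalityI) auto

lemma rotate_window:
  assumes "helix x m"
  shows "rotate_left C d (window k x m) = window (Suc k) x m"
proof -
  have u: "[k..<k + (d + 2)] = k # [Suc k..<k + (d + 2)]" "[Suc k..<Suc k + (d + 2)] = [Suc k..<k + (d + 2)] @ [k + (d + 2)]"
    by (auto simp: upt_conv_Cons)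
  have "x (k + (d + 2)) = shO C (x k)" "m (k + (d + 2)) = scl C eps (shM C (m k))"
    using helixD[OF assms] by blast+
  then show ?thesis
    unfolding rotate_left_def window_def map_upt_shift u by simp
qed

lemma window_in_angles:
  assumes "helix x m"
  shows "window k x m \<in> angles C \<longleftrightarrow> window 0 x m \<in> angles C"
proof (induction k)
  case (Suc k)
  then show ?case
    using N2[OF is_seq_window[OF assms, of k]] unfolding rotate_window[OF assms] by blast
qed simp

lemma angle_window: "angle x m \<Longrightarrow> window k x m \<in> angles C"
  using window_in_angles angle_def by auto

lemma seq_unroll:
  assumes "is_seq C d (cs, \<gamma>)"
  obtains x m where "helix x m" "\<And>i. i \<le> d + 1 \<Longrightarrow> x i = cs ! i" "\<And>i. i \<le> d + 1 \<Longrightarrow> m i = \<gamma> ! i"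
    "window 0 x m = (cs, \<gamma>)"
proof -
  let ?n = "d + 2"
  define S where "S g = scl C eps (shM C g)" for g
  define x where "x i = (shO C ^^ (i div ?n)) (cs ! (i mod ?n))" for i
  define m where "m i = (S ^^ (i div ?n)) (\<gamma> ! (i mod ?n))" for i
  have len: "length cs = ?n" "length \<gamma> = ?n"
    and ty: "i \<le> d \<Longrightarrow> \<gamma> ! i \<in> Hom C (cs ! i) (cs ! (i + 1))" "\<gamma> ! (d + 1) \<in> Hom C (cs ! (d + 1)) (shO C (cs ! 0))" for i
    using assms by (auto simp: is_seq_def)
  have iter: "(S ^^ k) f \<in> Hom C ((shO C ^^ k) a) ((shO C ^^ k) b)" if "f \<in> Hom C a b" for k f a b
    using that by (induction k) (auto simp: S_def intro: scl_in sh_in)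
  have "m i \<in> Hom C (x i) (x (Suc i))" for i
  proof (cases "Suc (i mod ?n) = ?n")
    case True
    then have "x (Suc i) = (shO C ^^ (i div ?n)) (shO C (cs ! 0))"
      unfolding x_def by (simp add: mod_Suc div_Suc funpow_swap1)
    then show ?thesis
      using iter[OF ty(2), of "i div ?n"] True by (simp add: x_def m_def)
  next
    case False
    then have "i mod ?n \<le> d"
      using mod_less_divisor[of ?n i] by linarith
    moreover have "x (Suc i) = (shO C ^^ (i div ?n)) (cs ! (i mod ?n + 1))"
      unfolding x_def using False by (simp add: mod_Suc div_Suc)
    ultimately show ?thesis
      using iter[OF ty(1), of "i mod ?n" "i div ?n"] by (simp add: x_def m_def)
  qed
  moreover have "x (i + ?n) = shO C (x i)" "m (i + ?n) = scl C eps (shM C (m i))" for i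
  proof -
    have "(i + ?n) div ?n = Suc (i div ?n)" "(i + ?n) mod ?n = i mod ?n"
      by (simp_all del: add_2_eq_Suc' add: div_add_self2)
    then show "x (i + ?n) = shO C (x i)" "m (i + ?n) = scl C eps (shM C (m i))"
      unfolding x_def m_def by (simp_all add: S_def)
  qed
  ultimately have "helix x m" unfolding helix_def by blast
  moreover have xm: "x i = cs ! i" "m i = \<gamma> ! i" if "i \<le> d + 1" for i
    using that by (auto simp: x_def m_def)
  moreover have "window 0 x m = (cs, \<gamma>)"
    unfolding window_def prod.inject by (intro conjI nth_equalityI) (auto simp: len xm simp del: upt_Suc)
  ultimately show ?thesis using that by blast
qed

lemma angle_unroll:
  assumes "(cs, \<gamma>) \<in> angles C"
  obtains x m where "angle x m" "\<And>i. i \<le> d + 1 \<Longrightarrow> x i = cs ! i" "\<And>i. i \<le> d + 1 \<Longrightarrow> m i = \<gamma> ! i"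
  using seq_unroll[OF angles_seq[OF assms]] assms unfolding angle_def by metis

lemma closed_seq_unroll:
  assumes "closed_seq x m" "window 0 x m \<in> angles C"
  obtains x' m' where "angle x' m'" "\<And>i. i \<le> d + 2 \<Longrightarrow> x' i = x i" "\<And>i. i \<le> d + 1 \<Longrightarrow> m' i = m i"
proof -
  obtain x' m' where 1: "angle x' m'" "\<And>i. i \<le> d + 1 \<Longrightarrow> x' i = fst (window 0 x m) ! i"
    "\<And>i. i \<le> d + 1 \<Longrightarrow> m' i = snd (window 0 x m) ! i"
    using assms(2) angle_unroll[of "fst (window 0 x m)" "snd (window 0 x m)"] by auto
  then have 2: "x' i = x i" "m' i = m i" if "i \<le> d + 1" for i
    using that by (auto simp: window_def simp del: upt_Suc)
  moreover have "x' (d + 2) = x (d + 2)"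
    using angle_shO(1)[OF 1(1), of "d + 2" 0] assms(1) 2(1)[of 0] by (simp add: closed_seq_def)
  ultimately show ?thesis
    using that 1(1) by (metis Suc_1 add_Suc_right le_SucE add.commute plus_1_eq_Suc)
qed

lemma ident_angle:
  obtains t \<tau> z where "angle t \<tau>" "t 0 = y" "t (Suc 0) = y" "\<tau> 0 = Id y" "zero_object C z"
    "\<And>i. 2 \<le> i \<Longrightarrow> i \<le> d + 1 \<Longrightarrow> t i = z"
proof -
  obtain z where z: "zero_object C z" using ex_zero_object by blast
  obtain t \<tau> where t: "angle t \<tau>" "\<And>i. i \<le> d + 1 \<Longrightarrow> t i = ([y, y] @ replicate d z) ! i"
    "\<And>i. i \<le> d + 1 \<Longrightarrow> \<tau> i = ([Id y] @ replicate (d + 1) 0) ! i"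
    using angle_unroll[OF N1_ident[OF z]] by blast
  show thesis
    by (rule that[OF t(1) _ _ _ z]) (use t in \<open>auto simp: nth_append nth_Cons' simp del: replicate_Suc\<close>)
qed

text \<open>Axioms N3 and N4 between arbitrary windows of two angles.\<close>

lemma angle_morphism:
  assumes a: "angle a \<alpha>" and b: "angle b \<beta>"
    and f: "f \<in> Hom C (a k) (b l)" "g \<in> Hom C (a (Suc k)) (b (Suc l))" "g \<cdot> \<alpha> k = \<beta> l \<cdot> f"
  obtains \<phi> where "\<phi> 0 = f" "\<phi> (Suc 0) = g" "\<phi> (d + 2) = shM C f"
    "\<And>i. i \<le> d + 2 \<Longrightarrow> \<phi> i \<in> Hom C (a (k + i)) (b (l + i))"
    "\<And>i. i \<le> d + 1 \<Longrightarrow> \<phi> (Suc i) \<cdot> \<alpha> (k + i) = \<beta> (l + i) \<cdot> \<phi> i"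
    "\<And>e. mapping_cone C d (window k a \<alpha>) (window l b \<beta>) (map \<phi> [0..<d + 2]) e \<Longrightarrow> e \<in> angles C"
proof -
  let ?a = "map (\<lambda>i. a (k + i)) [0..<d + 2]" and ?\<alpha> = "map (\<lambda>i. \<alpha> (k + i)) [0..<d + 2]"
  let ?b = "map (\<lambda>i. b (l + i)) [0..<d + 2]" and ?\<beta> = "map (\<lambda>i. \<beta> (l + i)) [0..<d + 2]"
  have "(?a, ?\<alpha>) \<in> angles C" "(?b, ?\<beta>) \<in> angles C"
    using angle_window[OF a, of k] angle_window[OF b, of l] by (auto simp: window_def)
  moreover have "?a ! 0 = a k" "?b ! 0 = b l" "?a ! 1 = a (Suc k)" "?b ! 1 = b (Suc l)" "?\<alpha> ! 0 = \<alpha> k" "?\<beta> ! 0 = \<beta> l"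
    by (auto simp del: upt_Suc)
  ultimately obtain \<psi> where \<psi>: "seq_mor C d (?a, ?\<alpha>) (?b, ?\<beta>) (f # g # \<psi>)"
    "\<And>e. mapping_cone C d (?a, ?\<alpha>) (?b, ?\<beta>) (f # g # \<psi>) e \<Longrightarrow> e \<in> angles C"
    using N4[of ?a ?\<alpha> ?b ?\<beta> f g] f by metis
  define \<phi> where "\<phi> i = (if i = d + 2 then shM C f else (f # g # \<psi>) ! i)" for i
  have len: "length (f # g # \<psi>) = d + 2"
    and ty: "i \<le> d + 1 \<Longrightarrow> (f # g # \<psi>) ! i \<in> Hom C (?a ! i) (?b ! i)"
    and sq: "i \<le> d \<Longrightarrow> (f # g # \<psi>) ! (i + 1) \<cdot> ?\<alpha> ! i = ?\<beta> ! i \<cdot> (f # g # \<psi>) ! i"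
    and last: "shM C ((f # g # \<psi>) ! 0) \<cdot> ?\<alpha> ! (d + 1) = ?\<beta> ! (d + 1) \<cdot> (f # g # \<psi>) ! (d + 1)" for i
    using \<psi>(1) unfolding seq_mor_def by auto
  have m: "map \<phi> [0..<d + 2] = f # g # \<psi>"
    using len by (intro nth_equalityI) (auto simp: \<phi>_def simp del: upt_Suc)
  have sh: "a (k + (d + 2)) = shO C (a k)" "b (l + (d + 2)) = shO C (b l)"
    using angle_shO[OF a] angle_shO[OF b] by blast+
  show thesis
  proof (rule that)
    show "\<phi> 0 = f" "\<phi> (Suc 0) = g" "\<phi> (d + 2) = shM C f" by (auto simp: \<phi>_def)
  next
    fix i assume "i \<le> d + 2"
    then show "\<phi> i \<in> Hom C (a (k + i)) (b (l + i))"
      using ty[of i] sh sh_in[OF f(1)] by (cases "i = d + 2") (auto simp: \<phi>_def simp del: upt_Suc)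
  next
    fix i assume "i \<le> d + 1"
    then show "\<phi> (Suc i) \<cdot> \<alpha> (k + i) = \<beta> (l + i) \<cdot> \<phi> i"
      using sq[of i] last by (cases "i = d + 1") (auto simp: \<phi>_def simp del: upt_Suc)
  next
    fix e assume "mapping_cone C d (window k a \<alpha>) (window l b \<beta>) (map \<phi> [0..<d + 2]) e"
    then show "e \<in> angles C" using \<psi>(2) m by (simp add: window_def)
  qed
qed

section \<open>Exactness of angles\<close>

text \<open>
  The pair \<open>(id, m\<^sub>i)\<close> extends to a morphism from the trivial angle on \<open>x\<^sub>i\<close>, whose third term is zero.
\<close>

lemma angle_cmp_zero:
  assumes "angle x m"
  shows "m (Suc i) \<cdot> m i = 0"
proof -
  obtain t \<tau> z where t: "angle t \<tau>" "t 0 = x i" "t (Suc 0) = x i" "\<tau> 0 = Id (x i)" "zero_object C z"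
    "\<And>j. 2 \<le> j \<Longrightarrow> j \<le> d + 1 \<Longrightarrow> t j = z"
    using ident_angle[of "x i"] by metis
  have mi: "m i \<in> Hom C (x i) (x (Suc i))" using angle_in[OF assms] .
  obtain \<phi> where \<phi>: "\<phi> (Suc 0) = m i" "\<And>j. j \<le> d + 2 \<Longrightarrow> \<phi> j \<in> Hom C (t (0 + j)) (x (i + j))"
    "\<And>j. j \<le> d + 1 \<Longrightarrow> \<phi> (Suc j) \<cdot> \<tau> (0 + j) = m (i + j) \<cdot> \<phi> j"
    by (rule angle_morphism[OF t(1) assms, of "Id (x i)" 0 i "m i"])
      (use t ident_closed mi cmp_ident_right in auto)
  have "\<tau> 1 = 0"
    using zero_objectD(2)[OF t(5), of "\<tau> 1" "t 1"] t(6)[of 2] angle_in[OF t(1), of 1] d_pos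
    by (simp add: numeral_2_eq_2)
  moreover have "\<phi> 2 \<in> Hom C (t 2) (x (i + 2))"
    using \<phi>(2)[of 2, unfolded add_0] by auto
  ultimately show ?thesis
    using \<phi>(3)[of 1] \<phi>(1) cmp_zero_right[of "\<phi> 2"] by (simp add: numeral_2_eq_2)
qed

text \<open>
  The pair \<open>(g, 0)\<close> extends to a morphism from the first rotation \<open>y \<rightarrow> 0 \<rightarrow> \<dots> \<rightarrow> 0 \<rightarrow> \<Sigma>\<^sup>d y\<close> of the trivial
  angle. Its last component is \<open>\<Sigma>\<^sup>d h\<close>.
\<close>

lemma angle_exact_right:
  assumes x: "angle x m" and g: "g \<in> Hom C y (x (Suc i))" "m (Suc i) \<cdot> g = 0"
  shows "\<exists>h\<in>Hom C y (x i). g = m i \<cdot> h"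
proof -
  obtain t \<tau> z where t: "angle t \<tau>" "t 0 = y" "t (Suc 0) = y" "\<tau> 0 = Id y" "zero_object C z"
    "\<And>j. 2 \<le> j \<Longrightarrow> j \<le> d + 1 \<Longrightarrow> t j = z"
    using ident_angle[of y] by metis
  have mi: "m i \<in> Hom C (x i) (x (Suc i))" "m (Suc i) \<in> Hom C (x (Suc i)) (x (Suc (Suc i)))"
    using angle_in[OF x] by blast+
  have t1: "\<tau> 1 \<in> Hom C y z"
    using t(3) t(6)[of 2] angle_in[OF t(1), of 1] d_pos by (simp add: numeral_2_eq_2)
  have td: "t (d + 2) = shO C y" "\<tau> (d + 2) = scl C eps (Id (shO C y))"
    using angle_shO[OF t(1), of "d + 2" 0] t(2,4) by (auto simp: sh_ident)
  obtain \<phi> where \<phi>: "\<phi> (d + 2) = shM C g" "\<And>j. j \<le> d + 2 \<Longrightarrow> \<phi> j \<in> Hom C (t (1 + j)) (x (Suc i + j))"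
    "\<And>j. j \<le> d + 1 \<Longrightarrow> \<phi> (Suc j) \<cdot> \<tau> (1 + j) = m (Suc i + j) \<cdot> \<phi> j"
    by (rule angle_morphism[OF t(1) x, of g 1 "Suc i" 0])
      (use g t(3) zero_in cmp_zero_left[OF t1] in auto)
  have xi: "x (Suc i + (d + 1)) = shO C (x i)" "m (Suc i + (d + 1)) = scl C eps (shM C (m i))"
    using angle_shO[OF x, of "Suc i + (d + 1)" i] by auto
  have "\<phi> (d + 1) \<in> Hom C (shO C y) (shO C (x i))"
    using \<phi>(2)[of "d + 1"] td xi by simp
  then obtain h where h: "h \<in> Hom C y (x i)" "\<phi> (d + 1) = shM C h"
    using sh_surj by blast
  have "shM C g \<cdot> scl C eps (Id (shO C y)) = scl C eps (shM C (m i)) \<cdot> shM C h"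
    using \<phi>(3)[of "d + 1"] \<phi>(1) td xi h by simp
  then have "scl C eps (shM C g) = scl C eps (shM C (m i \<cdot> h))"
    using cmp_scl_right[OF ident_closed sh_in[OF g(1)]] cmp_scl_left[OF sh_in[OF h(1)] sh_in[OF mi(1)]]
      sh_cmp[OF h(1) mi(1)] cmp_ident_right[OF sh_in[OF g(1)]] by simp
  then have "shM C g = shM C (m i \<cdot> h)" using scl_eps_eps by metis
  then show ?thesis
    using sh_eq_iff[OF g(1) cmp_closed[OF h(1) mi(1)]] h(1) by blast
qed

text \<open>
  The pair \<open>(0, g)\<close> extends to a morphism to the rotation \<open>0 \<rightarrow> y \<rightarrow> y \<rightarrow> \<dots>\<close> of a trivial angle, which starts at
  index \<open>d + 1\<close>. Its third component is \<open>h\<close>, up to sign.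
\<close>

lemma angle_exact_left:
  assumes x: "angle x m" and g: "g \<in> Hom C (x (Suc i)) y" "g \<cdot> m i = 0"
  shows "\<exists>h\<in>Hom C (x (Suc (Suc i))) y. g = h \<cdot> m (Suc i)"
proof -
  obtain y' where y': "y = shO C y'" using shO_surj by blast
  obtain t \<tau> z where t: "angle t \<tau>" "t 0 = y'" "t (Suc 0) = y'" "\<tau> 0 = Id y'" "zero_object C z"
    "\<And>j. 2 \<le> j \<Longrightarrow> j \<le> d + 1 \<Longrightarrow> t j = z"
    using ident_angle[of y'] by metis
  have mi: "m i \<in> Hom C (x i) (x (Suc i))" "m (Suc i) \<in> Hom C (x (Suc i)) (x (Suc (Suc i)))"
    using angle_in[OF x] by blast+
  have td: "t (d + 1) = z" "t (d + 2) = y" "t (d + 3) = y" "\<tau> (d + 2) = scl C eps (Id y)"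
    using t(6)[of "d + 1"] d_pos angle_shO[OF t(1), of "d + 2" 0] angle_shO(1)[OF t(1), of "d + 3" 1] t(2-4) y'
    by (auto simp: sh_ident)
  have "\<tau> (d + 1) \<cdot> 0 = 0"
    using cmp_zero_right[OF angle_in[OF t(1)]] by blast
  then obtain \<phi> where \<phi>: "\<phi> (Suc 0) = g" "\<And>j. j \<le> d + 2 \<Longrightarrow> \<phi> j \<in> Hom C (x (i + j)) (t (d + 1 + j))"
    "\<And>j. j \<le> d + 1 \<Longrightarrow> \<phi> (Suc j) \<cdot> m (i + j) = \<tau> (d + 1 + j) \<cdot> \<phi> j"
    by (rule_tac angle_morphism[OF x t(1), of 0 i "d + 1" g])
      (use g td zero_in in auto)
  have p2: "\<phi> 2 \<in> Hom C (x (Suc (Suc i))) y"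
    using \<phi>(2)[of 2] td(3) by (simp add: numeral_2_eq_2 numeral_3_eq_3)
  have "\<phi> 2 \<cdot> m (Suc i) = scl C eps (Id y) \<cdot> g"
    using \<phi>(3)[of 1] \<phi>(1) td(4) by (simp add: numeral_2_eq_2)
  also have "\<dots> = scl C eps g"
    using cmp_scl_left[OF g(1) ident_closed] cmp_ident_left[OF g(1)] by simp
  finally have "g = scl C eps (\<phi> 2 \<cdot> m (Suc i))"
    using scl_eps_eps by simp
  then show ?thesis
    using cmp_scl_left[OF mi(2) p2] scl_in[OF p2] by metis
qed

end

section \<open>Direct sums, cancellation and pushouts of angles\<close>

context angulated_category
begin

text \<open>
  A morphism of biproducts that is diagonal for the injections is diagonal for the projections. So only
  the squares of the injections have to be checked in a direct sum of angles.
\<close>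

lemma biproduct2_square:
  assumes "biproduct2 b c e i j p q" "biproduct2 b' c' e' i' j' p' q'"
    and "\<epsilon> \<in> Hom C e e'" "\<beta> \<in> Hom C b b'" "\<gamma> \<in> Hom C c c'"
    and "i' \<cdot> \<beta> = \<epsilon> \<cdot> i" "j' \<cdot> \<gamma> = \<epsilon> \<cdot> j"
  shows "p' \<cdot> \<epsilon> = \<beta> \<cdot> p"
proof -
  have h: "i \<in> Hom C b e" "j \<in> Hom C c e" "p \<in> Hom C e b" "q \<in> Hom C e c" "i \<cdot> p + j \<cdot> q = Id e"
    using assms(1) by (auto simp: biproduct2_def)
  have h': "i' \<in> Hom C b' e'" "j' \<in> Hom C c' e'" "p' \<in> Hom C e' b'" "p' \<cdot> i' = Id b'" "p' \<cdot> j' = 0"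
    using assms(2) by (auto simp: biproduct2_def)
  have pe: "p' \<cdot> \<epsilon> \<in> Hom C e b'" using cmp_closed[OF assms(3) h'(3)] .
  have "p' \<cdot> \<epsilon> = (p' \<cdot> \<epsilon>) \<cdot> (i \<cdot> p + j \<cdot> q)"
    using cmp_ident_right[OF pe] h(5) by simp
  also have "\<dots> = ((p' \<cdot> \<epsilon>) \<cdot> i) \<cdot> p + ((p' \<cdot> \<epsilon>) \<cdot> j) \<cdot> q"
    using cmp_add_right[OF cmp_closed[OF h(3,1)] cmp_closed[OF h(4,2)] pe] cmp_assoc[OF h(3,1) pe]
      cmp_assoc[OF h(4,2) pe] by simp
  also have "(p' \<cdot> \<epsilon>) \<cdot> i = \<beta>"
    using cmp_assoc[OF h(1) assms(3) h'(3)] cmp_assoc[OF assms(4) h'(1,3)] assms(4,6) h'(4) cmp_ident_left by metis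
  also have "(p' \<cdot> \<epsilon>) \<cdot> j = 0"
    using cmp_assoc[OF h(2) assms(3) h'(3)] cmp_assoc[OF assms(5) h'(2,3)] assms(5,7) h'(5) cmp_zero_left by metis
  finally show ?thesis using cmp_zero_left[OF h(4)] by simp
qed

lemma seq_direct_sumI:
  assumes b: "closed_seq b \<beta>" and c: "closed_seq c \<gamma>" and e: "closed_seq e \<epsilon>"
    and bip: "\<And>i. i \<le> d + 1 \<Longrightarrow> biproduct2 (b i) (c i) (e i) (I i) (J i) (P i) (Q i)"
    and IJ: "I (d + 2) = shM C (I 0)" "J (d + 2) = shM C (J 0)"
    and sq: "\<And>i. i \<le> d + 1 \<Longrightarrow> I (Suc i) \<cdot> \<beta> i = \<epsilon> i \<cdot> I i"
      "\<And>i. i \<le> d + 1 \<Longrightarrow> J (Suc i) \<cdot> \<gamma> i = \<epsilon> i \<cdot> J i"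
  shows "seq_direct_sum C d (window 0 b \<beta>) (window 0 c \<gamma>) (window 0 e \<epsilon>)"
proof -
  define P' where "P' i = (if i = d + 2 then shM C (P 0) else P i)" for i
  define Q' where "Q' i = (if i = d + 2 then shM C (Q 0) else Q i)" for i
  have bip': "biproduct2 (b i) (c i) (e i) (I i) (J i) (P' i) (Q' i)" if "i \<le> d + 2" for i
    using bip[of i] sh_biproduct2[OF bip[of 0]] b c e IJ that
    by (cases "i = d + 2") (auto simp: P'_def Q'_def closed_seq_def)
  have ty: "\<beta> i \<in> Hom C (b i) (b (Suc i))" "\<gamma> i \<in> Hom C (c i) (c (Suc i))" "\<epsilon> i \<in> Hom C (e i) (e (Suc i))"
    if "i \<le> d + 1" for i
    using b c e that by (auto simp: closed_seq_def)
  have sqP: "P' (Suc i) \<cdot> \<epsilon> i = \<beta> i \<cdot> P' i" if "i \<le> d + 1" for i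
    using biproduct2_square[OF bip' bip' ty(3,1,2)[OF that]] sq that by simp
  have sqQ: "Q' (Suc i) \<cdot> \<epsilon> i = \<gamma> i \<cdot> Q' i" if "i \<le> d + 1" for i
    using biproduct2_square[OF biproduct2_swap[OF bip'] biproduct2_swap[OF bip'] ty(3,2,1)[OF that]] sq that by simp
  have in_hom: "I i \<in> Hom C (b i) (e i)" "J i \<in> Hom C (c i) (e i)" "P' i \<in> Hom C (e i) (b i)" "Q' i \<in> Hom C (e i) (c i)"
    if "i \<le> d + 2" for i
    using bip'[OF that] by (auto simp: biproduct2_def)
  have PQ: "P' (Suc (Suc d)) = shM C (P' 0)" "Q' (Suc (Suc d)) = shM C (Q' 0)"
    and IJ': "I (Suc (Suc d)) = shM C (I 0)" "J (Suc (Suc d)) = shM C (J 0)"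
    using IJ by (auto simp: P'_def Q'_def)
  have mor: "seq_mor C d (window 0 u \<mu>) (window 0 v \<nu>) (map F [0..<d + 2])"
    if "\<And>i. i \<le> d + 2 \<Longrightarrow> F i \<in> Hom C (u i) (v i)" "F (Suc (Suc d)) = shM C (F 0)"
      "\<And>i. i \<le> d + 1 \<Longrightarrow> F (Suc i) \<cdot> \<mu> i = \<nu> i \<cdot> F i" for u v \<mu> \<nu> F
    unfolding seq_mor_def window_def using that(1) that(3) that(3)[of "d + 1"] that(2)
    by (auto simp: simp del: upt_Suc)
  show ?thesis
    unfolding seq_direct_sum_def
  proof (intro exI conjI allI impI)
    show "seq_mor C d (window 0 b \<beta>) (window 0 e \<epsilon>) (map I [0..<d + 2])"
      using in_hom IJ' sq by (intro mor) auto
    show "seq_mor C d (window 0 c \<gamma>) (window 0 e \<epsilon>) (map J [0..<d + 2])"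
      using in_hom IJ' sq by (intro mor) auto
    show "seq_mor C d (window 0 e \<epsilon>) (window 0 b \<beta>) (map P' [0..<d + 2])"
      using in_hom PQ sqP by (intro mor) auto
    show "seq_mor C d (window 0 e \<epsilon>) (window 0 c \<gamma>) (map Q' [0..<d + 2])"
      using in_hom PQ sqQ by (intro mor) auto
    fix i assume "i \<le> d + 1"
    then show "biproduct C [fst (window 0 b \<beta>) ! i, fst (window 0 c \<gamma>) ! i] (fst (window 0 e \<epsilon>) ! i)
        (\<lambda>k. [map I [0..<d + 2] ! i, map J [0..<d + 2] ! i] ! k) (\<lambda>k. [map P' [0..<d + 2] ! i, map Q' [0..<d + 2] ! i] ! k)"
      unfolding biproduct_pair_iff using bip'[of i] by (simp add: window_def del: upt_Suc)
  qed
qed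

lemma angle_direct_sum:
  assumes b: "angle b \<beta>" and c: "angle c \<gamma>" and z: "direct_sum C [b (d + 1), c (d + 1)] z"
  obtains e \<epsilon> where "angle e \<epsilon>" "\<And>i. i \<le> d + 1 \<Longrightarrow> direct_sum C [b i, c i] (e i)" "e (d + 1) = z"
proof -
  have "\<exists>s I J P Q. biproduct2 (b i) (c i) s I J P Q \<and> (i = d + 1 \<longrightarrow> s = z)" for i
    using z ex_direct_sum[of "b i" "c i"] unfolding direct_sum_pair_iff by metis
  then obtain e0 I0 J0 P Q where s: "\<And>i. biproduct2 (b i) (c i) (e0 i) (I0 i) (J0 i) (P i) (Q i)" "e0 (d + 1) = z"
    by metis
  define e where "e i = (if i = d + 2 then shO C (e0 0) else e0 i)" for i
  define I where "I i = (if i = d + 2 then shM C (I0 0) else I0 i)" for i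
  define J where "J i = (if i = d + 2 then shM C (J0 0) else J0 i)" for i
  have bip: "biproduct2 (b i) (c i) (e i) (I i) (J i) (P i) (Q i)" if "i \<le> d + 1" for i
    using s(1)[of i] that by (auto simp: e_def I_def J_def)
  have ty: "\<beta> i \<in> Hom C (b i) (b (Suc i))" "\<gamma> i \<in> Hom C (c i) (c (Suc i))" for i
    using angle_in[OF b] angle_in[OF c] by auto
  have "I (d + 2) \<in> Hom C (b (d + 2)) (e (d + 2))" "J (d + 2) \<in> Hom C (c (d + 2)) (e (d + 2))"
    using angle_shO(1)[OF b, of "d + 2" 0] angle_shO(1)[OF c, of "d + 2" 0] s(1)[of 0]
    by (auto simp: biproduct2_def e_def I_def J_def intro: sh_in)
  then have in1: "I i \<in> Hom C (b i) (e i)" "J i \<in> Hom C (c i) (e i)" if "i \<le> d + 2" for i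
    using that bip[of i] by (cases "i = d + 2"; simp add: biproduct2_def)+
  have in2: "P i \<in> Hom C (e i) (b i)" "Q i \<in> Hom C (e i) (c i)"
    "P i \<cdot> I i = Id (b i)" "Q i \<cdot> J i = Id (c i)" "Q i \<cdot> I i = 0" "P i \<cdot> J i = 0" if "i \<le> d + 1" for i
    using bip[OF that] by (simp_all add: biproduct2_def)
  define \<epsilon> where "\<epsilon> i = (I (Suc i) \<cdot> \<beta> i) \<cdot> P i + (J (Suc i) \<cdot> \<gamma> i) \<cdot> Q i" for i
  have in3: "I (Suc i) \<cdot> \<beta> i \<in> Hom C (b i) (e (Suc i))" "J (Suc i) \<cdot> \<gamma> i \<in> Hom C (c i) (e (Suc i))"
    "(I (Suc i) \<cdot> \<beta> i) \<cdot> P i \<in> Hom C (e i) (e (Suc i))" "(J (Suc i) \<cdot> \<gamma> i) \<cdot> Q i \<in> Hom C (e i) (e (Suc i))"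
    if "i \<le> d + 1" for i
  proof -
    show 1: "I (Suc i) \<cdot> \<beta> i \<in> Hom C (b i) (e (Suc i))" "J (Suc i) \<cdot> \<gamma> i \<in> Hom C (c i) (e (Suc i))"
      using that in1[of "Suc i"] ty[of i] by (auto intro: cmp_closed)
    show "(I (Suc i) \<cdot> \<beta> i) \<cdot> P i \<in> Hom C (e i) (e (Suc i))" "(J (Suc i) \<cdot> \<gamma> i) \<cdot> Q i \<in> Hom C (e i) (e (Suc i))"
      using cmp_closed[OF in2(1) 1(1)] cmp_closed[OF in2(2) 1(2)] that by auto
  qed
  have closed: "closed_seq e \<epsilon>"
    unfolding closed_seq_def \<epsilon>_def using add_in in3(3,4) by (auto simp: e_def)
  have sqI: "I (Suc i) \<cdot> \<beta> i = \<epsilon> i \<cdot> I i" if i: "i \<le> d + 1" for i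
  proof -
    note j = in1(1)[of i]
    have "\<epsilon> i \<cdot> I i = (I (Suc i) \<cdot> \<beta> i) \<cdot> (P i \<cdot> I i) + (J (Suc i) \<cdot> \<gamma> i) \<cdot> (Q i \<cdot> I i)"
      unfolding \<epsilon>_def using cmp_add_left[OF j in3(3,4)] cmp_assoc[OF j in2(1) in3(1)] cmp_assoc[OF j in2(2) in3(2)] i by simp
    then show ?thesis using in2[OF i] cmp_ident_right[OF in3(1)] cmp_zero_right[OF in3(2)] i by simp
  qed
  have sqJ: "J (Suc i) \<cdot> \<gamma> i = \<epsilon> i \<cdot> J i" if i: "i \<le> d + 1" for i
  proof -
    note j = in1(2)[of i]
    have "\<epsilon> i \<cdot> J i = (I (Suc i) \<cdot> \<beta> i) \<cdot> (P i \<cdot> J i) + (J (Suc i) \<cdot> \<gamma> i) \<cdot> (Q i \<cdot> J i)"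
      unfolding \<epsilon>_def using cmp_add_left[OF j in3(3,4)] cmp_assoc[OF j in2(1) in3(1)] cmp_assoc[OF j in2(2) in3(2)] i by simp
    then show ?thesis using in2[OF i] cmp_ident_right[OF in3(2)] cmp_zero_right[OF in3(1)] i by simp
  qed
  have "seq_direct_sum C d (window 0 b \<beta>) (window 0 c \<gamma>) (window 0 e \<epsilon>)"
    by (rule seq_direct_sumI[where I = I and J = J and P = P and Q = Q, OF helix_closed_seq[OF angle_helix[OF b]] helix_closed_seq[OF angle_helix[OF c]] closed bip _ _ sqI sqJ])
      (auto simp: I_def J_def)
  then have "window 0 e \<epsilon> \<in> angles C"
    using N1_sum[OF angle_window[OF b] angle_window[OF c] is_seq_closed[OF closed]] by blast
  then obtain e' \<epsilon>' where e': "angle e' \<epsilon>'" "\<And>i. i \<le> d + 2 \<Longrightarrow> e' i = e i"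
    using closed_seq_unroll[OF closed] by metis
  show thesis
  proof (rule that[OF e'(1)])
    show "e' (d + 1) = z" using e'(2)[of "d + 1"] s(2) by (simp add: e_def)
    show "direct_sum C [b i, c i] (e' i)" if "i \<le> d + 1" for i
      using bip[OF that] e'(2)[of i] that unfolding direct_sum_pair_iff by auto
  qed
qed

text \<open>
  By the two equations \<open>\<eta>\<^sub>0\<close> carries the summand \<open>b\<close> of \<open>e\<^sub>0\<close> isomorphically onto the summand \<open>b\<close> of \<open>e\<^sub>1\<close>, and has no
  component from \<open>x\<close> to it. Hence the trivial angle on \<open>b\<close> is a direct summand, and its complement is an angle.
\<close>

lemma angle_cancel:
  assumes e: "angle e \<eta>" and b0: "biproduct2 x b (e 0) j k p r" and b1: "biproduct2 y b (e 1) j' k' p' r'"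
    and k: "\<eta> 0 \<cdot> k = k'" and r: "r' \<cdot> \<eta> 0 = r"
  obtains v \<nu> where "angle v \<nu>" "v 0 = x" "v 1 = y" "\<And>i. 2 \<le> i \<Longrightarrow> i \<le> d + 1 \<Longrightarrow> v i = e i"
    "\<nu> 0 = p' \<cdot> (\<eta> 0 \<cdot> j)"
proof -
  note h0 = biproduct2D[OF b0] and h1 = biproduct2D[OF b1]
  have ty: "\<eta> i \<in> Hom C (e i) (e (Suc i))" for i using angle_in[OF e] .
  have ty0: "\<eta> 0 \<in> Hom C (e 0) (e 1)" using ty[of 0] by simp
  have ed: "e (d + 2) = shO C (e 0)" using angle_shO(1)[OF e, of "d + 2" 0] by simp
  have tyd: "\<eta> (d + 1) \<in> Hom C (e (d + 1)) (shO C (e 0))" using ty[of "d + 1"] ed by simp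
  have d2: "2 \<le> d + 1" "1 \<noteq> d + 1" using d_pos by auto
  define v where "v i = (if i = 0 then x else if i = 1 then y else if i = d + 2 then shO C x else e i)" for i
  define \<nu> where "\<nu> i = (if i = 0 then p' \<cdot> (\<eta> 0 \<cdot> j) else if i = 1 then \<eta> 1 \<cdot> j'
    else if i = d + 1 then shM C p \<cdot> \<eta> (d + 1) else \<eta> i)" for i
  obtain t \<tau> z where t: "angle t \<tau>" "t 0 = b" "t (Suc 0) = b" "\<tau> 0 = Id b" "zero_object C z"
    "\<And>i. 2 \<le> i \<Longrightarrow> i \<le> d + 1 \<Longrightarrow> t i = z"
    using ident_angle[of b] by metis
  define I where "I i = (if i = 0 then j else if i = 1 then j' else if i = d + 2 then shM C j else Id (e i))" for i
  define J where "J i = (if i = 0 then k else if i = 1 then k' else if i = d + 2 then shM C k else 0)" for i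
  define P where "P i = (if i = 0 then p else if i = 1 then p' else Id (e i))" for i
  define Q where "Q i = (if i = 0 then r else if i = 1 then r' else 0)" for i :: nat
  have nu0: "\<nu> 0 \<in> Hom C x y" unfolding \<nu>_def using h0 h1 ty0 by (auto intro!: cmp_closed)
  have nu1: "\<nu> 1 \<in> Hom C y (e 2)"
    unfolding \<nu>_def using cmp_closed[OF h1(1), of "\<eta> 1" "e 2"] ty[of 1] by (simp add: numeral_2_eq_2)
  have nud: "\<nu> (d + 1) \<in> Hom C (e (d + 1)) (shO C x)"
    unfolding \<nu>_def using cmp_closed[OF tyd sh_in[OF h0(3)]] d_pos by simp
  have "\<nu> i \<in> Hom C (v i) (v (Suc i))" if "i \<le> d + 1" for i
  proof -
    consider "i = 0" | "i = 1" | "i = d + 1" | "2 \<le> i" "i \<le> d" using \<open>i \<le> d + 1\<close> by linarith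
    then show ?thesis
      using nu0 nu1 nud ty[of i] d2 by cases (auto simp: v_def \<nu>_def numeral_2_eq_2)
  qed
  then have closed: "closed_seq v \<nu>" by (auto simp: closed_seq_def v_def)
  have bip: "biproduct2 (v i) (t i) (e i) (I i) (J i) (P i) (Q i)" if "i \<le> d + 1" for i
  proof -
    consider "i = 0" | "i = 1" | "2 \<le> i" using \<open>i \<le> d + 1\<close> by linarith
    then show ?thesis
    proof cases
      case 3
      then show ?thesis
        using t(6)[OF 3 \<open>i \<le> d + 1\<close>] biproduct2_zero[OF t(5), of "e i"] \<open>i \<le> d + 1\<close>
        by (simp add: v_def I_def J_def P_def Q_def)
    qed (use b0 b1 t in \<open>auto simp: v_def I_def J_def P_def Q_def\<close>)
  qed
  have sh_eta: "shM C (\<eta> 0) \<cdot> \<eta> (d + 1) = 0"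
  proof -
    have "scl C eps (shM C (\<eta> 0)) \<cdot> \<eta> (d + 1) = 0"
      using angle_cmp_zero[OF e, of "d + 1"] angle_shO(2)[OF e, of "Suc (d + 1)" 0] by simp
    then show ?thesis
      using cmp_scl_left[OF tyd sh_in[OF ty0], of eps] by (metis scl_eps_eps scale_zero_right)
  qed
  have sqI: "I (Suc i) \<cdot> \<nu> i = \<eta> i \<cdot> I i" if "i \<le> d + 1" for i
  proof -
    consider "i = 0" | "i = 1" | "i = d + 1" | "2 \<le> i" "i \<le> d" using \<open>i \<le> d + 1\<close> by linarith
    then show ?thesis
    proof cases
      case 1
      have ej: "\<eta> 0 \<cdot> j \<in> Hom C x (e 1)" using cmp_closed[OF h0(1) ty0] .
      have "r' \<cdot> (\<eta> 0 \<cdot> j) = 0" using cmp_assoc[OF h0(1) ty0 h1(4)] r h0(7) by simp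
      then have "\<eta> 0 \<cdot> j = j' \<cdot> (p' \<cdot> (\<eta> 0 \<cdot> j))"
        using cmp_ident_left[OF ej] cmp_add_left[OF ej cmp_closed[OF h1(3,1)] cmp_closed[OF h1(4,2)]]
          cmp_assoc[OF ej h1(3,1)] cmp_assoc[OF ej h1(4,2)] cmp_zero_right[OF h1(2)] h1(9) by simp
      then show ?thesis using 1 by (simp add: I_def \<nu>_def)
    next
      case 2
      then show ?thesis
        using cmp_ident_left[OF nu1] d2 by (simp add: I_def \<nu>_def numeral_2_eq_2)
    next
      case 3
      let ?g = "\<eta> (d + 1)"
      have "shM C r \<cdot> ?g = 0"
        using sh_cmp[OF ty0 h1(4)] r cmp_assoc[OF tyd sh_in[OF ty0] sh_in[OF h1(4)]] sh_eta
          cmp_zero_right[OF sh_in[OF h1(4)]] by simp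
      moreover have "shM C j \<cdot> shM C p + shM C k \<cdot> shM C r = Id (shO C (e 0))"
        using sh_biproduct2[OF b0] by (simp add: biproduct2_def)
      ultimately have "?g = shM C j \<cdot> (shM C p \<cdot> ?g)"
        using cmp_ident_left[OF tyd] cmp_add_left[OF tyd cmp_closed[OF sh_in[OF h0(3)] sh_in[OF h0(1)]] cmp_closed[OF sh_in[OF h0(4)] sh_in[OF h0(2)]]]
          cmp_assoc[OF tyd sh_in[OF h0(3)] sh_in[OF h0(1)]] cmp_assoc[OF tyd sh_in[OF h0(4)] sh_in[OF h0(2)]]
          cmp_zero_right[OF sh_in[OF h0(2)]] by simp
      then show ?thesis
        using 3 d2 cmp_ident_right[OF tyd] by (simp add: I_def \<nu>_def)
    next
      case 4
      then show ?thesis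
        using cmp_ident_left[OF ty[of i]] cmp_ident_right[OF ty[of i]] by (simp add: I_def \<nu>_def)
    qed
  qed
  have sqJ: "J (Suc i) \<cdot> \<tau> i = \<eta> i \<cdot> J i" if "i \<le> d + 1" for i
  proof -
    consider "i = 0" | "i = 1" | "2 \<le> i" using \<open>i \<le> d + 1\<close> by linarith
    then show ?thesis
    proof cases
      case 1
      then show ?thesis using k t(4) cmp_ident_right[OF h1(2)] by (simp add: J_def)
    next
      case 2
      have "\<eta> 1 \<cdot> k' = (\<eta> 1 \<cdot> \<eta> 0) \<cdot> k"
        using cmp_assoc[OF h0(2) ty0, of "\<eta> 1" "e 2"] ty[of 1] k by (simp add: numeral_2_eq_2)
      also have "\<eta> 1 \<cdot> \<eta> 0 = 0" using angle_cmp_zero[OF e, of 0] by simp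
      finally have "\<eta> 1 \<cdot> k' = 0" using cmp_zero_left[OF h0(2)] by simp
      then show ?thesis
        using 2 d2 cmp_zero_left[OF angle_in[OF t(1)]] by (simp add: J_def)
    next
      case 3
      then have "\<tau> i = 0"
        using zero_objectD(1)[OF t(5), of "\<tau> i"] angle_in[OF t(1), of i] t(6)[OF 3 \<open>i \<le> d + 1\<close>] by simp
      moreover have "J (Suc i) \<cdot> 0 = 0"
        using 3 \<open>i \<le> d + 1\<close> cmp_zero_right[OF sh_in[OF h0(2)]] cmp_zero_right[OF zero_in] by (auto simp: J_def)
      ultimately show ?thesis
        using 3 \<open>i \<le> d + 1\<close> cmp_zero_right[OF ty[of i]] by (auto simp: J_def)
    qed
  qed
  have "seq_direct_sum C d (window 0 v \<nu>) (window 0 t \<tau>) (window 0 e \<eta>)"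
    by (rule seq_direct_sumI[where I = I and J = J and P = P and Q = Q, OF closed helix_closed_seq[OF angle_helix[OF t(1)]] helix_closed_seq[OF angle_helix[OF e]] bip _ _ sqI sqJ])
      (use d_pos in \<open>auto simp: I_def J_def\<close>)
  then have "window 0 v \<nu> \<in> angles C"
    using N1_summand[OF angle_window[OF e] is_seq_closed[OF closed] is_seq_window[OF angle_helix[OF t(1)]]] by blast
  then obtain v' \<nu>' where v': "angle v' \<nu>'" "\<And>i. i \<le> d + 2 \<Longrightarrow> v' i = v i" "\<And>i. i \<le> d + 1 \<Longrightarrow> \<nu>' i = \<nu> i"
    using closed_seq_unroll[OF closed] by metis
  show thesis
    by (rule that[OF v'(1)]) (use v'(2) v'(3)[of 0] in \<open>auto simp: v_def \<nu>_def\<close>)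
qed

lemma angle_shift_back:
  assumes "angle v \<nu>"
  obtains w \<omega> where "angle w \<omega>" "\<And>i. w (Suc i) = v i" "\<And>i. \<omega> (Suc i) = \<nu> i"
proof -
  note h = angle_in[OF assms] and s = angle_shO[OF assms]
  obtain w0 where w0: "v (d + 1) = shO C w0" using shO_surj by blast
  have "\<nu> (d + 1) \<in> Hom C (shO C w0) (shO C (v 0))"
    using h[of "d + 1"] s(1)[of "d + 2" 0] w0 by simp
  then obtain f where f: "f \<in> Hom C w0 (v 0)" "\<nu> (d + 1) = shM C f" using sh_surj by blast
  define w where "w i = (case i of 0 \<Rightarrow> w0 | Suc k \<Rightarrow> v k)" for i
  define \<omega> where "\<omega> i = (case i of 0 \<Rightarrow> scl C eps f | Suc k \<Rightarrow> \<nu> k)" for i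
  have "\<omega> i \<in> Hom C (w i) (w (Suc i))" for i
    using h f(1) by (cases i) (auto simp: w_def \<omega>_def intro: scl_in)
  moreover have "w (i + (d + 2)) = shO C (w i)" for i
    using s(1)[of "k + (d + 2)" k for k] w0 by (cases i) (auto simp: w_def)
  moreover have "\<omega> (i + (d + 2)) = scl C eps (shM C (\<omega> i))" for i
    using s(2)[of "k + (d + 2)" k for k] f sh_scl[OF f(1)] scl_eps_eps by (cases i) (auto simp: \<omega>_def)
  ultimately have helix: "helix w \<omega>" by (auto simp: helix_def)
  have "window (Suc 0) w \<omega> = window 0 v \<nu>"
    by (simp add: window_def w_def \<omega>_def del: upt_Suc)
  then have "angle w \<omega>"
    unfolding angle_def using helix window_in_angles[OF helix] angle_window[OF assms] by metis
  then show ?thesis using that by (simp add: w_def \<omega>_def)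
qed

lemma angle_shift_back_n:
  assumes "angle v \<nu>"
  shows "\<exists>w \<omega>. angle w \<omega> \<and> (\<forall>i. w (i + n) = v i \<and> \<omega> (i + n) = \<nu> i)"
proof (induction n)
  case 0
  then show ?case using assms by auto
next
  case (Suc n)
  then obtain w \<omega> where w: "angle w \<omega>" "\<And>i. w (i + n) = v i" "\<And>i. \<omega> (i + n) = \<nu> i" by blast
  obtain w' \<omega>' where w': "angle w' \<omega>'" "\<And>i. w' (Suc i) = w i" "\<And>i. \<omega>' (Suc i) = \<omega> i"
    using angle_shift_back[OF w(1)] by metis
  show ?case
    by (intro exI[of _ w'] exI[of _ \<omega>']) (use w w' in auto)
qed

lemma mapping_cone_window:
  assumes a: "angle a \<alpha>"
    and bip: "\<And>i. i \<le> d + 1 \<Longrightarrow> biproduct2 (a (Suc (k + i))) (x (l + i)) (e i) (I i) (J i) (P i) (Q i)"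
    and IJ: "I (d + 2) = shM C (I 0)" "J (d + 2) = shM C (J 0)"
    and \<phi>: "\<phi> (d + 2) = shM C (\<phi> 0)"
    and \<eta>: "\<And>i. i \<le> d + 1 \<Longrightarrow> \<eta> i = I (Suc i) \<cdot> (- (if i = d + 1 then shM C (\<alpha> k) else \<alpha> (Suc (k + i)))) \<cdot> P i
        + J (Suc i) \<cdot> \<phi> (Suc i) \<cdot> P i + J (Suc i) \<cdot> \<xi> (l + i) \<cdot> Q i"
  shows "mapping_cone C d (window k a \<alpha>) (window l x \<xi>) (map \<phi> [0..<d + 2]) (window 0 e \<eta>)"
proof -
  have ad: "a (Suc (k + (d + 1))) = shO C (a k)"
    using angle_shO(1)[OF a, of "Suc (k + (d + 1))" k] by simp
  have 1: "(map (\<lambda>i. a (k + i)) [0..<d + 2] @ [shO C (a k)]) ! (i + 1) = a (Suc (k + i))" if "i \<le> d + 1" for i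
    using that ad by (cases "i = d + 1") (auto simp: nth_append simp del: upt_Suc)
  have 2: "(map (\<lambda>i. \<alpha> (k + i)) [0..<d + 2] @ [shM C (\<alpha> k)]) ! (i + 1)
      = (if i = d + 1 then shM C (\<alpha> k) else \<alpha> (Suc (k + i)))" if "i \<le> d + 1" for i
    using that by (cases "i = d + 1") (auto simp: nth_append simp del: upt_Suc)
  have phi': "(map \<phi> [0..<d + 2] @ [shM C (\<phi> 0)]) ! (i + 1) = \<phi> (Suc i)" if "i \<le> d + 1" for i
    using that \<phi> by (cases "i = d + 1") (auto simp: nth_append simp del: upt_Suc)
  have 4: "map (\<lambda>i. x (l + i)) [0..<d + 2] ! i = x (l + i)" "map (\<lambda>i. \<xi> (l + i)) [0..<d + 2] ! i = \<xi> (l + i)"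
    "map (\<lambda>i. e (0 + i)) [0..<d + 2] ! i = e i" "map (\<lambda>i. \<eta> (0 + i)) [0..<d + 2] ! i = \<eta> i" if "i \<le> d + 1" for i
    using that by (auto simp del: upt_Suc)
  have 0: "map (\<lambda>i. a (k + i)) [0..<d + 2] ! 0 = a k" "map (\<lambda>i. \<alpha> (k + i)) [0..<d + 2] ! 0 = \<alpha> k"
    "map \<phi> [0..<d + 2] ! 0 = \<phi> 0"
    by (auto simp del: upt_Suc)
  show ?thesis
    unfolding mapping_cone_def window_def prod.case Let_def 0
  proof (intro conjI, goal_cases)
    case 3
    show ?case
    proof (rule exI[of _ I], rule exI[of _ J], rule exI[of _ P], rule exI[of _ Q], intro conjI allI impI)
      fix i assume i: "i \<le> d + 1"
      show "biproduct C [(map (\<lambda>i. a (k + i)) [0..<d + 2] @ [shO C (a k)]) ! (i + 1), map (\<lambda>i. x (l + i)) [0..<d + 2] ! i]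
          (map (\<lambda>i. e (0 + i)) [0..<d + 2] ! i) (\<lambda>k. [I i, J i] ! k) (\<lambda>k. [P i, Q i] ! k)"
        unfolding 1[OF i] 4[OF i] biproduct_pair_iff by (rule bip[OF i])
      show "map (\<lambda>i. \<eta> (0 + i)) [0..<d + 2] ! i =
          I (i + 1) \<cdot> (- ((map (\<lambda>i. \<alpha> (k + i)) [0..<d + 2] @ [shM C (\<alpha> k)]) ! (i + 1))) \<cdot> P i +
          J (i + 1) \<cdot> ((map \<phi> [0..<d + 2] @ [shM C (\<phi> 0)]) ! (i + 1)) \<cdot> P i +
          J (i + 1) \<cdot> (map (\<lambda>i. \<xi> (l + i)) [0..<d + 2] ! i) \<cdot> Q i"
        unfolding 2[OF i] 4[OF i] phi'[OF i] using \<eta>[OF i] by simp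
    qed (use IJ in auto)
  qed simp_all
qed

lemma biproduct2_shear:
  assumes "biproduct2 x y z i j p q" "f \<in> Hom C y x"
  shows "biproduct2 x y z i (j - i \<cdot> f) (p + f \<cdot> q) q"
proof -
  note h = biproduct2D(1-4)[OF assms(1)] and e = biproduct2D(5-9)[OF assms(1)]
  note f = assms(2)
  have if': "i \<cdot> f \<in> Hom C y z" and fq: "f \<cdot> q \<in> Hom C z x" and pfq: "p + f \<cdot> q \<in> Hom C z x"
    using cmp_closed[OF f h(1)] cmp_closed[OF h(4) f] h by (auto intro: add_in)
  have 1: "(p + f \<cdot> q) \<cdot> i = Id x"
    using cmp_add_left[OF h(1,3) fq] cmp_assoc[OF h(1,4) f] e cmp_zero_right[OF f] by simp
  have 2: "q \<cdot> (j - i \<cdot> f) = Id y"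
    using cmp_diff_right[OF h(2) if' h(4)] cmp_assoc[OF f h(1,4)] e cmp_zero_left[OF f] by simp
  have "(p + f \<cdot> q) \<cdot> j = f"
    using cmp_add_left[OF h(2,3) fq] cmp_assoc[OF h(2,4) f] e cmp_ident_right[OF f] by simp
  then have 3: "(p + f \<cdot> q) \<cdot> (j - i \<cdot> f) = 0"
    using cmp_diff_right[OF h(2) if' pfq] cmp_assoc[OF f h(1) pfq] 1 cmp_ident_left[OF f] by simp
  have "i \<cdot> (p + f \<cdot> q) + (j - i \<cdot> f) \<cdot> q = Id z"
    using cmp_add_right[OF h(3) fq h(1)] cmp_diff_left[OF h(4,2) if'] cmp_assoc[OF h(4) f h(1)] e by simp
  then show ?thesis
    unfolding biproduct2_def using h e 1 2 3 pfq diff_in[OF h(2) if'] by blast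
qed

text \<open>
  The morphism of angles \<open>a \<rightarrow> x\<close>, rotated to start with \<open>q\<close> and the identity of \<open>b = a\<^sub>d\<^sub>+\<^sub>1 = x\<^sub>d\<^sub>+\<^sub>1\<close>, has a
  mapping cone in which \<open>b\<close> occurs in the first two terms \<open>b \<oplus> x\<^sub>d\<close> and \<open>\<Sigma>\<^sup>d a\<^sub>0 \<oplus> b\<close>. Cancelling it leaves
  the angle \<open>a\<^sub>0 \<rightarrow> a\<^sub>1 \<oplus> x\<^sub>0 \<rightarrow> \<dots> \<rightarrow> a\<^sub>d \<oplus> x\<^sub>d\<^sub>-\<^sub>1 \<rightarrow> x\<^sub>d\<close>.
\<close>

lemma angle_pushout:
  assumes a: "angle a \<alpha>" and x: "angle x \<xi>" and eq: "a (d + 1) = x (d + 1)"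
    and q: "q \<in> Hom C (a d) (x d)" "\<xi> d \<cdot> q = \<alpha> d"
  obtains w \<omega> where "angle w \<omega>" "w 0 = a 0" "w (d + 1) = x d"
    "\<And>i. i < d \<Longrightarrow> direct_sum C [a (Suc i), x i] (w (Suc i))" "\<omega> (d + 1) = \<alpha> (d + 1) \<cdot> \<xi> d"
proof -
  let ?b = "x (d + 1)"
  have al: "\<alpha> i \<in> Hom C (a i) (a (Suc i))" and xi: "\<xi> i \<in> Hom C (x i) (x (Suc i))" for i
    using angle_in[OF a] angle_in[OF x] by auto
  have sha: "a (d + 2 + i) = shO C (a i)" "x (d + 2 + i) = shO C (x i)" for i
    using angle_shO(1)[OF a, of "d + 2 + i" i] angle_shO(1)[OF x, of "d + 2 + i" i] by auto
  have ald: "\<alpha> (d + 1) \<in> Hom C ?b (shO C (a 0))" and xid: "\<xi> d \<in> Hom C (x d) ?b"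
    using al[of "d + 1"] xi[of d] sha(1)[of 0] eq by auto
  obtain \<phi> where \<phi>: "\<phi> 0 = q" "\<phi> (Suc 0) = Id ?b" "\<phi> (d + 2) = shM C q"
    "\<And>i. i \<le> d + 2 \<Longrightarrow> \<phi> i \<in> Hom C (a (d + i)) (x (d + i))"
    "\<And>e. mapping_cone C d (window d a \<alpha>) (window d x \<xi>) (map \<phi> [0..<d + 2]) e \<Longrightarrow> e \<in> angles C"
    by (rule angle_morphism[OF a x, of q d d "Id ?b"])
      (use q al[of d] eq ident_closed[of ?b] cmp_ident_left[OF al[of d]] in auto)
  have "\<forall>y z. \<exists>s i j p q. biproduct2 y z s i j p q"
    using ex_direct_sum unfolding direct_sum_pair_iff by blast
  then obtain S I0 J0 P0 Q0 where S: "\<And>y z. biproduct2 y z (S y z) (I0 y z) (J0 y z) (P0 y z) (Q0 y z)"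
    by metis
  define e where "e i = (if i < 2 then S (a (Suc (d + i))) (x (d + i)) else if i = d + 2 then shO C (S (a (Suc d)) (x d))
    else shO C (S (a (i - 1)) (x (i - 2))))" for i
  define cone where "cone G i = (if i < 2 then G (a (Suc (d + i))) (x (d + i)) else if i = d + 2 then shM C (G (a (Suc d)) (x d))
    else shM C (G (a (i - 1)) (x (i - 2))))" for G i
  define I J P Q where IJPQ: "I = cone I0" "J = cone J0" "P = cone P0" "Q = cone Q0"
  have bip: "biproduct2 (a (Suc (d + i))) (x (d + i)) (e i) (I i) (J i) (P i) (Q i)" if "i \<le> d + 2" for i
  proof (cases "i < 2")
    case True
    then show ?thesis using S by (simp add: e_def IJPQ cone_def)
  next
    case False
    then have i: "2 \<le> i" by simp
    have "a (Suc (d + i)) = shO C (a (i - 1))" "x (d + i) = shO C (x (i - 2))"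
      using sha(1)[of "i - 1"] sha(2)[of "i - 2"] i
      by (metis Suc_diff_1 add_Suc_right add_2_eq_Suc' add_Suc less_le_trans pos2,
          metis add.assoc le_add_diff_inverse)
    moreover have "i - 1 = Suc d" "i - 2 = d" if "i = d + 2" using that by auto
    ultimately show ?thesis
      using sh_biproduct2[OF S] i by (auto simp: e_def IJPQ cone_def)
  qed
  have h: "I i \<in> Hom C (a (Suc (d + i))) (e i)" "J i \<in> Hom C (x (d + i)) (e i)"
    "P i \<in> Hom C (e i) (a (Suc (d + i)))" "Q i \<in> Hom C (e i) (x (d + i))" if "i \<le> d + 2" for i
    using bip[OF that] by (auto simp: biproduct2_def)
  define \<alpha>' where "\<alpha>' i = - (if i = d + 1 then shM C (\<alpha> d) else \<alpha> (Suc (d + i)))" for i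
  define \<eta> where "\<eta> i = I (Suc i) \<cdot> \<alpha>' i \<cdot> P i + J (Suc i) \<cdot> \<phi> (Suc i) \<cdot> P i + J (Suc i) \<cdot> \<xi> (d + i) \<cdot> Q i" for i
  have al': "\<alpha>' i \<in> Hom C (a (Suc (d + i))) (a (Suc (d + Suc i)))" if "i \<le> d + 1" for i
  proof (cases "i = d + 1")
    case True
    then show ?thesis
      using sh_in[OF al[of d]] sha(1)[of d] sha(1)[of "Suc d"] by (auto simp: \<alpha>'_def add.commute intro!: minus_in)
  next
    case False
    then show ?thesis using al[of "Suc (d + i)"] by (auto simp: \<alpha>'_def intro: minus_in)
  qed
  have eta_in: "\<eta> i \<in> Hom C (e i) (e (Suc i))" if "i \<le> d + 1" for i
  proof -
    have ph: "\<phi> (Suc i) \<in> Hom C (a (Suc (d + i))) (x (d + Suc i))" and x': "\<xi> (d + i) \<in> Hom C (x (d + i)) (x (d + Suc i))"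
      using \<phi>(4)[of "Suc i"] xi[of "d + i"] that by auto
    have s: "Suc i \<le> d + 2" "i \<le> d + 2" using that by auto
    show ?thesis
      unfolding \<eta>_def
      by (intro add_in cmp_closed[OF h(3)[OF s(2)] cmp_closed[OF al'[OF that] h(1)[OF s(1)]]]
          cmp_closed[OF h(3)[OF s(2)] cmp_closed[OF ph h(2)[OF s(1)]]] cmp_closed[OF h(4)[OF s(2)] cmp_closed[OF x' h(2)[OF s(1)]]])
  qed
  have e_last: "e (d + 2) = shO C (e 0)" "I (d + 2) = shM C (I 0)" "J (d + 2) = shM C (J 0)"
    by (auto simp: e_def IJPQ cone_def)
  have closed: "closed_seq e \<eta>" using eta_in e_last by (auto simp: closed_seq_def)
  have "mapping_cone C d (window d a \<alpha>) (window d x \<xi>) (map \<phi> [0..<d + 2]) (window 0 e \<eta>)"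
    by (rule mapping_cone_window[where I = I and J = J and P = P and Q = Q, OF a])
      (use bip e_last \<phi>(1,3) in \<open>auto simp: \<eta>_def \<alpha>'_def\<close>)
  then obtain e' \<eta>' where e': "angle e' \<eta>'" "\<And>i. i \<le> d + 2 \<Longrightarrow> e' i = e i" "\<And>i. i \<le> d + 1 \<Longrightarrow> \<eta>' i = \<eta> i"
    using closed_seq_unroll[OF closed] \<phi>(5) by metis
  \<comment> \<open>The summand \<open>b\<close> of \<open>e 0\<close> is carried isomorphically onto the summand \<open>b\<close> of \<open>e 1\<close>.\<close>
  have b0: "biproduct2 ?b (x d) (e 0) (I 0) (J 0) (P 0) (Q 0)" and b1: "biproduct2 (shO C (a 0)) ?b (e 1) (I 1) (J 1) (P 1) (Q 1)"
    using bip[of 0] bip[of 1] sha(1)[of 0] eq by auto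
  note h0 = biproduct2D(1-4)[OF b0] and k0 = biproduct2D(5-8)[OF b0]
  note h1 = biproduct2D(1-4)[OF b1] and k1 = biproduct2D(5-8)[OF b1]
  let ?A = "- (\<alpha> (d + 1) \<cdot> P 0)" and ?B = "P 0 + \<xi> d \<cdot> Q 0"
  have aP: "\<alpha> (d + 1) \<cdot> P 0 \<in> Hom C (e 0) (shO C (a 0))" and xQ: "\<xi> d \<cdot> Q 0 \<in> Hom C (e 0) ?b"
    using cmp_closed[OF h0(3) ald] cmp_closed[OF h0(4) xid] by auto
  have A: "?A \<in> Hom C (e 0) (shO C (a 0))" and B: "?B \<in> Hom C (e 0) ?b"
    using aP xQ h0 by (auto intro: minus_in add_in)
  have eta0: "\<eta> 0 = I 1 \<cdot> ?A + J 1 \<cdot> ?B"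
  proof -
    have "I 1 \<cdot> (- \<alpha> (d + 1)) \<cdot> P 0 = I 1 \<cdot> ?A"
      using cmp_assoc[OF h0(3) minus_in[OF ald] h1(1)] cmp_minus_left[OF h0(3) ald] by simp
    moreover have "J 1 \<cdot> Id ?b \<cdot> P 0 + J 1 \<cdot> \<xi> d \<cdot> Q 0 = J 1 \<cdot> ?B"
      using cmp_ident_right[OF h1(2)] cmp_assoc[OF h0(4) xid h1(2)] cmp_add_right[OF h0(3) xQ h1(2)] by simp
    ultimately show ?thesis
      using \<phi>(2) by (simp add: \<eta>_def \<alpha>'_def add.assoc)
  qed
  have eta0_in: "\<eta> 0 \<in> Hom C (e 0) (e 1)" using eta_in[of 0] by simp
  have IA: "I 1 \<cdot> ?A \<in> Hom C (e 0) (e 1)" and JB: "J 1 \<cdot> ?B \<in> Hom C (e 0) (e 1)"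
    using cmp_closed[OF A h1(1)] cmp_closed[OF B h1(2)] by auto
  have Peta: "P 1 \<cdot> \<eta> 0 = ?A" and Qeta: "Q 1 \<cdot> \<eta> 0 = ?B"
    unfolding eta0
    using cmp_add_right[OF IA JB h1(3)] cmp_add_right[OF IA JB h1(4)] cmp_assoc[OF A h1(1,3)] cmp_assoc[OF B h1(2,3)]
      cmp_assoc[OF A h1(1,4)] cmp_assoc[OF B h1(2,4)] k1 cmp_ident_left[OF A] cmp_ident_left[OF B]
      cmp_zero_left[OF A] cmp_zero_left[OF B] by simp_all
  have etaI: "\<eta> 0 \<cdot> I 0 = J 1 - I 1 \<cdot> \<alpha> (d + 1)"
  proof -
    have "?A \<cdot> I 0 = - \<alpha> (d + 1)"
      using cmp_minus_left[OF h0(1) aP] cmp_assoc[OF h0(1,3) ald] k0 cmp_ident_right[OF ald] by simp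
    moreover have "?B \<cdot> I 0 = Id ?b"
      using cmp_add_left[OF h0(1,3) xQ] cmp_assoc[OF h0(1,4) xid] k0 cmp_zero_right[OF xid] by simp
    ultimately show ?thesis
      unfolding eta0
      using cmp_add_left[OF h0(1) IA JB] cmp_assoc[OF h0(1) A h1(1)] cmp_assoc[OF h0(1) B h1(2)]
        cmp_minus_right[OF ald h1(1)] cmp_ident_right[OF h1(2)] by simp
  qed
  let ?p = "P 1 + \<alpha> (d + 1) \<cdot> Q 1" and ?j = "J 0 - I 0 \<cdot> \<xi> d"
  have p: "?p \<in> Hom C (e 1) (shO C (a 0))" and j: "?j \<in> Hom C (x d) (e 0)"
    using h1 h0 cmp_closed[OF h1(4) ald] cmp_closed[OF xid h0(1)] by (auto intro: add_in diff_in)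
  have "?p \<cdot> \<eta> 0 = ?A + \<alpha> (d + 1) \<cdot> ?B"
    using cmp_add_left[OF eta0_in h1(3) cmp_closed[OF h1(4) ald]] cmp_assoc[OF eta0_in h1(4) ald] Peta Qeta by simp
  also have "\<dots> = \<alpha> (d + 1) \<cdot> (\<xi> d \<cdot> Q 0)"
    using cmp_add_right[OF h0(3) xQ ald] by simp
  finally have pe: "?p \<cdot> \<eta> 0 = \<alpha> (d + 1) \<cdot> (\<xi> d \<cdot> Q 0)" .
  have Qj: "Q 0 \<cdot> ?j = Id (x d)"
    using cmp_diff_right[OF h0(2) cmp_closed[OF xid h0(1)] h0(4)] cmp_assoc[OF xid h0(1,4)] k0 cmp_zero_left[OF xid] by simp
  have nu0: "?p \<cdot> (\<eta> 0 \<cdot> ?j) = \<alpha> (d + 1) \<cdot> \<xi> d"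
    using cmp_assoc[OF j eta0_in p] pe cmp_assoc[OF j xQ ald] cmp_assoc[OF j h0(4) xid] Qj cmp_ident_right[OF xid] by simp
  have e01: "e' 0 = e 0" "e' 1 = e 1" "\<eta>' 0 = \<eta> 0" using e' by auto
  \<comment> \<open>Sheared biproducts make the component of \<open>\<eta> 0\<close> between the two copies of \<open>b\<close> diagonal.\<close>
  obtain v \<nu> where v: "angle v \<nu>" "v 0 = x d" "v 1 = shO C (a 0)" "\<And>i. 2 \<le> i \<Longrightarrow> i \<le> d + 1 \<Longrightarrow> v i = e' i"
    "\<nu> 0 = \<alpha> (d + 1) \<cdot> \<xi> d"
    using angle_cancel[OF e'(1), of "x d" ?b ?j "I 0" "Q 0" ?B "shO C (a 0)" "I 1" "J 1 - I 1 \<cdot> \<alpha> (d + 1)" ?p "Q 1"]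
      biproduct2_swap[OF biproduct2_shear[OF b0 xid]] biproduct2_shear[OF b1 ald] etaI Qeta nu0
    unfolding e01 by metis
  obtain w \<omega> where w: "angle w \<omega>" "\<And>i. w (i + (d + 1)) = v i" "\<And>i. \<omega> (i + (d + 1)) = \<nu> i"
    using angle_shift_back_n[OF v(1), of "d + 1"] by blast
  have wsh: "shO C (w i) = v (Suc i)" for i
    using w(2)[of "Suc i"] angle_shO(1)[OF w(1), of "Suc i + (d + 1)" i] by simp
  show thesis
  proof (rule that[OF w(1)])
    show "w 0 = a 0" using wsh[of 0] v(3) shO_eq_iff by simp
    show "w (d + 1) = x d" using w(2)[of 0] v(2) by simp
    show "\<omega> (d + 1) = \<alpha> (d + 1) \<cdot> \<xi> d" using w(3)[of 0] v(5) by simp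
    show "direct_sum C [a (Suc i), x i] (w (Suc i))" if "i < d" for i
    proof -
      have "shO C (w (Suc i)) = e' (Suc (Suc i))" using wsh[of "Suc i"] v(4)[of "Suc (Suc i)"] that by simp
      also have "\<dots> = shO C (S (a (Suc i)) (x i))" using e'(2)[of "Suc (Suc i)"] that by (simp add: e_def)
      finally have "w (Suc i) = S (a (Suc i)) (x i)" using shO_eq_iff by blast
      then show ?thesis using S[of "a (Suc i)" "x i"] unfolding direct_sum_pair_iff by metis
    qed
  qed
qed

end

section \<open>Resolutions and additive functions\<close>

definition altsum :: "nat \<Rightarrow> (nat \<Rightarrow> 'g::ab_group_add) \<Rightarrow> 'g" where
  "altsum n h = (\<Sum>i\<le>n. if even i then h i else - h i)"

lemma altsum_0: "altsum 0 h = h 0"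
  by (simp add: altsum_def)

lemma altsum_Suc: "altsum (Suc n) h = altsum n h + (if even n then - h (Suc n) else h (Suc n))"
  by (simp add: altsum_def)

lemma altsum_Suc_shift: "altsum (Suc n) h = h 0 - altsum n (\<lambda>i. h (Suc i))"
  by (induction n) (auto simp: altsum_Suc altsum_0)

lemma altsum_add: "altsum n (\<lambda>i. g i + h i) = altsum n g + altsum n h"
  by (induction n) (auto simp: altsum_Suc altsum_0)

lemma altsum_diff: "altsum n (\<lambda>i. g i - h i) = altsum n g - altsum n h"
  by (induction n) (auto simp: altsum_Suc altsum_0)

lemma altsum_cong: "(\<And>i. i \<le> n \<Longrightarrow> g i = h i) \<Longrightarrow> altsum n g = altsum n h"
  unfolding altsum_def by (intro sum.cong) auto

lemma altsum_mult: "altsum n (\<lambda>i. c * h i) = (c :: int) * altsum n h"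
  by (induction n) (auto simp: altsum_Suc altsum_0 algebra_simps)

lemma altsum_zero: "altsum n (\<lambda>i. 0) = 0"
  by (induction n) (auto simp: altsum_Suc altsum_0)

lemma pushout_index_cases:
  assumes "i \<le> Suc n"
  obtains "i = 0" | k where "i = Suc k" "k < n" | "i = Suc n"
  using assms by (cases i) (auto simp: le_less)

text \<open>The terms of the pushout \<open>a\<^sub>0, a\<^sub>1 \<oplus> x\<^sub>0, \<dots>, a\<^sub>n \<oplus> x\<^sub>n\<^sub>-\<^sub>1, x\<^sub>n\<close>.\<close>

lemma altsum_pushout:
  "altsum (Suc n) (\<lambda>i. (if i \<le> n then g i else 0) + (if i = 0 then 0 else h (i - 1))) = altsum n g - altsum n h"
proof -
  have "altsum (Suc n) (\<lambda>i. if i \<le> n then g i else 0) = altsum n g"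
    by (simp add: altsum_Suc) (rule altsum_cong, simp)
  moreover have "altsum (Suc n) (\<lambda>i. if i = 0 then 0 else h (i - 1)) = - altsum n h"
    by (simp add: altsum_Suc_shift)
  ultimately show ?thesis by (simp add: altsum_add)
qed

locale cluster_tilting = angulated_category C d
  for C :: "('o, 'm::ab_group_add, 'k::field, 'z) angcat_scheme" (structure) and d :: nat +
  fixes T :: 'o
  assumes tilting: "OT_cluster_tilting C d T"
begin

text \<open>
  The resolution \<open>t\<^sub>d \<rightarrow> \<dots> \<rightarrow> t\<^sub>0 \<rightarrow> v\<close> in the order of the angle, so \<open>a\<^sub>i = t\<^sub>d\<^sub>-\<^sub>i\<close>. Alternating sums over \<open>a\<close> and over \<open>t\<close>
  differ by the sign \<open>(-1)\<^sup>d\<close>.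
\<close>

definition res :: "(nat \<Rightarrow> 'o) \<Rightarrow> (nat \<Rightarrow> 'm) \<Rightarrow> 'o \<Rightarrow> bool" where
  "res a \<alpha> v \<longleftrightarrow> angle a \<alpha> \<and> (\<forall>i\<le>d. a i \<in> addcat C T) \<and> a (d + 1) = v"

lemma resD:
  assumes "res a \<alpha> v"
  shows "angle a \<alpha>" "i \<le> d \<Longrightarrow> a i \<in> addcat C T" "a (d + 1) = v" "\<alpha> i \<in> Hom C (a i) (a (Suc i))"
    "\<alpha> d \<in> Hom C (a d) v" "\<alpha> (d + 1) \<in> Hom C v (shO C (a 0))"
proof -
  show a: "angle a \<alpha>" "i \<le> d \<Longrightarrow> a i \<in> addcat C T" "a (d + 1) = v"
    using assms by (auto simp: res_def)
  show "\<alpha> i \<in> Hom C (a i) (a (Suc i))" using angle_in[OF a(1)] .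
  show "\<alpha> d \<in> Hom C (a d) v" "\<alpha> (d + 1) \<in> Hom C v (shO C (a 0))"
    using angle_in[OF a(1), of d] angle_in[OF a(1), of "d + 1"] a(3) angle_shO(1)[OF a(1), of "d + 2" 0] by auto
qed

lemma rigid: "t \<in> addcat C T \<Longrightarrow> t' \<in> addcat C T \<Longrightarrow> f \<in> Hom C t (shO C t') \<Longrightarrow> f = 0"
  using tilting unfolding OT_cluster_tilting_def by blast

lemma resolution_res:
  assumes "resolution C d (addcat C T) ts v"
  obtains a \<alpha> where "res a \<alpha> v" "\<And>i. i \<le> d \<Longrightarrow> a i = ts ! i"
proof -
  obtain \<gamma> where ts: "length ts = d + 1" "set ts \<subseteq> addcat C T" "(ts @ [v], \<gamma>) \<in> angles C"
    using assms by (auto simp: resolution_def)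
  obtain a \<alpha> where a: "angle a \<alpha>" "\<And>i. i \<le> d + 1 \<Longrightarrow> a i = (ts @ [v]) ! i"
    using angle_unroll[OF ts(3)] by metis
  have "a i = ts ! i" if "i \<le> d" for i using a(2)[of i] that ts(1) by (simp add: nth_append)
  moreover have "a (d + 1) = v" using a(2)[of "d + 1"] ts(1) by (simp add: nth_append)
  moreover have "ts ! i \<in> addcat C T" if "i \<le> d" for i
    using ts(1,2) that nth_mem[of i ts] by auto
  ultimately show ?thesis using that a(1) unfolding res_def by auto
qed

lemma ex_resolution: "\<exists>ts. resolution C d (addcat C T) ts v"
  using tilting unfolding OT_cluster_tilting_def by blast

lemma ex_res: "\<exists>a \<alpha>. res a \<alpha> v"
  using ex_resolution resolution_res by metis

lemma res_approximation:
  assumes "res a \<alpha> v" "t \<in> addcat C T" "g \<in> Hom C t v"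
  obtains h where "h \<in> Hom C t (a d)" "g = \<alpha> d \<cdot> h"
proof -
  note r = resD[OF assms(1)]
  have "\<alpha> (Suc d) \<cdot> g = 0"
    using rigid[OF assms(2) r(2)[of 0]] cmp_closed[OF assms(3) r(6)] by simp
  then show ?thesis
    using angle_exact_right[OF r(1), of g t d] r(3) assms(3) that by auto
qed

text \<open>
  Exactness at the two ends is included, and everything is tested on \<open>Hom(t, -)\<close> for \<open>t\<close> in \<open>add T\<close>. As the
  terms lie in \<open>add T\<close>, such a complex splits.
\<close>

definition exact_complex :: "nat \<Rightarrow> (nat \<Rightarrow> 'o) \<Rightarrow> (nat \<Rightarrow> 'm) \<Rightarrow> bool" where
  "exact_complex n x m \<longleftrightarrow>
    (\<forall>i\<le>n. x i \<in> addcat C T) \<and> (\<forall>i<n. m i \<in> Hom C (x i) (x (Suc i))) \<and>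
    (\<forall>i. Suc i < n \<longrightarrow> m (Suc i) \<cdot> m i = 0) \<and>
    (\<forall>t\<in>addcat C T. \<forall>g\<in>Hom C t (x 0). m 0 \<cdot> g = 0 \<longrightarrow> g = 0) \<and>
    (\<forall>i. Suc i < n \<longrightarrow> (\<forall>t\<in>addcat C T. \<forall>g\<in>Hom C t (x (Suc i)). m (Suc i) \<cdot> g = 0 \<longrightarrow>
      (\<exists>h\<in>Hom C t (x i). g = m i \<cdot> h))) \<and>
    (\<forall>t\<in>addcat C T. \<forall>g\<in>Hom C t (x n). \<exists>h\<in>Hom C t (x (n - 1)). g = m (n - 1) \<cdot> h)"

text \<open>The last morphism of an angle inside \<open>add T\<close> is zero by rigidity, so the long exact sequence breaks up.\<close>

lemma angle_exact_complex:
  assumes w: "angle w \<omega>" and in_T: "\<And>i. i \<le> d + 1 \<Longrightarrow> w i \<in> addcat C T"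
  shows "exact_complex (d + 1) w \<omega>"
proof -
  note ty = angle_in[OF w]
  have sh: "w (d + 2) = shO C (w 0)" "\<omega> (d + 2) = scl C eps (shM C (\<omega> 0))"
    using angle_shO[OF w, of "d + 2" 0] by auto
  have last: "\<omega> (d + 1) = 0"
    using rigid[OF in_T[of "d + 1"] in_T[of 0]] ty[of "d + 1"] sh(1) by simp
  have "g = 0" if g: "g \<in> Hom C t (w 0)" "\<omega> 0 \<cdot> g = 0" for t g
  proof -
    have "\<omega> (d + 2) \<cdot> shM C g = 0"
      unfolding sh(2) using cmp_scl_left[OF sh_in[OF g(1)] sh_in[OF ty[of 0]]] sh_cmp[OF g(1) ty[of 0]] g(2)
      by (simp add: sh_zero)
    then obtain h where "h \<in> Hom C (shO C t) (w (d + 1))" "shM C g = \<omega> (d + 1) \<cdot> h"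
      using angle_exact_right[OF w, of "shM C g" "shO C t" "d + 1"] sh_in[OF g(1)] sh(1) by auto
    then have "shM C g = shM C 0" using last cmp_zero_left sh_zero by metis
    then show ?thesis using sh_eq_iff[OF g(1) zero_in] by blast
  qed
  moreover have "\<exists>h\<in>Hom C t (w d). g = \<omega> d \<cdot> h" if "g \<in> Hom C t (w (Suc d))" for t g
    using angle_exact_right[OF w that] last cmp_zero_left[OF that] by simp
  ultimately show ?thesis
    unfolding exact_complex_def using in_T ty angle_cmp_zero[OF w] angle_exact_right[OF w] by simp
qed

text \<open>
  The last morphism \<open>x\<^sub>n\<^sub>-\<^sub>1 \<rightarrow> x\<^sub>n\<close> has a section \<open>s\<close>. Adding \<open>x\<^sub>n\<close> to \<open>x\<^sub>n\<^sub>-\<^sub>2\<close>, mapped to \<open>x\<^sub>n\<^sub>-\<^sub>1\<close> by \<open>s\<close>,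
  shortens the complex by one term. In this way no idempotent has to be split.
\<close>

lemma exact_complex_shorten:
  assumes ex: "exact_complex (Suc (Suc n)) x m" and w: "direct_sum C [x n, x (Suc (Suc n))] w"
  obtains m' where "exact_complex (Suc n) (x(n := w)) m'"
proof -
  have in_T: "\<And>i. i \<le> n + 2 \<Longrightarrow> x i \<in> addcat C T" and ty: "\<And>i. i < n + 2 \<Longrightarrow> m i \<in> Hom C (x i) (x (Suc i))"
    and zero: "\<And>i. Suc i < n + 2 \<Longrightarrow> m (Suc i) \<cdot> m i = 0"
    and inj: "\<And>t g. t \<in> addcat C T \<Longrightarrow> g \<in> Hom C t (x 0) \<Longrightarrow> m 0 \<cdot> g = 0 \<Longrightarrow> g = 0"
    and exa: "\<And>i t g. Suc i < n + 2 \<Longrightarrow> t \<in> addcat C T \<Longrightarrow> g \<in> Hom C t (x (Suc i)) \<Longrightarrow> m (Suc i) \<cdot> g = 0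
      \<Longrightarrow> \<exists>h\<in>Hom C t (x i). g = m i \<cdot> h"
    and sur: "\<And>t g. t \<in> addcat C T \<Longrightarrow> g \<in> Hom C t (x (n + 2)) \<Longrightarrow> \<exists>h\<in>Hom C t (x (Suc n)). g = m (Suc n) \<cdot> h"
    using ex unfolding exact_complex_def by auto
  obtain i j p q where bip: "biproduct2 (x n) (x (n + 2)) w i j p q"
    using w by (auto simp: direct_sum_pair_iff)
  note h = biproduct2D(1-4)[OF bip] and e = biproduct2D(5-9)[OF bip]
  obtain s where s: "s \<in> Hom C (x (n + 2)) (x (Suc n))" "m (Suc n) \<cdot> s = Id (x (n + 2))"
    using sur[of "x (n + 2)" "Id (x (n + 2))"] in_T[of "n + 2"] ident_closed by auto
  have mn: "m n \<in> Hom C (x n) (x (Suc n))" and mn1: "m (Suc n) \<in> Hom C (x (Suc n)) (x (n + 2))"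
    using ty[of n] ty[of "Suc n"] by auto
  define l where "l = m n \<cdot> p + s \<cdot> q"
  have mp: "m n \<cdot> p \<in> Hom C w (x (Suc n))" and sq: "s \<cdot> q \<in> Hom C w (x (Suc n))"
    using cmp_closed[OF h(3) mn] cmp_closed[OF h(4) s(1)] .
  then have l: "l \<in> Hom C w (x (Suc n))" unfolding l_def by (rule add_in)
  have li: "l \<cdot> i = m n"
    unfolding l_def using cmp_add_left[OF h(1) mp sq] cmp_assoc[OF h(1,3) mn] cmp_assoc[OF h(1,4) s(1)] e
      cmp_ident_right[OF mn] cmp_zero_right[OF s(1)] by simp
  have lg: "l \<cdot> g = m n \<cdot> (p \<cdot> g) + s \<cdot> (q \<cdot> g)" if "g \<in> Hom C t w" for g t
    unfolding l_def using cmp_add_left[OF that mp sq] cmp_assoc[OF that h(3) mn] cmp_assoc[OF that h(4) s(1)] by simp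
  have decomp: "g = i \<cdot> (p \<cdot> g) + j \<cdot> (q \<cdot> g)" if "g \<in> Hom C t w" for g t
    using cmp_ident_left[OF that] e(5) cmp_add_left[OF that cmp_closed[OF h(3,1)] cmp_closed[OF h(4,2)]]
      cmp_assoc[OF that h(3,1)] cmp_assoc[OF that h(4,2)] by simp
  have kernel: "q \<cdot> g = 0 \<and> m n \<cdot> (p \<cdot> g) = 0" if g: "g \<in> Hom C t w" "l \<cdot> g = 0" for g t
  proof -
    have pg: "p \<cdot> g \<in> Hom C t (x n)" and qg: "q \<cdot> g \<in> Hom C t (x (n + 2))"
      using cmp_closed g(1) h by blast+
    have "m (Suc n) \<cdot> (l \<cdot> g) = (m (Suc n) \<cdot> m n) \<cdot> (p \<cdot> g) + (m (Suc n) \<cdot> s) \<cdot> (q \<cdot> g)"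
      unfolding lg[OF g(1)] using cmp_add_right[OF cmp_closed[OF pg mn] cmp_closed[OF qg s(1)] mn1]
        cmp_assoc[OF pg mn mn1] cmp_assoc[OF qg s(1) mn1] by simp
    then have "q \<cdot> g = 0"
      using g(2) zero[of n] s(2) cmp_zero_left[OF pg] cmp_ident_left[OF qg] cmp_zero_right[OF mn1] by simp
    then show ?thesis using lg[OF g(1)] g(2) cmp_zero_right[OF s(1)] by simp
  qed
  define m' where "m' k = (if k = n then l else if Suc k = n then i \<cdot> m k else m k)" for k
  let ?x = "x(n := w)"
  have im: "i \<cdot> m k \<in> Hom C (x k) w" if "Suc k = n" for k
    using cmp_closed[OF ty[of k], of i w] h(1) that by simp
  have w_in: "w \<in> addcat C T" using addcat_sum[OF in_T in_T w] by simp
  have 1: "?x k \<in> addcat C T" if "k \<le> Suc n" for k using in_T[of k] w_in that by simp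
  have 2: "m' k \<in> Hom C (?x k) (?x (Suc k))" if "k < Suc n" for k
    using ty[of k] l im[of k] that by (auto simp: m'_def)
  have 3: "m' (Suc k) \<cdot> m' k = 0" if k: "Suc k < Suc n" for k
  proof (cases "Suc k = n")
    case True
    have "l \<cdot> (i \<cdot> m k) = m n \<cdot> m k"
      using cmp_assoc[OF ty[of k], of i w l "x (Suc n)"] h(1) l li True by simp
    then show ?thesis using zero[of k] True by (auto simp: m'_def)
  next
    case False
    have "m (Suc k) \<cdot> m k = 0" using zero k by simp
    moreover have "(i \<cdot> m (Suc k)) \<cdot> m k = 0" if "Suc (Suc k) = n"
      using cmp_assoc[OF ty[of k] ty[of "Suc k"], of i w] h(1) that \<open>m (Suc k) \<cdot> m k = 0\<close> cmp_zero_right[OF h(1)] by simp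
    ultimately show ?thesis using False k by (auto simp: m'_def)
  qed
  have 4: "g = 0" if g: "t \<in> addcat C T" "g \<in> Hom C t (?x 0)" "m' 0 \<cdot> g = 0" for t g
  proof -
    consider "n = 0" | "n = 1" | "n > 1" by linarith
    then show ?thesis
    proof cases
      case 1
      then have gw: "g \<in> Hom C t w" and lg0: "l \<cdot> g = 0" using g by (auto simp: m'_def)
      have "p \<cdot> g = 0"
        using inj[OF g(1), of "p \<cdot> g"] kernel[OF gw lg0] cmp_closed[OF gw h(3)] 1 by simp
      then show ?thesis
        using decomp[OF gw] kernel[OF gw lg0] cmp_zero_right[OF h(1)] cmp_zero_right[OF h(2)] by simp
    next
      case 2
      then have gw: "g \<in> Hom C t (x 0)" and z: "(i \<cdot> m 0) \<cdot> g = 0" using g by (auto simp: m'_def)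
      have mg: "m 0 \<cdot> g \<in> Hom C t (x n)" using cmp_closed[OF gw ty[of 0]] 2 by simp
      have "i \<cdot> (m 0 \<cdot> g) = 0" using cmp_assoc[OF gw ty[of 0], of i w] h(1) z 2 by simp
      then have "m 0 \<cdot> g = 0"
        using cmp_assoc[OF mg h(1,3)] e(1) cmp_ident_left[OF mg] cmp_zero_right[OF h(3)] by simp
      then show ?thesis using inj[OF g(1) gw] by simp
    next
      case 3
      then show ?thesis using inj g by (auto simp: m'_def)
    qed
  qed
  have 5: "\<exists>h\<in>Hom C t (?x k). g = m' k \<cdot> h"
    if k: "Suc k < Suc n" and g: "t \<in> addcat C T" "g \<in> Hom C t (?x (Suc k))" "m' (Suc k) \<cdot> g = 0" for k t g
  proof -
    consider "Suc k = n" | "Suc (Suc k) = n" | "Suc (Suc k) < n" using k by linarith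
    then show ?thesis
    proof cases
      case 1
      then have gw: "g \<in> Hom C t w" and lg0: "l \<cdot> g = 0" using g by (auto simp: m'_def)
      obtain f where f: "f \<in> Hom C t (x k)" "p \<cdot> g = m k \<cdot> f"
        using exa[of k t "p \<cdot> g"] kernel[OF gw lg0] cmp_closed[OF gw h(3)] g(1) 1 by auto
      have "g = i \<cdot> (m k \<cdot> f)"
        using decomp[OF gw] kernel[OF gw lg0] f cmp_zero_right[OF h(2)] by simp
      then have "g = m' k \<cdot> f"
        using cmp_assoc[OF f(1) ty[of k], of i w] h(1) 1 by (auto simp: m'_def)
      then show ?thesis using f(1) 1 by auto
    next
      case 2
      have gw: "g \<in> Hom C t (x (Suc k))" and z: "(i \<cdot> m (Suc k)) \<cdot> g = 0" using g 2 by (auto simp: m'_def)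
      have mg: "m (Suc k) \<cdot> g \<in> Hom C t (x n)" using cmp_closed[OF gw ty[of "Suc k"]] 2 by simp
      have "i \<cdot> (m (Suc k) \<cdot> g) = 0" using cmp_assoc[OF gw ty[of "Suc k"], of i w] h(1) z 2 by simp
      then have "m (Suc k) \<cdot> g = 0"
        using cmp_assoc[OF mg h(1,3)] e(1) cmp_ident_left[OF mg] cmp_zero_right[OF h(3)] by simp
      then show ?thesis using exa[of k t g] gw g(1) 2 by (auto simp: m'_def)
    next
      case 3
      then show ?thesis using exa[of k t g] g by (auto simp: m'_def)
    qed
  qed
  have 6: "\<exists>h\<in>Hom C t (?x (Suc n - 1)). g = m' (Suc n - 1) \<cdot> h"
    if g: "t \<in> addcat C T" "g \<in> Hom C t (?x (Suc n))" for t g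
  proof -
    have gx: "g \<in> Hom C t (x (Suc n))" using g by simp
    have mg: "m (Suc n) \<cdot> g \<in> Hom C t (x (n + 2))" using cmp_closed[OF gx mn1] .
    have sg: "s \<cdot> (m (Suc n) \<cdot> g) \<in> Hom C t (x (Suc n))" using cmp_closed[OF mg s(1)] .
    have "m (Suc n) \<cdot> (g - s \<cdot> (m (Suc n) \<cdot> g)) = 0"
      using cmp_diff_right[OF gx sg mn1] cmp_assoc[OF mg s(1) mn1] s(2) cmp_ident_left[OF mg] by simp
    then obtain f where f: "f \<in> Hom C t (x n)" "g - s \<cdot> (m (Suc n) \<cdot> g) = m n \<cdot> f"
      using exa[of n t] g(1) diff_in[OF gx sg] by auto
    have if': "i \<cdot> f \<in> Hom C t w" and jm: "j \<cdot> (m (Suc n) \<cdot> g) \<in> Hom C t w"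
      using cmp_closed[OF f(1) h(1)] cmp_closed[OF mg h(2)] .
    have "l \<cdot> (j \<cdot> (m (Suc n) \<cdot> g)) = s \<cdot> (m (Suc n) \<cdot> g)"
      using lg[OF jm] cmp_assoc[OF mg h(2,3)] cmp_assoc[OF mg h(2,4)] e cmp_zero_left[OF mg] cmp_ident_left[OF mg]
        cmp_zero_right[OF mn] by simp
    moreover have "l \<cdot> (i \<cdot> f) = m n \<cdot> f"
      using cmp_assoc[OF f(1) h(1) l] li by simp
    ultimately have "l \<cdot> (i \<cdot> f + j \<cdot> (m (Suc n) \<cdot> g)) = g"
      using cmp_add_right[OF if' jm l] f(2) by (simp add: algebra_simps)
    then show ?thesis
      using add_in[OF if' jm] by (intro bexI[of _ "i \<cdot> f + j \<cdot> (m (Suc n) \<cdot> g)"]) (auto simp: m'_def)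
  qed
  have "exact_complex (Suc n) ?x m'"
    unfolding exact_complex_def
  proof (intro conjI allI impI ballI)
    fix t g assume "t \<in> addcat C T" "g \<in> Hom C t (?x (Suc n))"
    then show "\<exists>h\<in>Hom C t (?x (Suc n - 1)). g = m' (Suc n - 1) \<cdot> h" by (rule 6)
  qed (erule (2) 4 | erule (3) 5 | erule 1 | erule 2 | erule 3)+
  then show ?thesis by (rule that)
qed

end

text \<open>
  \<open>f\<close> is additive on \<open>add T\<close> modulo the subgroup \<open>N\<close>. With \<open>N = {0}\<close> this is an element of the dual
  of the split Grothendieck group, with \<open>N\<close> the subgroup of relations and \<open>f = frag_of\<close> it is the universal such map.
\<close>

locale additive_function = cluster_tilting C d T
  for C :: "('o, 'm::ab_group_add, 'k::field, 'z) angcat_scheme" (structure) and d :: nat and T :: 'o +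
  fixes N :: "'g::ab_group_add set" and f :: "'o \<Rightarrow> 'g"
  assumes N_zero: "0 \<in> N"
    and N_diff: "a \<in> N \<Longrightarrow> b \<in> N \<Longrightarrow> a - b \<in> N"
    and f_sum: "x \<in> addcat C T \<Longrightarrow> y \<in> addcat C T \<Longrightarrow> direct_sum C [x, y] z \<Longrightarrow> f z - (f x + f y) \<in> N"
begin

lemma N_minus: "x \<in> N \<Longrightarrow> - x \<in> N"
  using N_diff[OF N_zero] by simp

lemma N_add: "x \<in> N \<Longrightarrow> y \<in> N \<Longrightarrow> x + y \<in> N"
  using N_diff[OF _ N_minus, of x y] by simp

lemma N_altsum: "(\<And>i. i \<le> n \<Longrightarrow> g i \<in> N) \<Longrightarrow> altsum n g \<in> N"
  by (induction n) (auto simp: altsum_0 altsum_Suc intro: N_add N_diff)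

lemma N_trans: "x - y \<in> N \<Longrightarrow> y \<in> N \<Longrightarrow> x \<in> N"
  using N_add[of "x - y" y] by simp

lemma f_zero_object:
  assumes "zero_object C z"
  shows "f z \<in> N"
  using f_sum[of z z z] addcat_zero[OF assms] direct_sum_zero[OF assms isomorphic_refl] N_minus by fastforce

lemma f_iso:
  assumes "x \<in> addcat C T" "isomorphic C x y"
  shows "f y - f x \<in> N"
proof -
  obtain z where z: "zero_object C z" using ex_zero_object by blast
  have "f y - (f x + f z) \<in> N"
    using f_sum[OF assms(1) addcat_zero[OF z] direct_sum_zero[OF z assms(2)]] .
  then show ?thesis using N_add[OF _ f_zero_object[OF z]] by fastforce
qed

lemma exact_complex_altsum: "exact_complex (Suc n) x m \<Longrightarrow> altsum (Suc n) (\<lambda>i. f (x i)) \<in> N"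
proof (induction n arbitrary: x m)
  case 0
  have in_T: "x 0 \<in> addcat C T" "x 1 \<in> addcat C T" and ty: "m 0 \<in> Hom C (x 0) (x 1)"
    and inj: "\<And>t g. t \<in> addcat C T \<Longrightarrow> g \<in> Hom C t (x 0) \<Longrightarrow> m 0 \<cdot> g = 0 \<Longrightarrow> g = 0"
    and sur: "\<And>t g. t \<in> addcat C T \<Longrightarrow> g \<in> Hom C t (x 1) \<Longrightarrow> \<exists>h\<in>Hom C t (x 0). g = m 0 \<cdot> h"
    using 0 unfolding exact_complex_def by auto
  obtain s where s: "s \<in> Hom C (x 1) (x 0)" "Id (x 1) = m 0 \<cdot> s"
    using sur[OF in_T(2) ident_closed] by blast
  have sm: "s \<cdot> m 0 \<in> Hom C (x 0) (x 0)" using cmp_closed[OF ty s(1)] .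
  have "m 0 \<cdot> (s \<cdot> m 0 - Id (x 0)) = 0"
    using cmp_diff_right[OF sm ident_closed ty] cmp_assoc[OF ty s(1) ty] s(2) cmp_ident_left[OF ty]
      cmp_ident_right[OF ty] by simp
  then have "s \<cdot> m 0 = Id (x 0)"
    using inj[OF in_T(1) diff_in[OF sm ident_closed]] by simp
  then have "isomorphic C (x 0) (x 1)"
    using isomorphicI[OF ty s(1)] s(2) by simp
  then have "- (f (x 1) - f (x 0)) \<in> N" using f_iso[OF in_T(1)] N_minus by blast
  then show ?case by (simp add: altsum_Suc altsum_0)
next
  case (Suc n)
  obtain w where w: "direct_sum C [x n, x (Suc (Suc n))] w" using ex_direct_sum by blast
  obtain m' where "exact_complex (Suc n) (x(n := w)) m'"
    using exact_complex_shorten[OF Suc.prems w] by blast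
  then have IH: "altsum (Suc n) (\<lambda>i. f ((x(n := w)) i)) \<in> N" by (rule Suc.IH)
  have "x n \<in> addcat C T" "x (Suc (Suc n)) \<in> addcat C T"
    using Suc.prems by (auto simp: exact_complex_def)
  then have fw: "f w - (f (x n) + f (x (Suc (Suc n)))) \<in> N" using f_sum w by blast
  have "altsum n (\<lambda>i. f ((x(n := w)) i)) - altsum n (\<lambda>i. f (x i))
      = (if even n then f w - f (x n) else - (f w - f (x n)))"
  proof (cases n)
    case (Suc k)
    have "altsum k (\<lambda>i. f ((x(n := w)) i)) = altsum k (\<lambda>i. f (x i))"
      by (rule altsum_cong) (simp add: Suc)
    then show ?thesis using Suc by (simp add: altsum_Suc)
  qed (simp add: altsum_0)
  then have "altsum (Suc (Suc n)) (\<lambda>i. f (x i)) - altsum (Suc n) (\<lambda>i. f ((x(n := w)) i))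
      = (if even n then - (f w - (f (x n) + f (x (Suc (Suc n))))) else f w - (f (x n) + f (x (Suc (Suc n)))))"
    by (auto simp: altsum_Suc algebra_simps)
  also have "\<dots> \<in> N" using fw N_minus[OF fw] by auto
  finally show ?case using IH N_trans by blast
qed

text \<open>
  The pushout of the two resolutions has all its terms in \<open>add T\<close>.
\<close>

lemma res_unique:
  assumes a: "res a \<alpha> v" and x: "res x \<xi> v"
  shows "altsum d (\<lambda>i. f (a i)) - altsum d (\<lambda>i. f (x i)) \<in> N"
proof -
  note ra = resD[OF a] and rx = resD[OF x]
  obtain q where q: "q \<in> Hom C (a d) (x d)" "\<alpha> d = \<xi> d \<cdot> q"
    using res_approximation[OF x ra(2)[OF order_refl] ra(5)] by blast
  obtain w \<omega> where w: "angle w \<omega>" "w 0 = a 0" "w (d + 1) = x d"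
    "\<And>i. i < d \<Longrightarrow> direct_sum C [a (Suc i), x i] (w (Suc i))"
    using angle_pushout[OF ra(1) rx(1) _ q(1)] q(2) ra(3) rx(3) by metis
  have w_in: "w i \<in> addcat C T" if "i \<le> d + 1" for i
  proof -
    from that have "i \<le> Suc d" by simp
    then show ?thesis
      using w ra(2) rx(2) addcat_sum[OF ra(2) rx(2) w(4)] by (cases rule: pushout_index_cases) auto
  qed
  have 1: "altsum (Suc d) (\<lambda>i. f (w i)) \<in> N"
    using exact_complex_altsum angle_exact_complex[OF w(1) w_in] by simp
  let ?h = "\<lambda>i. (if i \<le> d then f (a i) else 0) + (if i = 0 then 0 else f (x (i - 1)))"
  have "f (w i) - ?h i \<in> N" if "i \<le> Suc d" for i
  proof -
    from that show ?thesis
      using w(2,3) f_sum[OF ra(2) rx(2) w(4)] N_zero by (cases rule: pushout_index_cases) auto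
  qed
  then have "altsum (Suc d) (\<lambda>i. f (w i)) - altsum (Suc d) ?h \<in> N"
    using N_altsum[of "Suc d" "\<lambda>i. f (w i) - ?h i"] by (simp add: altsum_diff)
  then have "altsum (Suc d) ?h \<in> N"
    using N_diff[OF 1] by fastforce
  then show ?thesis using altsum_pushout[of d "\<lambda>i. f (a i)" "\<lambda>i. f (x i)"] by simp
qed

end

locale integer_additive_function = additive_function C d T "{0 :: int}" f
  for C :: "('o, 'm::ab_group_add, 'k::field, 'z) angcat_scheme" (structure) and d :: nat and T :: 'o and f :: "'o \<Rightarrow> int"
begin

definition res_sum :: "'o \<Rightarrow> int" where
  "res_sum v = (THE k. \<exists>a \<alpha>. res a \<alpha> v \<and> k = altsum d (\<lambda>i. f (a i)))"

lemma res_sum_eq: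
  assumes "res a \<alpha> v"
  shows "res_sum v = altsum d (\<lambda>i. f (a i))"
  unfolding res_sum_def using assms res_unique by (intro the_equality) fastforce+

lemma f_additive: "x \<in> addcat C T \<Longrightarrow> y \<in> addcat C T \<Longrightarrow> direct_sum C [x, y] z \<Longrightarrow> f z = f x + f y"
  using f_sum by fastforce

lemma f_zero: "zero_object C z \<Longrightarrow> f z = 0"
  using f_zero_object by simp

text \<open>
  Here \<open>0 \<rightarrow> \<dots> \<rightarrow> 0 \<rightarrow> t \<rightarrow> t\<close> is a resolution, with \<open>t\<close> at index \<open>d\<close>, whence the sign.
\<close>

lemma res_sum_in:
  assumes "t \<in> addcat C T"
  shows "res_sum t = (-1) ^ d * f t"
proof -
  obtain y \<upsilon> z where y: "angle y \<upsilon>" "y 0 = t" "y (Suc 0) = t" "zero_object C z"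
    "\<And>i. 2 \<le> i \<Longrightarrow> i \<le> d + 1 \<Longrightarrow> y i = z"
    using ident_angle[of t] by metis
  obtain w \<omega> where w: "angle w \<omega>" "\<And>i. w (i + d) = y i"
    using angle_shift_back_n[OF y(1), of d] by blast
  have wd: "w d = t" "w (d + 1) = t" using w(2)[of 0] w(2)[of 1] y by auto
  have wz: "zero_object C (w i)" if "i < d" for i
  proof -
    have "shO C (w i) = z"
      using angle_shO(1)[OF w(1), of "i + (d + 2)" i] w(2)[of "i + 2"] y(5)[of "i + 2"] that
      by (simp add: add.assoc add.commute)
    then have "shM C (Id (w i)) = shM C 0" using y(4) by (simp add: sh_ident sh_zero zero_object_iff)
    then show ?thesis using sh_eq_iff[OF ident_closed zero_in] by (simp add: zero_object_iff)
  qed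
  have "res w \<omega> t"
    unfolding res_def using w(1) wd wz addcat_zero assms by (metis le_neq_implies_less)
  then have "res_sum t = altsum d (\<lambda>i. f (w i))" by (rule res_sum_eq)
  also have "\<dots> = altsum d (\<lambda>i. if i = d then f t else 0)"
    using wd wz f_zero by (intro altsum_cong) auto
  also have "\<dots> = (-1) ^ d * f t"
  proof -
    have "altsum d (\<lambda>i. if i = d then f t else 0) = (\<Sum>i\<le>d. if i = d then (if even d then f t else - f t) else 0)"
      unfolding altsum_def by (intro sum.cong) auto
    then show ?thesis by (simp add: minus_one_power_iff)
  qed
  finally show ?thesis .
qed

lemma res_sum_additive:
  assumes "direct_sum C [x, y] z"
  shows "res_sum z = res_sum x + res_sum y"
proof -
  obtain a \<alpha> b \<beta> where r: "res a \<alpha> x" "res b \<beta> y" using ex_res by metis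
  note ra = resD[OF r(1)] and rb = resD[OF r(2)]
  obtain e \<epsilon> where e: "angle e \<epsilon>" "\<And>i. i \<le> d + 1 \<Longrightarrow> direct_sum C [a i, b i] (e i)" "e (d + 1) = z"
    using angle_direct_sum[OF ra(1) rb(1)] assms ra(3) rb(3) by metis
  have "res e \<epsilon> z"
    unfolding res_def using e addcat_sum[OF ra(2) rb(2) e(2)] by simp
  then have "res_sum z = altsum d (\<lambda>i. f (e i))" by (rule res_sum_eq)
  also have "\<dots> = altsum d (\<lambda>i. f (a i) + f (b i))"
    using e(2) f_additive ra(2) rb(2) by (intro altsum_cong) simp
  finally show ?thesis using res_sum_eq r by (simp add: altsum_add)
qed

lemma res_sum_direct_sum_eq_0:
  "direct_sum C xs x \<Longrightarrow> (\<And>y. y \<in> set xs \<Longrightarrow> res_sum y = 0) \<Longrightarrow> res_sum x = 0"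
proof (induction xs arbitrary: x)
  case Nil
  then show ?case using res_sum_in f_zero addcat_zero by (simp add: direct_sum_Nil_iff)
next
  case (Cons a xs)
  obtain y where y: "direct_sum C xs y" using ex_direct_sum_list by blast
  then have "direct_sum C [a, y] x"
    using direct_sum_regroup[of "[a]" xs x a y] Cons.prems(1) direct_sum_single by simp
  then show ?case using res_sum_additive Cons.IH[OF y] Cons.prems(2) by simp
qed

text \<open>
  Pushing out along a resolution of the last term moves the terms of the angle one place to the
  right and puts objects of \<open>add T\<close> in front; after at most \<open>d + 1\<close> steps the angle is a resolution.
\<close>

lemma res_sum_angle:
  assumes "angle a \<alpha>" "\<And>t g. t \<in> addcat C T \<Longrightarrow> g \<in> Hom C t (a (d + 1)) \<Longrightarrow> \<alpha> (d + 1) \<cdot> g = 0"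
  shows "altsum (Suc d) (\<lambda>i. res_sum (a i)) = 0"
proof -
  have gen: "altsum (Suc d) (\<lambda>i. res_sum (a i)) = 0"
    if "k \<le> d + 1" "angle a \<alpha>" "\<And>t g. t \<in> addcat C T \<Longrightarrow> g \<in> Hom C t (a (d + 1)) \<Longrightarrow> \<alpha> (d + 1) \<cdot> g = 0"
      "\<And>i. i < k \<Longrightarrow> a i \<in> addcat C T" for k a \<alpha>
    using that
  proof (induction k arbitrary: a \<alpha> rule: inc_induct)
    case base
    then have "res a \<alpha> (a (d + 1))" by (simp add: res_def)
    then have "res_sum (a (Suc d)) = altsum d (\<lambda>i. f (a i))" using res_sum_eq by simp
    moreover have "altsum d (\<lambda>i. res_sum (a i)) = (-1) ^ d * altsum d (\<lambda>i. f (a i))"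
      unfolding altsum_mult[symmetric] using base(3) res_sum_in by (intro altsum_cong) simp
    ultimately show ?case by (simp add: altsum_Suc)
  next
    case (step k)
    note a = step.prems(1) and van = step.prems(2) and in_T = step.prems(3)
    obtain r \<rho> where r: "res r \<rho> (a (d + 1))" using ex_res by blast
    note rr = resD[OF r]
    have ad: "\<alpha> d \<in> Hom C (a d) (a (d + 1))" using angle_in[OF a, of d] by simp
    obtain q where q: "q \<in> Hom C (r d) (a d)" "\<rho> d = \<alpha> d \<cdot> q"
      using angle_exact_right[OF a, of "\<rho> d" "r d" d] van[OF rr(2)[OF order_refl] rr(5)] rr(5) by auto
    obtain w \<omega> where w: "angle w \<omega>" "w 0 = r 0" "w (d + 1) = a d"
      "\<And>i. i < d \<Longrightarrow> direct_sum C [r (Suc i), a i] (w (Suc i))" "\<omega> (d + 1) = \<rho> (d + 1) \<cdot> \<alpha> d"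
      using angle_pushout[OF rr(1) a rr(3) q(1) q(2)[symmetric]] by metis
    have "\<omega> (d + 1) \<cdot> g = 0" if "t \<in> addcat C T" "g \<in> Hom C t (w (d + 1))" for t g
      using cmp_assoc[OF _ ad rr(6), of g t] rigid[OF that(1) rr(2)[of 0] cmp_closed[OF cmp_closed[OF _ ad] rr(6)]]
        w(3,5) that(2) by simp
    moreover have "w i \<in> addcat C T" if "i < Suc k" for i
      using that w(2) rr(2) step.hyps addcat_sum[OF rr(2) in_T w(4)] by (cases i) auto
    ultimately have "altsum (Suc d) (\<lambda>i. res_sum (w i)) = 0"
      using step.IH[OF w(1)] by blast
    moreover have "res_sum (w i) = (if i \<le> d then res_sum (r i) else 0) + (if i = 0 then 0 else res_sum (a (i - 1)))"
      if "i \<le> Suc d" for i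
    proof -
      from that show ?thesis
        using w(2,3) res_sum_additive[OF w(4)] by (cases rule: pushout_index_cases) auto
    qed
    ultimately have "altsum d (\<lambda>i. res_sum (r i)) = altsum d (\<lambda>i. res_sum (a i))"
      using altsum_pushout[of d "\<lambda>i. res_sum (r i)" "\<lambda>i. res_sum (a i)"]
        altsum_cong[of "Suc d" "\<lambda>i. res_sum (w i)"] by simp
    moreover have "altsum d (\<lambda>i. res_sum (r i)) = (-1) ^ d * altsum d (\<lambda>i. f (r i))"
      unfolding altsum_mult[symmetric] using rr(2) res_sum_in by (intro altsum_cong) simp
    moreover have "res_sum (a (Suc d)) = altsum d (\<lambda>i. f (r i))" using res_sum_eq[OF r] by simp
    ultimately show ?case by (cases "even d") (simp_all add: altsum_Suc)
  qed
  show ?thesis using gen[of 0 a \<alpha>] assms by simp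
qed

text \<open>
  A \<open>U\<close>-resolution of \<open>\<Sigma>\<^sup>d t\<close>, rotated back by one step, is an angle that begins with \<open>t\<close> and continues in
  \<open>add U\<close>. Its last morphism ends in \<open>\<Sigma>\<^sup>d t\<close> and is killed by \<open>F\<^sub>T\<close>.
\<close>

lemma res_sum_determines:
  assumes "krull_schmidt C" "OT_cluster_tilting C d U" "\<And>v. v \<in> Indec C (addcat C U) \<Longrightarrow> res_sum v = 0"
    and t: "t \<in> addcat C T"
  shows "f t = 0"
proof -
  interpret U: cluster_tilting C d U by unfold_locales (rule assms(2))
  obtain r \<rho> where r: "U.res r \<rho> (shO C t)" using U.ex_res by blast
  note rr = U.resD[OF r]
  have zero: "res_sum (r i) = 0" if i: "i \<le> d" for i
  proof -
    obtain xs where "direct_sum C xs (r i)" "set xs \<subseteq> Indec C (addcat C U)"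
      using addcat_decompose[OF assms(1) rr(2)[OF i]] by blast
    then show ?thesis using res_sum_direct_sum_eq_0 assms(3) by blast
  qed
  obtain w \<omega> where w: "angle w \<omega>" "\<And>i. w (Suc i) = r i"
    using angle_shift_back[OF rr(1)] by metis
  have w0: "w 0 = t"
    using angle_shO(1)[OF w(1), of "d + 2" 0] w(2)[of "d + 1"] rr(3) shO_eq_iff by simp
  have "\<omega> (d + 1) \<cdot> g = 0" if "t' \<in> addcat C T" "g \<in> Hom C t' (w (d + 1))" for t' g
    using rigid[OF that(1) t] cmp_closed[OF that(2) angle_in[OF w(1)]] angle_shO(1)[OF w(1), of "d + 2" 0] w0 by simp
  then have "altsum (Suc d) (\<lambda>i. res_sum (w i)) = 0" using res_sum_angle[OF w(1)] by blast
  then have "res_sum t - altsum d (\<lambda>i. res_sum (r i)) = 0"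
    unfolding altsum_Suc_shift using w0 w(2) by simp
  moreover have "altsum d (\<lambda>i. res_sum (r i)) = altsum d (\<lambda>i. 0)"
    using zero by (intro altsum_cong) simp
  ultimately show ?thesis using res_sum_in[OF t] by (simp add: altsum_zero)
qed

end

section \<open>The split Grothendieck group and the index\<close>

text \<open>
  The expression in the definition of the index, for an arbitrary group.
\<close>

definition altprod :: "('a, 'b) monoid_scheme \<Rightarrow> nat \<Rightarrow> (nat \<Rightarrow> 'a) \<Rightarrow> 'a" where
  "altprod G n x = (\<Otimes>\<^bsub>G\<^esub>i\<in>{..n}. x i [^]\<^bsub>G\<^esub> ((-1) ^ i :: int))"

lemma (in group) int_pow_sign: "x \<in> carrier G \<Longrightarrow> x [^] ((-1) ^ i :: int) = (if even i then x else inv x)"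
  using int_pow_neg[of x 1] by (simp add: minus_one_power_iff)

lemma (in comm_group) altprod_rec:
  assumes "\<And>i. x i \<in> carrier G"
  shows "altprod G 0 x = x 0"
    "altprod G (Suc n) x = altprod G n x \<otimes> (if even n then inv (x (Suc n)) else x (Suc n))"
    "altprod G n x \<in> carrier G"
proof -
  have p: "x i [^] ((-1) ^ i :: int) = (if even i then x i else inv (x i))" for i
    using int_pow_sign assms by simp
  then show "altprod G 0 x = x 0" unfolding altprod_def using assms by simp
  show "altprod G n x \<in> carrier G" unfolding altprod_def using assms by (intro finprod_closed) auto
  have "altprod G (Suc n) x = x (Suc n) [^] ((-1) ^ Suc n :: int) \<otimes> altprod G n x"
    unfolding altprod_def atMost_Suc using assms by (intro finprod_insert) auto
  also have "\<dots> = altprod G n x \<otimes> x (Suc n) [^] ((-1) ^ Suc n :: int)"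
    unfolding altprod_def using assms by (intro m_comm finprod_closed int_pow_closed) auto
  finally show "altprod G (Suc n) x = altprod G n x \<otimes> (if even n then inv (x (Suc n)) else x (Suc n))"
    unfolding p by simp
qed

lemma hom_altprod:
  assumes "comm_group G" "comm_group H" "h \<in> hom G H" "\<And>i. x i \<in> carrier G"
  shows "h (altprod G n x) = altprod H n (\<lambda>i. h (x i))"
proof -
  interpret G: comm_group G by (rule assms(1))
  interpret H: comm_group H by (rule assms(2))
  interpret h: group_hom G H h by unfold_locales (rule assms(3))
  note hx = h.hom_closed[OF assms(4)]
  show ?thesis
    using assms(4) G.altprod_rec(3)[OF assms(4)]
    by (induction n) (simp_all add: G.altprod_rec[OF assms(4)] H.altprod_rec[where x = "\<lambda>i. h (x i)", OF hx])
qed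

lemma altprod_cong:
  assumes "comm_group G" "\<And>i. x i \<in> carrier G" "\<And>i. i \<le> n \<Longrightarrow> y i = x i"
  shows "altprod G n y = altprod G n x"
proof -
  interpret comm_group G by (rule assms(1))
  show ?thesis
    unfolding altprod_def by (rule finprod_cong') (use assms in auto)
qed

lemma altprod_integer_group: "altprod integer_group n x = altsum n x"
  by (induction n) (simp_all add: comm_group.altprod_rec[OF abelian_integer_group] altsum_0 altsum_Suc)

lemma altprod_free_Abelian_group:
  assumes "\<And>i. t i \<in> S"
  shows "altprod (free_Abelian_group S) n (\<lambda>i. frag_of (t i)) = altsum n (\<lambda>i. frag_of (t i))"
  by (induction n)
    (simp_all add: comm_group.altprod_rec[OF abelian_free_Abelian_group, of "\<lambda>i. frag_of (t i)"] assms altsum_0 altsum_Suc)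

lemma altsum_rev: "altsum n (\<lambda>i. h (n - i)) = (if even n then altsum n h else - altsum n h)"
proof (induction n arbitrary: h)
  case (Suc n)
  have "altsum (Suc n) (\<lambda>i. h (Suc n - i)) = h (Suc n) - altsum n (\<lambda>i. h (n - i))"
    by (simp add: altsum_Suc_shift)
  then show ?case using Suc by (simp add: altsum_Suc)
qed (simp add: altsum_0)

context cluster_tilting
begin

abbreviation Fr where "Fr \<equiv> free_Abelian_group (addcat C T)"
abbreviation Rel where "Rel \<equiv> K0_kernel C (addcat C T)"
abbreviation K0 where "K0 \<equiv> K0_split C (addcat C T)"

lemma relations_carrier: "K0_relations C (addcat C T) \<subseteq> carrier Fr"
proof
  fix r assume "r \<in> K0_relations C (addcat C T)"
  then obtain t t0 t1 where r: "r = frag_of t - (frag_of t0 + frag_of t1)"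
    "t \<in> addcat C T" "t0 \<in> addcat C T" "t1 \<in> addcat C T"
    by (auto simp: K0_relations_def)
  have "Poly_Mapping.keys (frag_of t - (frag_of t0 + frag_of t1)) \<subseteq> Poly_Mapping.keys (frag_of t) \<union> (Poly_Mapping.keys (frag_of t0) \<union> Poly_Mapping.keys (frag_of t1))"
    using keys_diff keys_add by (metis (no_types, lifting) Un_mono order_refl order_trans)
  then show "r \<in> carrier Fr" using r by auto
qed

lemma Rel_subgroup: "subgroup Rel Fr"
  unfolding K0_kernel_def using group.generate_is_subgroup[OF group_free_Abelian_group relations_carrier] .

lemma Rel_normal: "Rel \<lhd> Fr"
  using comm_group.subgroup_imp_normal[OF abelian_free_Abelian_group Rel_subgroup] .

lemma K0_comm_group: "comm_group K0"
  unfolding K0_split_def by (rule comm_group.abelian_FactGroup[OF abelian_free_Abelian_group Rel_subgroup])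

lemma coset_hom: "(\<lambda>x. Rel #>\<^bsub>Fr\<^esub> x) \<in> hom Fr K0"
  unfolding K0_split_def by (rule normal.r_coset_hom_Mod[OF Rel_normal])

lemma Rel_zero: "0 \<in> Rel"
  using subgroup.one_closed[OF Rel_subgroup] by simp

lemma Rel_add: "x \<in> Rel \<Longrightarrow> y \<in> Rel \<Longrightarrow> x + y \<in> Rel"
  using subgroup.m_closed[OF Rel_subgroup, of x y] by simp

lemma Rel_minus: "x \<in> Rel \<Longrightarrow> - x \<in> Rel"
  using subgroup.m_inv_closed[OF Rel_subgroup, of x] subgroup.mem_carrier[OF Rel_subgroup, of x] by simp

lemma coset_def: "Rel #>\<^bsub>Fr\<^esub> x = {h + x | h. h \<in> Rel}"
  by (auto simp: r_coset_def)

lemma coset_eq_iff: "Rel #>\<^bsub>Fr\<^esub> x = Rel #>\<^bsub>Fr\<^esub> y \<longleftrightarrow> x - y \<in> Rel"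
proof
  assume "Rel #>\<^bsub>Fr\<^esub> x = Rel #>\<^bsub>Fr\<^esub> y"
  moreover have "x \<in> Rel #>\<^bsub>Fr\<^esub> x" unfolding coset_def using Rel_zero by force
  ultimately show "x - y \<in> Rel" unfolding coset_def by auto
next
  have sub: "Rel #>\<^bsub>Fr\<^esub> x \<subseteq> Rel #>\<^bsub>Fr\<^esub> y" if "x - y \<in> Rel" for x y
  proof
    fix z assume "z \<in> Rel #>\<^bsub>Fr\<^esub> x"
    then obtain h where "h \<in> Rel" "z = h + x" unfolding coset_def by auto
    then have "z = (h + (x - y)) + y" "h + (x - y) \<in> Rel" using Rel_add that by auto
    then show "z \<in> Rel #>\<^bsub>Fr\<^esub> y" unfolding coset_def by blast
  qed
  assume "x - y \<in> Rel"
  then show "Rel #>\<^bsub>Fr\<^esub> x = Rel #>\<^bsub>Fr\<^esub> y"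
    using sub[of x y] sub[of y x] Rel_minus[of "x - y"] by auto
qed

lemma frag_additive: "additive_function C d T Rel frag_of"
proof
  show "frag_of z - (frag_of x + frag_of y) \<in> Rel"
    if "x \<in> addcat C T" "y \<in> addcat C T" "direct_sum C [x, y] z" for x y z
  proof -
    have "frag_of z - (frag_of x + frag_of y) \<in> K0_relations C (addcat C T)"
      unfolding K0_relations_def using that addcat_sum by blast
    then show ?thesis unfolding K0_kernel_def by (rule generate.incl)
  qed
  show "a - b \<in> Rel" if "a \<in> Rel" "b \<in> Rel" for a b
    using Rel_add[OF that(1) Rel_minus[OF that(2)]] by simp
qed (rule Rel_zero)

lemma K0_class_carrier: "t \<in> addcat C T \<Longrightarrow> K0_class C (addcat C T) t \<in> carrier K0"
  unfolding K0_class_def using coset_hom by (simp add: hom_def Pi_iff)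

text \<open>
  The classes of two resolutions differ by an element of \<open>Rel\<close>, by \<open>res_unique\<close> for the universal additive
  function \<open>frag_of\<close>.
\<close>

lemma index_eq:
  assumes "res a \<alpha> v"
  shows "index C d T v = altprod K0 d (\<lambda>i. K0_class C (addcat C T) (a (d - i)))"
proof -
  let ?cl = "K0_class C (addcat C T)"
  have coset: "altprod K0 d (\<lambda>i. ?cl (x (d - i))) = Rel #>\<^bsub>Fr\<^esub> altsum d (\<lambda>i. frag_of (x (d - i)))"
    if "res x \<xi> v" for x \<xi>
  proof -
    note x = resD(2)[OF that]
    have "Rel #>\<^bsub>Fr\<^esub> altprod Fr d (\<lambda>i. frag_of (x (d - i))) = altprod K0 d (\<lambda>i. Rel #>\<^bsub>Fr\<^esub> frag_of (x (d - i)))"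
      using x by (intro hom_altprod[OF abelian_free_Abelian_group K0_comm_group coset_hom]) simp
    then show ?thesis
      using altprod_free_Abelian_group[of "\<lambda>i. x (d - i)" "addcat C T" d] x by (simp add: K0_class_def)
  qed
  have unique: "altprod K0 d (\<lambda>i. ?cl (x (d - i))) = altprod K0 d (\<lambda>i. ?cl (a (d - i)))" if "res x \<xi> v" for x \<xi>
  proof -
    have "altsum d (\<lambda>i. frag_of (x i)) - altsum d (\<lambda>i. frag_of (a i)) \<in> Rel"
      using additive_function.res_unique[OF frag_additive that assms] .
    moreover have "altsum d (\<lambda>i. frag_of (x (d - i))) - altsum d (\<lambda>i. frag_of (a (d - i)))
        = (if even d then altsum d (\<lambda>i. frag_of (x i)) - altsum d (\<lambda>i. frag_of (a i))
           else - (altsum d (\<lambda>i. frag_of (x i)) - altsum d (\<lambda>i. frag_of (a i))))"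
      using altsum_rev[of d "\<lambda>i. frag_of (x i)"] altsum_rev[of d "\<lambda>i. frag_of (a i)"] by auto
    ultimately have "altsum d (\<lambda>i. frag_of (x (d - i))) - altsum d (\<lambda>i. frag_of (a (d - i))) \<in> Rel"
      using Rel_minus by presburger
    then show ?thesis unfolding coset[OF that] coset[OF assms] coset_eq_iff .
  qed
  have ts: "(\<Otimes>\<^bsub>K0\<^esub>i\<in>{..d}. ?cl (ts ! (d - i)) [^]\<^bsub>K0\<^esub> ((-1) ^ i :: int)) = altprod K0 d (\<lambda>i. ?cl (a (d - i)))"
    if "resolution C d (addcat C T) ts v" for ts
  proof -
    obtain x \<xi> where x: "res x \<xi> v" "\<And>i. i \<le> d \<Longrightarrow> x i = ts ! i"
      using resolution_res[OF \<open>resolution C d (addcat C T) ts v\<close>] by metis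
    have "altprod K0 d (\<lambda>i. ?cl (ts ! (d - i))) = altprod K0 d (\<lambda>i. ?cl (x (d - i)))"
      by (rule altprod_cong[OF K0_comm_group]) (use K0_class_carrier resD(2)[OF x(1)] x(2) in auto)
    then show ?thesis using unique[OF x(1)] unfolding altprod_def by simp
  qed
  show ?thesis
    unfolding index_def using ex_resolution[of v] by (intro the_equality) (auto simp: ts)
qed

lemma dual_index:
  assumes "c \<in> dual_group K0" "res a \<alpha> v"
  shows "c (index C d T v) = altsum d (\<lambda>i. c (K0_class C (addcat C T) (a (d - i))))"
  unfolding index_eq[OF assms(2)] altprod_integer_group[symmetric]
  using assms(1) K0_class_carrier resD(2)[OF assms(2)]
  by (intro hom_altprod[OF K0_comm_group abelian_integer_group]) (auto simp: dual_group_def)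

lemma dual_additive:
  assumes "c \<in> dual_group K0" "x \<in> addcat C T" "y \<in> addcat C T" "direct_sum C [x, y] z"
  shows "c (K0_class C (addcat C T) z) = c (K0_class C (addcat C T) x) + c (K0_class C (addcat C T) y)"
proof -
  have "frag_of z - (frag_of x + frag_of y) \<in> Rel"
    using additive_function.f_sum[OF frag_additive assms(2-4)] .
  then have "K0_class C (addcat C T) z = Rel #>\<^bsub>Fr\<^esub> (frag_of x \<otimes>\<^bsub>Fr\<^esub> frag_of y)"
    unfolding K0_class_def mult_free_Abelian_group coset_eq_iff .
  also have "\<dots> = K0_class C (addcat C T) x \<otimes>\<^bsub>K0\<^esub> K0_class C (addcat C T) y"
    unfolding K0_class_def using coset_hom assms(2,3) by (intro hom_mult[OF coset_hom]) auto
  finally show ?thesis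
    using assms(1) hom_mult[of c K0 integer_group] K0_class_carrier assms(2,3) by (simp add: dual_group_def)
qed

lemma dual_exists:
  assumes "integer_additive_function C d T f"
  obtains c where "c \<in> dual_group K0" "\<And>t. t \<in> addcat C T \<Longrightarrow> c (K0_class C (addcat C T) t) = f t"
proof -
  interpret f: integer_additive_function C d T f by (rule assms)
  obtain h where h: "h \<in> hom Fr integer_group" "\<And>x. x \<in> addcat C T \<Longrightarrow> h (frag_of x) = f x"
    using comm_group.free_Abelian_group_universal[OF abelian_integer_group, of f "addcat C T"] by auto
  interpret h: group_hom Fr integer_group h
    by (intro group_hom.intro group_hom_axioms.intro group_free_Abelian_group group_integer_group h)
  have h_diff: "h (x - y) = h x - h y" if "x \<in> carrier Fr" "y \<in> carrier Fr" for x y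
    using h.hom_mult[OF that(1) h.G.inv_closed[OF that(2)]] h.hom_inv[OF that(2)] that by simp
  have rel: "h r = 0" if r_in: "r \<in> K0_relations C (addcat C T)" for r
  proof -
    obtain t t0 t1 where r: "r = frag_of t - (frag_of t0 + frag_of t1)"
      "t \<in> addcat C T" "t0 \<in> addcat C T" "t1 \<in> addcat C T" "direct_sum C [t0, t1] t"
      using r_in by (auto simp: K0_relations_def)
    have "frag_of t0 + frag_of t1 \<in> carrier Fr"
      using h.G.m_closed[of "frag_of t0" "frag_of t1"] r by simp
    then have "h r = f t - (f t0 + f t1)"
      using h_diff[of "frag_of t" "frag_of t0 + frag_of t1"] h.hom_mult[of "frag_of t0" "frag_of t1"] h(2) r by simp
    then show ?thesis using f.f_additive[OF r(3,4,5)] by simp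
  qed
  have ker: "h r = 0" if "r \<in> Rel" for r
    using that unfolding K0_kernel_def
  proof (induction r rule: generate.induct)
    case (inv r)
    then have "h (inv\<^bsub>Fr\<^esub> r) = - h r" using h.hom_inv relations_carrier by (simp add: subset_iff)
    then show ?case using rel inv by simp
  next
    case (eng r s)
    then have "r \<in> carrier Fr" "s \<in> carrier Fr"
      using h.G.generate_in_carrier[OF relations_carrier] by auto
    then show ?case using h.hom_mult[of r s] eng by simp
  qed (use rel h.hom_one in auto)
  obtain g where g: "g \<in> hom (Fr Mod Rel) integer_group" "\<And>x. x \<in> carrier Fr \<Longrightarrow> g (Rel #>\<^bsub>Fr\<^esub> x) = h x"
  proof (rule FactGroup_universal[OF h(1) Rel_normal])
    fix x y assume xy: "x \<in> carrier Fr" "y \<in> carrier Fr" "Rel #>\<^bsub>Fr\<^esub> x = Rel #>\<^bsub>Fr\<^esub> y"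
    then show "h x = h y" using ker[of "x - y"] h_diff[OF xy(1,2)] by (simp add: coset_eq_iff)
  qed blast
  show thesis
  proof (rule that[of "restrict g (carrier K0)"])
    interpret K0: comm_group K0 by (rule K0_comm_group)
    have "restrict g (carrier K0) \<in> hom K0 integer_group"
      using hom_mult[OF g(1)[folded K0_split_def]] by (intro homI) simp_all
    then show "restrict g (carrier K0) \<in> dual_group K0" by (simp add: dual_group_def)
    show "restrict g (carrier K0) (K0_class C (addcat C T) t) = f t" if "t \<in> addcat C T" for t
      using K0_class_carrier[OF that] g(2)[of "frag_of t"] h(2)[OF that] that by (simp add: K0_class_def)
  qed
qed

lemma dual_eqI:
  assumes "c \<in> dual_group K0" "c' \<in> dual_group K0"
    and "\<And>t. t \<in> addcat C T \<Longrightarrow> c (K0_class C (addcat C T) t) = c' (K0_class C (addcat C T) t)"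
  shows "c = c'"
proof -
  have hom: "(\<lambda>x. b (Rel #>\<^bsub>Fr\<^esub> x)) \<in> hom Fr integer_group" if "b \<in> dual_group K0" for b
    using hom_compose[OF coset_hom, of b integer_group] that by (simp add: dual_group_def comp_def)
  have diff: "b (Rel #>\<^bsub>Fr\<^esub> (x - y)) = b (Rel #>\<^bsub>Fr\<^esub> x) - b (Rel #>\<^bsub>Fr\<^esub> y)"
    if "b \<in> dual_group K0" "Poly_Mapping.keys x \<subseteq> addcat C T" "Poly_Mapping.keys y \<subseteq> addcat C T" for b x y
  proof -
    interpret h: group_hom Fr integer_group "\<lambda>x. b (Rel #>\<^bsub>Fr\<^esub> x)"
      by (intro group_hom.intro group_hom_axioms.intro group_free_Abelian_group group_integer_group hom that)
    show ?thesis
      using h.hom_mult[of x "inv\<^bsub>Fr\<^esub> y"] h.hom_inv[of y] that h.G.inv_closed[of y] by simp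
  qed
  have zero: "b (Rel #>\<^bsub>Fr\<^esub> 0) = 0" if "b \<in> dual_group K0" for b
    using diff[OF that, of 0 0] by simp
  have eq: "c (Rel #>\<^bsub>Fr\<^esub> x) = c' (Rel #>\<^bsub>Fr\<^esub> x)" if "Poly_Mapping.keys x \<subseteq> addcat C T" for x
    by (rule free_Abelian_group_induct[OF that])
      (use diff[OF assms(1)] diff[OF assms(2)] zero[OF assms(1)] zero[OF assms(2)] assms(3)[unfolded K0_class_def] in simp_all)
  show ?thesis
  proof (rule extensionalityI)
    show "c \<in> extensional (carrier K0)" "c' \<in> extensional (carrier K0)"
      using assms by (auto simp: dual_group_def)
    show "c x = c' x" if "x \<in> carrier K0" for x
      using that eq by (auto simp: K0_split_def carrier_FactGroup)
  qed
qed

text \<open>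
  Two elements of the dual with these values on the indices of the \<open>v\<close> differ by an additive function that
  vanishes there, hence vanishes by \<open>res_sum_determines\<close>. So the description of the \<open>c\<close>-vector is unique.
\<close>

lemma c_vector_eqI:
  assumes ks: "krull_schmidt C" and U: "OT_cluster_tilting C d U"
    and f: "integer_additive_function C d T f"
    and dual: "\<And>v a \<alpha>. v \<in> Indec C (addcat C U) \<Longrightarrow> res a \<alpha> v \<Longrightarrow>
      altsum d (\<lambda>i. f (a (d - i))) = (if isomorphic C v u then 1 else 0)"
    and t: "t \<in> addcat C T"
  shows "c_vector C d T U u (K0_class C (addcat C T) t) = f t"
proof -
  let ?cl = "K0_class C (addcat C T)"
  obtain c where c: "c \<in> dual_group K0" "\<And>t. t \<in> addcat C T \<Longrightarrow> c (?cl t) = f t"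
    using dual_exists[OF f] by blast
  have c_dual: "c (index C d T v) = (if isomorphic C v u then 1 else 0)" if v: "v \<in> Indec C (addcat C U)" for v
  proof -
    obtain a \<alpha> where a: "res a \<alpha> v" using ex_res by blast
    have "c (index C d T v) = altsum d (\<lambda>i. f (a (d - i)))"
      unfolding dual_index[OF c(1) a] using c(2) resD(2)[OF a] by (intro altsum_cong) simp
    then show ?thesis using dual[OF v a] by simp
  qed
  have unique: "c' = c" if c': "c' \<in> dual_group K0"
    "\<forall>v\<in>Indec C (addcat C U). c' (index C d T v) = (if isomorphic C v u then 1 else 0)" for c'
  proof (rule dual_eqI[OF c'(1) c(1)])
    interpret g: integer_additive_function C d T "\<lambda>x. c' (?cl x) - c (?cl x)"
      by unfold_locales (auto simp: dual_additive[OF c'(1)] dual_additive[OF c(1)])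
    have zero: "g.res_sum v = 0" if v: "v \<in> Indec C (addcat C U)" for v
    proof -
      obtain a \<alpha> where a: "res a \<alpha> v" using ex_res by blast
      have "altsum d (\<lambda>i. c' (?cl (a (d - i))) - c (?cl (a (d - i)))) = 0"
        using dual_index[OF c'(1) a] dual_index[OF c(1) a] c_dual[OF v] c'(2) v by (simp add: altsum_diff)
      then show ?thesis
        using altsum_rev[of d "\<lambda>i. c' (?cl (a i)) - c (?cl (a i))"] g.res_sum_eq[OF a] by (simp split: if_splits)
    qed
    show "c' (?cl t) = c (?cl t)" if "t \<in> addcat C T" for t
      using g.res_sum_determines[OF ks U zero that] by simp
  qed
  have "c_vector C d T U u = c"
    unfolding c_vector_def
  proof (rule the_equality)
    show "c \<in> dual_group K0 \<and> (\<forall>v\<in>Indec C (addcat C U). c (index C d T v) = (if isomorphic C v u then 1 else 0))"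
      using c(1) c_dual by blast
  qed (use unique in blast)
  then show ?thesis using c(2) t by simp
qed

end

section \<open>Dimensions of image functors\<close>

context vector_space_pair
begin

text \<open>Here \<open>f\<close> is linear on \<open>V\<close> only, as is composition with a morphism.\<close>

lemma rank_nullity:
  assumes V: "vs1.subspace V" and fin: "finite S" "V \<subseteq> vs1.span S"
    and add: "\<And>x y. x \<in> V \<Longrightarrow> y \<in> V \<Longrightarrow> f (x + y) = f x + f y"
    and scale: "\<And>c x. x \<in> V \<Longrightarrow> f (s1 c x) = s2 c (f x)"
  shows "vs1.dim V = vs2.dim (f ` V) + vs1.dim {x \<in> V. f x = 0}"
proof -
  let ?K = "{x \<in> V. f x = 0}"
  obtain A where A: "A \<subseteq> ?K" "vs1.independent A" "?K \<subseteq> vs1.span A" "card A = vs1.dim ?K"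
    using vs1.basis_exists[of ?K] by blast
  obtain B where B: "A \<subseteq> B" "B \<subseteq> V" "vs1.independent B" "V \<subseteq> vs1.span B"
    using vs1.maximal_independent_subset_extend[OF _ A(2), of V] A(1) by blast
  have finB: "finite B"
    using vs1.independent_span_bound[OF fin(1) B(3)] B(2) fin(2) by blast
  have span: "vs1.span B = V" using vs1.span_minimal[OF B(2) V] B(4) by blast
  obtain g where g: "Vector_Spaces.linear s1 s2 g" "\<forall>x\<in>B. g x = f x"
    using linear_independent_extend[OF B(3)] by blast
  interpret g: Vector_Spaces.linear s1 s2 g by (rule g(1))
  have f0: "f 0 = 0" using add[of 0 0] vs1.subspace_0[OF V] by simp
  have gf: "g x = f x" if "x \<in> V" for x
  proof -
    have "x \<in> vs1.span B" using that span by simp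
    then have "x \<in> V \<and> g x = f x"
    proof (induction rule: vs1.span_induct_alt)
      case (step c b y)
      then have "b \<in> V" using B(2) by auto
      then show ?case
        using step g(2) add[of "s1 c b" y] scale[of b c] vs1.subspace_scale[OF V] vs1.subspace_add[OF V]
        by (simp add: g.add g.scale)
    qed (simp add: f0 g.zero vs1.subspace_0[OF V])
    then show ?thesis by simp
  qed
  have disj: "x = 0" if "x \<in> vs1.span A" "x \<in> vs1.span (B - A)" for x
  proof -
    have "vs1.representation B x = vs1.representation A x" "vs1.representation B x = vs1.representation (B - A) x"
      using vs1.representation_extend[OF B(3)] that B(1) by blast+
    then have "vs1.representation B x b = 0" for b
      using vs1.representation_ne_zero[of A x b] vs1.representation_ne_zero[of "B - A" x b] by auto
    moreover have "x \<in> vs1.span B" using that(1) B(1) vs1.span_mono by blast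
    ultimately show ?thesis
      using vs1.sum_nonzero_representation_eq[OF B(3), of x] by (simp add: sum.neutral)
  qed
  have inj: "inj_on g (vs1.span (B - A))"
    unfolding g.inj_on_iff_eq_0[OF vs1.subspace_span]
  proof (intro ballI impI)
    fix x assume x: "x \<in> vs1.span (B - A)" "g x = 0"
    then have "x \<in> V" using span vs1.span_mono[of "B - A" B] by auto
    then have "x \<in> ?K" using x(2) gf by simp
    then show "x = 0" using disj[of x] A(3) x(1) by blast
  qed
  have ind: "vs2.independent (g ` (B - A))"
    using linear_independent_injective_image[OF g(1) vs1.independent_mono[OF B(3)] inj] by blast
  have "f ` V = g ` vs1.span B" using gf span by (auto simp: image_iff)
  also have "\<dots> = vs2.span (g ` B)" using linear_span_image[OF g(1)] by simp
  also have "\<dots> = vs2.span (g ` (B - A))"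
  proof -
    have "g ` B \<subseteq> insert 0 (g ` (B - A))" using A(1) gf by auto
    then have "vs2.span (g ` B) \<subseteq> vs2.span (g ` (B - A))"
      using vs2.span_mono vs2.span_insert_0 by metis
    then show ?thesis using vs2.span_mono[of "g ` (B - A)" "g ` B"] by auto
  qed
  finally have "vs2.dim (f ` V) = card (g ` (B - A))"
    using vs2.dim_span_eq_card_independent[OF ind] by simp
  also have "\<dots> = card (B - A)"
    by (rule card_image) (rule inj_on_subset[OF inj vs1.span_superset])
  also have "\<dots> = card B - card A" using finB B(1) by (simp add: card_Diff_subset finite_subset)
  finally show ?thesis
    using A(4) vs1.basis_card_eq_dim[OF B(2,4,3)] card_mono[OF finB B(1)] by simp
qed

end

context vector_space
begin

lemma dim_zero_space: "dim {0} = 0"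
  using dim_span[of "{}"] dim_eq_card_independent[OF independent_empty] by simp

lemma dim_line: "w \<noteq> 0 \<Longrightarrow> dim {scale c w | c. True} = 1"
proof -
  assume "w \<noteq> 0"
  then have "dim (span {w}) = 1" by (subst dim_span_eq_card_independent) auto
  moreover have "span {w} = {scale c w | c. True}" by (auto simp: span_singleton)
  ultimately show ?thesis by simp
qed

lemma dim_insert_vector:
  assumes "subspace I" "finite S" "I \<subseteq> span S" "w \<notin> I" "subspace V" "I \<subseteq> V" "w \<in> V"
    and "\<And>x. x \<in> V \<Longrightarrow> \<exists>c. x - scale c w \<in> I"
  shows "dim V = dim I + 1"
proof -
  obtain B where B: "B \<subseteq> I" "independent B" "I \<subseteq> span B" "card B = dim I"
    using basis_exists[of I] by blast
  have finB: "finite B" using independent_span_bound[OF assms(2) B(2)] B(1) assms(3) by blast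
  have spanB: "span B = I" using span_minimal[OF B(1) assms(1)] B(3) by blast
  have ind: "independent (insert w B)" using independent_insertI[of w B] spanB assms(4) B(2) by simp
  have "V \<subseteq> span (insert w B)"
  proof
    fix x assume "x \<in> V"
    then obtain c where "x - scale c w \<in> span B" using assms(8) spanB by blast
    then show "x \<in> span (insert w B)" unfolding span_insert by blast
  qed
  moreover have "insert w B \<subseteq> V" using assms(6,7) B(1) by blast
  ultimately have "card (insert w B) = dim V" using basis_card_eq_dim ind by blast
  moreover have "w \<notin> B" using assms(4) B(1) by blast
  ultimately show ?thesis using finB B(4) by simp
qed

end

text \<open>As a functor of \<open>t\<close> in \<open>add T\<close> this is \<open>Hom(F\<^sub>T t, Im \<delta>\<^sub>*)\<close>, by \<open>End_hom_dim_eq\<close> below.\<close>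

definition post_image :: "('o, 'm, 'k, 'z) lincat_scheme \<Rightarrow> 'o \<Rightarrow> 'm \<Rightarrow> 'o \<Rightarrow> 'm set" where
  "post_image C b \<delta> t = (\<lambda>h. \<delta> \<cdot>\<^bsub>C\<^esub> h) ` Hom C t b"

context linear_category
begin

lemma pair_self: "vector_space_pair (scl C) (scl C)"
  by (simp add: vector_space_pair_def vector_space_axioms)

lemma linear_image_subspace:
  assumes "subspace V"
    and add: "\<And>x y. x \<in> V \<Longrightarrow> y \<in> V \<Longrightarrow> f (x + y) = f x + f y"
    and scale: "\<And>c x. x \<in> V \<Longrightarrow> f (scl C c x) = scl C c (f x)"
  shows "subspace (f ` V)"
proof (rule subspaceI)
  show "0 \<in> f ` V"
    using scale[of 0 0] subspace_0[OF assms(1)] by (auto intro!: image_eqI[of _ _ 0])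
  show "x + y \<in> f ` V" if "x \<in> f ` V" "y \<in> f ` V" for x y
    using that add subspace_add[OF assms(1)] by (auto simp flip: add)
  show "scl C c x \<in> f ` V" if "x \<in> f ` V" for c x
    using that scale subspace_scale[OF assms(1)] by (auto simp flip: scale)
qed

lemma post_image_in: "\<delta> \<in> Hom C b y \<Longrightarrow> post_image C b \<delta> t \<subseteq> Hom C t y"
  unfolding post_image_def using cmp_closed by blast

lemma post_image_subspace: "\<delta> \<in> Hom C b y \<Longrightarrow> subspace (post_image C b \<delta> t)"
  unfolding post_image_def by (rule linear_image_subspace[OF Hom_subspace]) (auto simp: cmp_add_right cmp_scl_right)

lemma hom_finiteD:
  assumes "hom_finite C" "V \<subseteq> Hom C x y"
  obtains S where "finite S" "V \<subseteq> span S"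
  using assms unfolding hom_finite_def by metis

lemma pre_linear:
  assumes "V \<subseteq> Hom C t y" "\<alpha> \<in> Hom C s t"
  shows "\<And>h k. h \<in> V \<Longrightarrow> k \<in> V \<Longrightarrow> (h + k) \<cdot> \<alpha> = h \<cdot> \<alpha> + k \<cdot> \<alpha>"
    "\<And>c h. h \<in> V \<Longrightarrow> scl C c h \<cdot> \<alpha> = scl C c (h \<cdot> \<alpha>)"
  using assms cmp_add_left[OF assms(2)] cmp_scl_left[OF assms(2)] by blast+

lemma rank_nullity_pre:
  assumes "hom_finite C" "subspace V" "V \<subseteq> Hom C t y" "\<alpha> \<in> Hom C s t"
  shows "dim V = dim ((\<lambda>h. h \<cdot> \<alpha>) ` V) + dim {h \<in> V. h \<cdot> \<alpha> = 0}"
proof -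
  obtain S where S: "finite S" "V \<subseteq> span S" using hom_finiteD assms(1,3) by blast
  show ?thesis
    by (rule vector_space_pair.rank_nullity[OF pair_self assms(2) S]) (use pre_linear[OF assms(3,4)] in auto)
qed

text \<open>
  Restriction along \<open>x \<rightarrow> z\<close> is onto, and restriction along \<open>y \<rightarrow> z\<close> identifies its kernel with the image at \<open>y\<close>.
\<close>

lemma dim_post_image_additive:
  assumes fin: "hom_finite C" and \<delta>: "\<delta> \<in> Hom C b w" and z: "direct_sum C [x, y] z"
  shows "dim (post_image C b \<delta> z) = dim (post_image C b \<delta> x) + dim (post_image C b \<delta> y)"
proof -
  obtain i j p q where bip: "biproduct2 x y z i j p q" using z by (auto simp: direct_sum_pair_iff)
  note h = biproduct2D(1-4)[OF bip] and e = biproduct2D(5-9)[OF bip]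
  let ?M = "post_image C b \<delta>"
  let ?K = "{m \<in> ?M z. m \<cdot> i = 0}"
  have restrict: "(\<lambda>m. m \<cdot> r) ` ?M z = ?M t"
    if r: "r \<in> Hom C t z" "s \<in> Hom C z t" "s \<cdot> r = Id t" for r s t
  proof (intro equalityI subsetI)
    fix m assume "m \<in> (\<lambda>m. m \<cdot> r) ` ?M z"
    then obtain g where "g \<in> Hom C z b" "m = (\<delta> \<cdot> g) \<cdot> r" by (auto simp: post_image_def)
    then show "m \<in> ?M t" using cmp_assoc[OF r(1) _ \<delta>, of g] cmp_closed[OF r(1), of g b] by (auto simp: post_image_def)
  next
    fix m assume "m \<in> ?M t"
    then obtain g where g: "g \<in> Hom C t b" "m = \<delta> \<cdot> g" by (auto simp: post_image_def)
    then have "m = (\<delta> \<cdot> (g \<cdot> s)) \<cdot> r"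
      using cmp_assoc[OF r(1) cmp_closed[OF r(2) g(1)] \<delta>] cmp_assoc[OF r(1,2) g(1)] r(3) cmp_ident_right[OF g(1)] by simp
    then show "m \<in> (\<lambda>m. m \<cdot> r) ` ?M z" using cmp_closed[OF r(2) g(1)] by (auto simp: post_image_def)
  qed
  have Mz: "?M z \<subseteq> Hom C z w" "subspace (?M z)" using post_image_in post_image_subspace \<delta> by blast+
  have K_sub: "subspace ?K"
    using subspace_0[OF Mz(2)] subspace_add[OF Mz(2)] subspace_scale[OF Mz(2)] pre_linear[OF Mz(1) h(1)] cmp_zero_left[OF h(1)]
    by (intro subspaceI) auto
  have K_in: "?K \<subseteq> Hom C z w" using Mz by auto
  have "(\<lambda>m. m \<cdot> j) ` ?K = ?M y"
  proof (intro equalityI subsetI)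
    fix m assume "m \<in> (\<lambda>m. m \<cdot> j) ` ?K"
    then show "m \<in> ?M y" using restrict[OF h(2,4) e(2)] by blast
  next
    fix m assume m: "m \<in> ?M y"
    then obtain g where g: "g \<in> Hom C y b" "m = \<delta> \<cdot> g" by (auto simp: post_image_def)
    have gq: "g \<cdot> q \<in> Hom C z b" using cmp_closed[OF h(4) g(1)] .
    have "(\<delta> \<cdot> (g \<cdot> q)) \<cdot> i = 0"
      using cmp_assoc[OF h(1) gq \<delta>] cmp_assoc[OF h(1,4) g(1)] e(3) cmp_zero_right[OF g(1)] cmp_zero_right[OF \<delta>] by simp
    moreover have "(\<delta> \<cdot> (g \<cdot> q)) \<cdot> j = m"
      using cmp_assoc[OF h(2) gq \<delta>] cmp_assoc[OF h(2,4) g(1)] e(2) cmp_ident_right[OF g(1)] g(2) by simp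
    ultimately show "m \<in> (\<lambda>m. m \<cdot> j) ` ?K" using gq by (force simp: post_image_def)
  qed
  moreover have "{m \<in> ?K. m \<cdot> j = 0} = {0}"
  proof -
    have "m = 0" if m: "m \<in> ?K" "m \<cdot> j = 0" for m
    proof -
      have mw: "m \<in> Hom C z w" using m K_in by auto
      have "m = (m \<cdot> i) \<cdot> p + (m \<cdot> j) \<cdot> q"
        using cmp_ident_right[OF mw] e(5) cmp_add_right[OF cmp_closed[OF h(3,1)] cmp_closed[OF h(4,2)] mw]
          cmp_assoc[OF h(3,1) mw] cmp_assoc[OF h(4,2) mw] by simp
      then show ?thesis using m cmp_zero_left[OF h(3)] cmp_zero_left[OF h(4)] by simp
    qed
    then show ?thesis using subspace_0[OF K_sub] cmp_zero_left[OF h(2)] by auto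
  qed
  ultimately have "dim ?K = dim (?M y)"
    using rank_nullity_pre[OF fin K_sub K_in h(2)] dim_zero_space by simp
  then show ?thesis
    using rank_nullity_pre[OF fin Mz(2,1) h(1)] restrict[OF h(1,3) e(1)] by simp
qed

end

text \<open>
  As \<open>F\<^sub>T t\<close> is projective for \<open>t\<close> in \<open>add T\<close>, every homomorphism from it to the image of \<open>\<delta>\<^sub>*\<close> is
  induced by some \<open>t \<rightarrow> b\<close>.
\<close>

lemma (in additive_linear_category) End_hom_dim_eq:
  assumes fin: "hom_finite C" and \<delta>: "\<delta> \<in> Hom C b w" and t: "t \<in> addcat C T"
  shows "End_hom_dim C T (F_obj C T t) (F_image C T b \<delta>) = dim (post_image C b \<delta> t)"
proof -
  let ?M = "post_image C b \<delta> t" and ?E = "End_hom C T (Hom C T t) (post_image C b \<delta> T)"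
  define \<Psi> where "\<Psi> h = (\<lambda>m. if m \<in> Hom C T t then h \<cdot> m else 0)" for h
  obtain n :: nat and a c where ac: "\<forall>k<n. a k \<in> Hom C T t \<and> c k \<in> Hom C t T" "(\<Sum>k<n. a k \<cdot> c k) = Id t"
    using addcat_retract[OF t] by blast
  have Mw: "?M \<subseteq> Hom C t w" using post_image_in[OF \<delta>] .
  have expand: "h = (\<Sum>k<n. (h \<cdot> a k) \<cdot> c k)" if h: "h \<in> Hom C t y" for h y
  proof -
    have "h = h \<cdot> (\<Sum>k<n. a k \<cdot> c k)" using cmp_ident_right[OF h] ac(2) by simp
    also have "\<dots> = (\<Sum>k<n. h \<cdot> (a k \<cdot> c k))"
      by (rule cmp_sum_right[OF h]) (use ac(1) cmp_closed in blast)
    also have "\<dots> = (\<Sum>k<n. (h \<cdot> a k) \<cdot> c k)"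
      using cmp_assoc[OF _ _ h] ac(1) by (intro sum.cong) force+
    finally show ?thesis .
  qed
  have image: "\<Psi> ` ?M = ?E"
  proof (intro equalityI subsetI)
    fix \<psi> assume "\<psi> \<in> \<Psi> ` ?M"
    then obtain g where g: "g \<in> Hom C t b" "\<psi> = \<Psi> (\<delta> \<cdot> g)" by (auto simp: post_image_def)
    have dg: "\<delta> \<cdot> g \<in> Hom C t w" using cmp_closed[OF g(1) \<delta>] .
    have "(\<delta> \<cdot> g) \<cdot> m \<in> post_image C b \<delta> T" if "m \<in> Hom C T t" for m
      using cmp_assoc[OF that g(1) \<delta>] cmp_closed[OF that g(1)] by (auto simp: post_image_def)
    then show "\<psi> \<in> ?E"
      unfolding g(2) \<Psi>_def End_hom_def
      using cmp_add_right[OF _ _ dg] cmp_assoc[OF _ _ dg] by (auto simp: add_in cmp_closed)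
  next
    fix \<psi> assume \<psi>: "\<psi> \<in> ?E"
    then have in_im: "\<And>m. m \<in> Hom C T t \<Longrightarrow> \<psi> m \<in> post_image C b \<delta> T"
      and add: "\<And>m m'. m \<in> Hom C T t \<Longrightarrow> m' \<in> Hom C T t \<Longrightarrow> \<psi> (m + m') = \<psi> m + \<psi> m'"
      and equi: "\<And>m g. m \<in> Hom C T t \<Longrightarrow> g \<in> Hom C T T \<Longrightarrow> \<psi> (m \<cdot> g) = \<psi> m \<cdot> g"
      and out: "\<And>m. m \<notin> Hom C T t \<Longrightarrow> \<psi> m = 0"
      by (auto simp: End_hom_def)
    have "\<psi> 0 = 0" using add[OF zero_in zero_in] by simp
    then have sum: "\<psi> (\<Sum>k\<in>I. f k) = (\<Sum>k\<in>I. \<psi> (f k))" if "\<And>k. k \<in> I \<Longrightarrow> f k \<in> Hom C T t" for f and I :: "nat set"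
      using that by (induction I rule: infinite_finite_induct) (auto simp: add sum_in)
    have "\<forall>k<n. \<exists>g\<in>Hom C T b. \<psi> (a k) = \<delta> \<cdot> g"
      using in_im ac(1) by (auto simp: post_image_def)
    then obtain g where g: "\<And>k. k < n \<Longrightarrow> g k \<in> Hom C T b" "\<And>k. k < n \<Longrightarrow> \<psi> (a k) = \<delta> \<cdot> g k"
      by metis
    define f where "f = (\<Sum>k<n. g k \<cdot> c k)"
    have gc: "g k \<cdot> c k \<in> Hom C t b" if "k < n" for k using cmp_closed g(1) ac(1) that by blast
    have f: "f \<in> Hom C t b" unfolding f_def using gc by (intro sum_in) auto
    have df: "\<delta> \<cdot> f = (\<Sum>k<n. \<psi> (a k) \<cdot> c k)"
    proof -
      have "\<delta> \<cdot> f = (\<Sum>k<n. \<delta> \<cdot> (g k \<cdot> c k))"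
        unfolding f_def by (rule cmp_sum_right[OF \<delta>]) (use gc in auto)
      also have "\<dots> = (\<Sum>k<n. \<psi> (a k) \<cdot> c k)"
        using cmp_assoc[OF _ g(1) \<delta>] g(2) ac(1) by (intro sum.cong) auto
      finally show ?thesis .
    qed
    have "\<psi> m = (\<delta> \<cdot> f) \<cdot> m" if m: "m \<in> Hom C T t" for m
    proof -
      have cm: "c k \<cdot> m \<in> Hom C T T" "a k \<in> Hom C T t" "c k \<in> Hom C t T" if "k < n" for k
        using cmp_closed[OF m] ac(1) that by blast+
      have \<psi>a: "\<psi> (a k) \<in> Hom C T w" if "k < n" for k
        using in_im[OF cm(2)[OF that]] post_image_in[OF \<delta>] by blast
      have "m = (\<Sum>k<n. a k \<cdot> c k) \<cdot> m" using cmp_ident_left[OF m] ac(2) by simp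
      also have "\<dots> = (\<Sum>k<n. (a k \<cdot> c k) \<cdot> m)"
        by (rule cmp_sum_left[OF m]) (use cm cmp_closed in blast)
      also have "\<dots> = (\<Sum>k<n. a k \<cdot> (c k \<cdot> m))"
        using cmp_assoc[OF m cm(3,2)] by (intro sum.cong) auto
      finally have "\<psi> m = (\<Sum>k<n. \<psi> (a k \<cdot> (c k \<cdot> m)))"
        using sum[of "{..<n}" "\<lambda>k. a k \<cdot> (c k \<cdot> m)"] cmp_closed[OF cm(1,2)] by simp
      also have "\<dots> = (\<Sum>k<n. (\<psi> (a k) \<cdot> c k) \<cdot> m)"
        using equi cm cmp_assoc[OF m cm(3) \<psi>a] by (intro sum.cong) auto
      also have "\<dots> = (\<delta> \<cdot> f) \<cdot> m"
        unfolding df by (rule cmp_sum_left[OF m, symmetric]) (use cmp_closed[OF cm(3) \<psi>a] in auto)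
      finally show ?thesis .
    qed
    then have "\<psi> = \<Psi> (\<delta> \<cdot> f)" using out by (auto simp: \<Psi>_def)
    then show "\<psi> \<in> \<Psi> ` ?M" using f by (auto simp: post_image_def)
  qed
  have kernel: "{h \<in> ?M. \<Psi> h = 0} = {0}"
  proof -
    have "h = 0" if h: "h \<in> ?M" "\<Psi> h = 0" for h
    proof -
      have "h \<cdot> a k = 0" if "k < n" for k using fun_cong[OF h(2), of "a k"] ac(1) that by (simp add: \<Psi>_def)
      then have "(\<Sum>k<n. (h \<cdot> a k) \<cdot> c k) = 0"
        using ac(1) cmp_zero_left by (intro sum.neutral) auto
      then show ?thesis using expand[of h w] Mw h(1) by auto
    qed
    moreover have "\<Psi> 0 = 0" by (auto simp: \<Psi>_def cmp_zero_left)
    moreover have "0 \<in> ?M" using subspace_0[OF post_image_subspace[OF \<delta>]] .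
    ultimately show ?thesis by auto
  qed
  interpret P: vector_space_pair "scl C" "fun_scl C"
    by (simp add: vector_space_pair_def vector_space_axioms vector_space_fun_scl)
  obtain S where S: "finite S" "?M \<subseteq> span S" using hom_finiteD[OF fin Mw] by blast
  have "dim ?M = P.vs2.dim (\<Psi> ` ?M) + dim {h \<in> ?M. \<Psi> h = 0}"
  proof (rule P.rank_nullity[OF post_image_subspace[OF \<delta>] S])
    show "\<Psi> (h + k) = \<Psi> h + \<Psi> k" if "h \<in> ?M" "k \<in> ?M" for h k
      using pre_linear(1)[OF Mw _ that] by (auto simp: \<Psi>_def fun_eq_iff)
    show "\<Psi> (scl C x h) = fun_scl C x (\<Psi> h)" if "h \<in> ?M" for x h
      using pre_linear(2)[OF Mw _ that] by (auto simp: \<Psi>_def fun_scl_def fun_eq_iff)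
  qed
  then have "P.vs2.dim ?E = dim ?M" unfolding image kernel dim_zero_space by simp
  then show ?thesis
    unfolding End_hom_dim_def F_obj_def F_image_def F_mor_def post_image_def .
qed

section \<open>Euler characteristics of image functors along resolutions\<close>

context angulated_category
begin

text \<open>
  Contravariant exactness at \<open>\<Sigma>\<^sup>d a\<^sub>0\<close>, moved back to \<open>a\<^sub>0\<close>: the obstruction to extending \<open>f\<close> over \<open>a\<^sub>1\<close> is an element
  of \<open>Hom(a\<^sub>d\<^sub>+\<^sub>1, \<Sigma>\<^sup>d y)\<close>.
\<close>

lemma angle_extend_first:
  assumes a: "angle a \<alpha>" and f: "f \<in> Hom C (a 0) y"
  shows "shM C f \<cdot> \<alpha> (d + 1) = 0 \<longleftrightarrow> (\<exists>g\<in>Hom C (a (Suc 0)) y. f = g \<cdot> \<alpha> 0)"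
proof -
  have sh: "a (d + 2) = shO C (a 0)" "a (d + 3) = shO C (a (Suc 0))" "\<alpha> (d + 2) = scl C eps (shM C (\<alpha> 0))"
    using angle_shO[OF a, of "d + 2" 0] angle_shO(1)[OF a, of "d + 3" 1] by auto
  have a0: "\<alpha> 0 \<in> Hom C (a 0) (a (Suc 0))" using angle_in[OF a] .
  have ad: "\<alpha> (d + 1) \<in> Hom C (a (d + 1)) (shO C (a 0))" using angle_in[OF a, of "d + 1"] sh(1) by simp
  have sf: "shM C f \<in> Hom C (shO C (a 0)) (shO C y)" using sh_in[OF f] .
  show ?thesis
  proof
    assume "shM C f \<cdot> \<alpha> (d + 1) = 0"
    then obtain h where h: "h \<in> Hom C (a (Suc (Suc (d + 1)))) (shO C y)" "shM C f = h \<cdot> \<alpha> (Suc (d + 1))"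
      using angle_exact_left[OF a, of "shM C f" "d + 1" "shO C y"] sf sh(1) by auto
    then have h': "h \<in> Hom C (shO C (a (Suc 0))) (shO C y)" "shM C f = h \<cdot> scl C eps (shM C (\<alpha> 0))"
      using sh(2,3) by (auto simp: numeral_2_eq_2 numeral_3_eq_3)
    then obtain g where g: "g \<in> Hom C (a (Suc 0)) y" "h = shM C g" using sh_surj by blast
    let ?g = "scl C eps g"
    have "shM C f = scl C eps (shM C (g \<cdot> \<alpha> 0))"
      using h' g cmp_scl_right[OF sh_in[OF a0] sh_in[OF g(1)]] sh_cmp[OF a0 g(1)] by simp
    also have "\<dots> = shM C (?g \<cdot> \<alpha> 0)"
      using sh_scl[OF cmp_closed[OF a0 g(1)]] cmp_scl_left[OF a0 g(1)] by simp
    finally have "f = ?g \<cdot> \<alpha> 0" using sh_eq_iff[OF f cmp_closed[OF a0 scl_in[OF g(1)]]] by blast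
    then show "\<exists>g\<in>Hom C (a (Suc 0)) y. f = g \<cdot> \<alpha> 0" using scl_in[OF g(1)] by blast
  next
    assume "\<exists>g\<in>Hom C (a (Suc 0)) y. f = g \<cdot> \<alpha> 0"
    then obtain g where g: "g \<in> Hom C (a (Suc 0)) y" "f = g \<cdot> \<alpha> 0" by blast
    have "scl C eps (shM C (\<alpha> 0)) \<cdot> \<alpha> (d + 1) = 0"
      using angle_cmp_zero[OF a, of "d + 1"] sh(3) by simp
    then have "shM C (\<alpha> 0) \<cdot> \<alpha> (d + 1) = 0"
      using cmp_scl_left[OF ad sh_in[OF a0]] by (metis scl_eps_eps scale_zero_right)
    then show "shM C f \<cdot> \<alpha> (d + 1) = 0"
      unfolding g(2) sh_cmp[OF a0 g(1)] using cmp_assoc[OF ad sh_in[OF a0] sh_in[OF g(1)]] cmp_zero_right[OF sh_in[OF g(1)]] by simp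
  qed
qed

text \<open>
  A cocycle of \<open>\<mu>\<^sub>p\<^sub>+\<^sub>s Hom(a, x\<^sub>p\<^sub>+\<^sub>s)\<close> at \<open>a\<^sub>p\<close> is a coboundary: since \<open>f \<alpha>\<^sub>p\<^sub>-\<^sub>1\<close> is killed by \<open>\<mu>\<^sub>p\<^sub>+\<^sub>s\<close>, it comes
  from \<open>x\<^sub>p\<^sub>+\<^sub>s\<^sub>-\<^sub>1\<close>, which shifts the question one step to the left in both angles, until at \<open>a\<^sub>0\<close> the
  obstruction lies in \<open>Hom(a\<^sub>d\<^sub>+\<^sub>1, \<Sigma>\<^sup>d x\<^sub>s)\<close>.
\<close>

lemma cocycle_coboundary:
  assumes a: "angle a \<alpha>" and x: "angle x \<mu>" and van: "Hom C (a (d + 1)) (shO C (x s)) = {0}"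
    and f: "f \<in> Hom C (a p) (x (p + s))" "p = 0 \<or> \<mu> (p + s) \<cdot> (f \<cdot> \<alpha> (p - 1)) = 0"
  shows "\<exists>g\<in>Hom C (a (Suc p)) (x (p + s)). \<mu> (p + s) \<cdot> f = \<mu> (p + s) \<cdot> (g \<cdot> \<alpha> p)"
  using f
proof (induction p arbitrary: f)
  case 0
  then have f: "f \<in> Hom C (a 0) (x s)" by simp
  have "\<alpha> (d + 1) \<in> Hom C (a (d + 1)) (shO C (a 0))"
    using angle_in[OF a, of "d + 1"] angle_shO(1)[OF a, of "d + 2" 0] by simp
  then have "shM C f \<cdot> \<alpha> (d + 1) = 0" using van cmp_closed[OF _ sh_in[OF f]] by blast
  then show ?case using angle_extend_first[OF a f] by auto
next
  case (Suc p)
  let ?q = "p + s"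
  have al: "\<alpha> i \<in> Hom C (a i) (a (Suc i))" and mu: "\<mu> i \<in> Hom C (x i) (x (Suc i))" for i
    using angle_in[OF a] angle_in[OF x] by auto
  have f: "f \<in> Hom C (a (Suc p)) (x (Suc ?q))" "\<mu> (Suc ?q) \<cdot> (f \<cdot> \<alpha> p) = 0" using Suc.prems by auto
  obtain f' where f': "f' \<in> Hom C (a p) (x ?q)" "f \<cdot> \<alpha> p = \<mu> ?q \<cdot> f'"
    using angle_exact_right[OF x cmp_closed[OF al f(1)] f(2)] by blast
  have "p = 0 \<or> \<mu> ?q \<cdot> (f' \<cdot> \<alpha> (p - 1)) = 0"
  proof (cases p)
    case (Suc r)
    have "\<mu> ?q \<cdot> (f' \<cdot> \<alpha> r) = (\<mu> ?q \<cdot> f') \<cdot> \<alpha> r"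
      using cmp_assoc[of "\<alpha> r" "a r" "a p" f' "x ?q" "\<mu> ?q" "x (Suc ?q)"] al[of r] f'(1) mu Suc by simp
    also have "\<dots> = f \<cdot> (\<alpha> p \<cdot> \<alpha> r)"
      using cmp_assoc[of "\<alpha> r" "a r" "a p" "\<alpha> p" "a (Suc p)" f "x (Suc ?q)"] al[of r] al[of p] f Suc f'(2) by simp
    also have "\<alpha> p \<cdot> \<alpha> r = 0" using angle_cmp_zero[OF a, of r] Suc by simp
    finally show ?thesis using cmp_zero_right[OF f(1)] Suc by simp
  qed simp
  then obtain g' where g': "g' \<in> Hom C (a (Suc p)) (x ?q)" "\<mu> ?q \<cdot> f' = \<mu> ?q \<cdot> (g' \<cdot> \<alpha> p)"
    using Suc.IH[OF f'(1)] by blast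
  have mg: "\<mu> ?q \<cdot> g' \<in> Hom C (a (Suc p)) (x (Suc ?q))" using cmp_closed[OF g'(1) mu] .
  have "(f - \<mu> ?q \<cdot> g') \<cdot> \<alpha> p = 0"
    using cmp_diff_left[OF al f(1) mg] f'(2) g'(2) cmp_assoc[OF al g'(1) mu] by simp
  then obtain g where g: "g \<in> Hom C (a (Suc (Suc p))) (x (Suc ?q))" "f - \<mu> ?q \<cdot> g' = g \<cdot> \<alpha> (Suc p)"
    using angle_exact_left[OF a diff_in[OF f(1) mg]] by blast
  have "\<mu> (Suc ?q) \<cdot> (\<mu> ?q \<cdot> g') = 0"
    using cmp_assoc[OF g'(1) mu mu] angle_cmp_zero[OF x] cmp_zero_left[OF g'(1)] by simp
  then have "\<mu> (Suc ?q) \<cdot> f = \<mu> (Suc ?q) \<cdot> (f - \<mu> ?q \<cdot> g')"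
    using cmp_diff_right[OF f(1) mg mu] by simp
  then show ?case using g by auto
qed

lemma altsum_telescope:
  fixes v r :: "nat \<Rightarrow> int"
  assumes "\<And>i. i < n \<Longrightarrow> v (Suc i) = r (Suc i) + r i"
  shows "altsum n v = v 0 - r 0 + (-1) ^ n * r n"
  using assms by (induction n) (auto simp: altsum_0 altsum_Suc)

text \<open>The coboundaries at \<open>a\<^sub>p\<close> in the complex of the spaces \<open>\<delta> Hom(a\<^sub>p, b)\<close>, whose differential lowers \<open>p\<close>.\<close>

abbreviation boundary where
  "boundary b \<delta> a \<alpha> p \<equiv> (\<lambda>h. h \<cdot> \<alpha> p) ` post_image C b \<delta> (a (Suc p))"

lemma boundary_sub:
  assumes "\<delta> \<in> Hom C b y" "\<alpha> p \<in> Hom C (a p) (a (Suc p))"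
  shows "boundary b \<delta> a \<alpha> p \<subseteq> post_image C b \<delta> (a p)" "subspace (boundary b \<delta> a \<alpha> p)"
proof -
  show "boundary b \<delta> a \<alpha> p \<subseteq> post_image C b \<delta> (a p)"
    unfolding post_image_def using cmp_assoc[OF assms(2) _ assms(1)] cmp_closed[OF assms(2)] by auto
  show "subspace (boundary b \<delta> a \<alpha> p)"
    by (rule linear_image_subspace[OF post_image_subspace[OF assms(1)]])
      (use pre_linear[OF post_image_in[OF assms(1)] assms(2)] in auto)
qed

lemma boundaryI:
  assumes "\<delta> \<in> Hom C b y" "\<alpha> p \<in> Hom C (a p) (a (Suc p))" "g \<in> Hom C (a (Suc p)) b"
  shows "\<delta> \<cdot> (g \<cdot> \<alpha> p) \<in> boundary b \<delta> a \<alpha> p"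
  unfolding cmp_assoc[OF assms(2,3,1), symmetric] post_image_def using assms(3) by blast

text \<open>
  Along a \<open>(d + 2)\<close>-angle \<open>a\<close>, read as a resolution of \<open>a\<^sub>d\<^sub>+\<^sub>1\<close>, the functor \<open>\<delta> Hom(-, b)\<close> can fail to be
  exact at the two ends only.
\<close>

lemma post_image_euler:
  assumes fin: "hom_finite C" and a: "angle a \<alpha>" and x: "angle x \<mu>"
    and van: "\<And>s. 1 \<le> s \<Longrightarrow> s \<le> d \<Longrightarrow> Hom C (a (d + 1)) (shO C (x s)) = {0}"
    and b: "b = x (d + 1)" and \<delta>: "\<delta> = \<mu> (d + 1)"
  shows "altsum d (\<lambda>i. int (dim (post_image C b \<delta> (a i))))
    = int (dim (post_image C b \<delta> (a 0))) - int (dim (boundary b \<delta> a \<alpha> 0))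
      + (-1) ^ d * int (dim (boundary b \<delta> a \<alpha> d))"
proof (rule altsum_telescope[where r = "\<lambda>p. int (dim (boundary b \<delta> a \<alpha> p))"])
  fix p assume p: "p < d"
  have \<delta>_in: "\<delta> \<in> Hom C b (x (Suc (d + 1)))" using angle_in[OF x, of "d + 1"] b \<delta> by simp
  have al: "\<alpha> i \<in> Hom C (a i) (a (Suc i))" for i using angle_in[OF a] .
  let ?V = "post_image C b \<delta> (a (Suc p))"
  have kernel: "{h \<in> ?V. h \<cdot> \<alpha> p = 0} = boundary b \<delta> a \<alpha> (Suc p)"
  proof (intro equalityI subsetI)
    fix h assume "h \<in> {h \<in> ?V. h \<cdot> \<alpha> p = 0}"
    then obtain f where f: "f \<in> Hom C (a (Suc p)) b" "h = \<delta> \<cdot> f" "(\<delta> \<cdot> f) \<cdot> \<alpha> p = 0"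
      by (auto simp: post_image_def)
    have "\<delta> \<cdot> (f \<cdot> \<alpha> p) = 0" using cmp_assoc[OF al f(1) \<delta>_in] f(3) by simp
    then obtain g where g: "g \<in> Hom C (a (Suc (Suc p))) b" "\<delta> \<cdot> f = \<delta> \<cdot> (g \<cdot> \<alpha> (Suc p))"
    proof -
      have s: "Hom C (a (d + 1)) (shO C (x (d - p))) = {0}" "Suc p + (d - p) = d + 1"
        using van[of "d - p"] p by auto
      show ?thesis
        using cocycle_coboundary[OF a x s(1), of f "Suc p"] f(1) \<open>\<delta> \<cdot> (f \<cdot> \<alpha> p) = 0\<close> that
        unfolding s(2) b \<delta> by auto
    qed
    then show "h \<in> boundary b \<delta> a \<alpha> (Suc p)"
      using f(2) boundaryI[where \<alpha> = \<alpha> and a = a and p = "Suc p", OF \<delta>_in al g(1)] by simp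
  next
    fix h assume "h \<in> boundary b \<delta> a \<alpha> (Suc p)"
    then obtain g where g: "g \<in> Hom C (a (Suc (Suc p))) b" "h = (\<delta> \<cdot> g) \<cdot> \<alpha> (Suc p)"
      by (auto simp: post_image_def)
    have "h \<cdot> \<alpha> p = 0"
      using g(2) cmp_assoc[OF al[of p] al[of "Suc p"] cmp_closed[OF g(1) \<delta>_in]] angle_cmp_zero[OF a, of p]
        cmp_zero_right[OF cmp_closed[OF g(1) \<delta>_in]] by simp
    moreover have "h \<in> ?V"
      using g cmp_assoc[OF al g(1) \<delta>_in] cmp_closed[OF al g(1)] by (auto simp: post_image_def)
    ultimately show "h \<in> {h \<in> ?V. h \<cdot> \<alpha> p = 0}" by simp
  qed
  show "int (dim ?V) = int (dim (boundary b \<delta> a \<alpha> (Suc p))) + int (dim (boundary b \<delta> a \<alpha> p))"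
    using rank_nullity_pre[OF fin post_image_subspace[OF \<delta>_in] post_image_in[OF \<delta>_in] al, of p] unfolding kernel by simp
qed

end

section \<open>Exchange pairs\<close>

lemma angle_through_unroll:
  assumes ac: "angulated_category C d" and thr: "angle_through C d E a b \<delta>"
  shows "\<exists>x \<mu>. angulated_category.angle C d x \<mu> \<and> x 0 = a \<and> x (d + 1) = b \<and> \<mu> (d + 1) = \<delta> \<and>
    (\<forall>s. 1 \<le> s \<longrightarrow> s \<le> d \<longrightarrow> (\<exists>xs. set xs \<subseteq> E \<and> direct_sum C xs (x s)))"
proof -
  interpret angulated_category C d by (rule ac)
  obtain es \<gamma> where es: "length es = d" "([a] @ es @ [b], \<gamma> @ [\<delta>]) \<in> angles C"
    "\<forall>e \<in> set es. \<exists>xs. set xs \<subseteq> E \<and> direct_sum C xs e"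
    using thr by (auto simp: angle_through_def)
  have len: "length \<gamma> = d + 1" using angles_seq[OF es(2)] by (auto simp: is_seq_def)
  obtain x \<mu> where x: "angle x \<mu>" "\<And>i. i \<le> d + 1 \<Longrightarrow> x i = ([a] @ es @ [b]) ! i"
    "\<And>i. i \<le> d + 1 \<Longrightarrow> \<mu> i = (\<gamma> @ [\<delta>]) ! i"
    using angle_unroll[OF es(2)] by metis
  show ?thesis
  proof (rule exI[of _ x], rule exI[of _ \<mu>], intro conjI allI impI)
    show "angle x \<mu>" by (rule x(1))
    show "x 0 = a" "x (d + 1) = b" "\<mu> (d + 1) = \<delta>"
      using x(2)[of 0] x(2)[of "d + 1"] x(3)[of "d + 1"] es(1) len by (auto simp: nth_append)
    show "\<exists>xs. set xs \<subseteq> E \<and> direct_sum C xs (x s)" if "1 \<le> s" "s \<le> d" for s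
    proof -
      have "x s = es ! (s - 1)" using x(2)[of s] that es(1) by (auto simp: nth_append nth_Cons')
      moreover have "es ! (s - 1) \<in> set es" using that es(1) by (intro nth_mem) auto
      ultimately show ?thesis using es(3) by metis
    qed
  qed
qed

text \<open>
  The two exchange angles of an exchange pair \<open>u, u'\<close>, with the vanishing that the two cluster tilting
  objects provide. \<open>W\<close> stands for the indecomposables of \<open>add U\<close>.
\<close>

locale exchange = cluster_tilting C d T
  for C :: "('o, 'm::ab_group_add, 'k::field, 'z) angcat_scheme" (structure) and d :: nat and T :: 'o +
  fixes W :: "'o set" and u u' :: 'o and \<delta> \<epsilon> :: 'm
    and x y :: "nat \<Rightarrow> 'o" and \<mu> \<nu> :: "nat \<Rightarrow> 'm"
  assumes fin: "hom_finite C" and odd_d: "odd d"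
    and x: "angle x \<mu>" "x 0 = u'" "x (d + 1) = u" "\<mu> (d + 1) = \<delta>"
    and y: "angle y \<nu>" "y 0 = u" "y (d + 1) = u'" "\<nu> (d + 1) = \<epsilon>"
    and van_x: "v \<in> W \<Longrightarrow> 1 \<le> s \<Longrightarrow> s \<le> d \<Longrightarrow> Hom C v (shO C (x s)) = {0}"
    and van_y: "v \<in> W \<Longrightarrow> 1 \<le> s \<Longrightarrow> s \<le> d \<Longrightarrow> Hom C v (shO C (y s)) = {0}"
    and van_u: "v \<in> W \<Longrightarrow> Hom C v (shO C u) = {0}"
    and van_u': "v \<in> W \<Longrightarrow> \<not> isomorphic C v u \<Longrightarrow> Hom C v (shO C u') = {0}"
    and line: "hom_dim C u (shO C u') = 1" and u_in: "u \<in> W"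
begin

lemma delta_in: "\<delta> \<in> Hom C u (shO C u')"
  using angle_in[OF x(1), of "d + 1"] x angle_shO(1)[OF x(1), of "d + 2" 0] by simp

lemma epsilon_in: "\<epsilon> \<in> Hom C u' (shO C u)"
  using angle_in[OF y(1), of "d + 1"] y angle_shO(1)[OF y(1), of "d + 2" 0] by simp

text \<open>As \<open>Hom(u, \<Sigma>\<^sup>d x\<^sub>1) = 0\<close>, every \<open>u \<rightarrow> \<Sigma>\<^sup>d u'\<close> factors through \<open>\<delta>\<close>; this space is a line, so \<open>\<delta>\<close> spans it.\<close>

lemma delta_spans: "\<delta> \<noteq> 0" "g \<in> Hom C u (shO C u') \<Longrightarrow> \<exists>c. g = scl C c \<delta>"
proof -
  obtain B where B: "B \<subseteq> Hom C u (shO C u')" "independent B" "Hom C u (shO C u') \<subseteq> span B" "card B = 1"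
    using basis_exists[of "Hom C u (shO C u')"] line unfolding hom_dim_def by metis
  then obtain e where "B = {e}" by (auto simp: card_1_singleton_iff)
  then have e: "e \<in> Hom C u (shO C u')" "e \<noteq> 0" "\<And>g. g \<in> Hom C u (shO C u') \<Longrightarrow> \<exists>c. g = scl C c e"
    using B by (auto simp: span_singleton)
  have "\<mu> (d + 2) \<cdot> e \<in> Hom C u (shO C (x 1))"
    using angle_in[OF x(1), of "d + 2"] cmp_closed[OF e(1), of "\<mu> (d + 2)" "shO C (x 1)"]
      angle_shO(1)[OF x(1), of "d + 2" 0] angle_shO(1)[OF x(1), of "Suc (d + 2)" 1] x(2) by simp
  then have "\<mu> (Suc (d + 1)) \<cdot> e = 0" using van_x[OF u_in, of 1] d_pos by auto
  then obtain h where h: "h \<in> Hom C u u" "e = \<delta> \<cdot> h"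
    using angle_exact_right[OF x(1), of e u "d + 1"] e(1) angle_shO(1)[OF x(1), of "d + 2" 0] x by auto
  then show nz: "\<delta> \<noteq> 0" using e(2) cmp_zero_left by blast
  obtain k where k: "\<delta> = scl C k e" using e(3)[OF delta_in] by blast
  then have "k \<noteq> 0" using nz by auto
  then have "e = scl C (inverse k) \<delta>" using k by simp
  then show "\<exists>c. g = scl C c \<delta>" if "g \<in> Hom C u (shO C u')" for g
    using e(3)[OF that] by (metis scale_scale)
qed

lemma delta_iso:
  assumes "isomorphic C v u"
  obtains j k where "j \<in> Hom C v u" "k \<in> Hom C u v" "j \<cdot> k = Id u" "k \<cdot> j = Id v" "\<delta> \<cdot> j \<noteq> 0"
    "\<And>g. g \<in> Hom C v (shO C u') \<Longrightarrow> \<exists>c. g = scl C c (\<delta> \<cdot> j)"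
proof -
  obtain j k where jk: "j \<in> Hom C v u" "k \<in> Hom C u v" "k \<cdot> j = Id v" "j \<cdot> k = Id u"
    using assms by (elim isomorphicE)
  have "(\<delta> \<cdot> j) \<cdot> k = \<delta>"
    using cmp_assoc[OF jk(2,1) delta_in] jk(4) cmp_ident_right[OF delta_in] by simp
  then have nz: "\<delta> \<cdot> j \<noteq> 0" using delta_spans(1) cmp_zero_left[OF jk(2)] by auto
  have "\<exists>c. g = scl C c (\<delta> \<cdot> j)" if g: "g \<in> Hom C v (shO C u')" for g
  proof -
    obtain c where "g \<cdot> k = scl C c \<delta>" using delta_spans(2) cmp_closed[OF jk(2) g] by blast
    then have "g = scl C c \<delta> \<cdot> j"
      using cmp_assoc[OF jk(1,2) g] jk(3) cmp_ident_right[OF g] by simp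
    then show ?thesis using cmp_scl_left[OF jk(1) delta_in] by auto
  qed
  then show ?thesis using that[OF jk(1,2,4,3) nz] by blast
qed

lemma post_image_additive:
  "w \<in> Hom C b w' \<Longrightarrow> integer_additive_function C d T (\<lambda>t. int (dim (post_image C b w t)))"
  by unfold_locales (auto simp: dim_post_image_additive[OF fin])

text \<open>
  The Euler characteristic reduces to the space of composites \<open>a\<^sub>d \<rightarrow> v \<rightarrow> u \<rightarrow> \<Sigma>\<^sup>d u'\<close>. For \<open>v \<cong> u\<close> it is a line: as
  \<open>a\<^sub>d \<rightarrow> v\<close> is an approximation by \<open>add T\<close> and \<open>\<delta>\<^sub>* \<noteq> 0\<close>, the composite with \<open>\<delta>\<close> is not zero. Otherwise
  \<open>Hom(v, \<Sigma>\<^sup>d u') = 0\<close>.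
\<close>

lemma dual_delta:
  assumes t: "t \<in> addcat C T" "f \<in> Hom C t u" "\<delta> \<cdot> f \<noteq> 0" and v: "v \<in> W" and r: "res a \<alpha> v"
  shows "altsum d (\<lambda>i. int (dim (post_image C u \<delta> (a (d - i))))) = (if isomorphic C v u then 1 else 0)"
proof -
  note rr = resD[OF r]
  let ?V = "\<lambda>i. post_image C u \<delta> (a i)" and ?B = "boundary u \<delta> a \<alpha>"
  have "?V 0 \<subseteq> ?B 0"
  proof
    fix h assume "h \<in> ?V 0"
    then obtain g where g: "g \<in> Hom C (a 0) u" "h = \<delta> \<cdot> g" by (auto simp: post_image_def)
    have "shM C g \<cdot> \<alpha> (d + 1) = 0" using van_u[OF v] cmp_closed[OF rr(6) sh_in[OF g(1)]] by auto
    then obtain g' where "g' \<in> Hom C (a (Suc 0)) u" "g = g' \<cdot> \<alpha> 0" using angle_extend_first[OF rr(1) g(1)] by blast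
    then show "h \<in> ?B 0" using g(2) boundaryI[where \<alpha> = \<alpha> and a = a and p = 0, OF delta_in rr(4)[of 0]] by simp
  qed
  then have start: "?B 0 = ?V 0" using boundary_sub(1)[where \<alpha> = \<alpha> and a = a and p = 0, OF delta_in rr(4)[of 0]] by blast
  have ad: "\<alpha> d \<in> Hom C (a d) v" using rr(5) .
  have stop: "dim (?B d) = (if isomorphic C v u then 1 else 0)"
  proof (cases "isomorphic C v u")
    case False
    then have "post_image C u \<delta> v = {0}"
      using van_u'[OF v] post_image_in[OF delta_in, of v] subspace_0[OF post_image_subspace[OF delta_in, of v]] by blast
    then show ?thesis using False rr(3) cmp_zero_left[OF ad] dim_zero_space by simp
  next
    case True
    then obtain j k where jk: "j \<in> Hom C v u" "k \<in> Hom C u v" "j \<cdot> k = Id u" "k \<cdot> j = Id v" "\<delta> \<cdot> j \<noteq> 0"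
      and sp: "\<And>g. g \<in> Hom C v (shO C u') \<Longrightarrow> \<exists>c. g = scl C c (\<delta> \<cdot> j)"
      using delta_iso by metis
    have dj: "\<delta> \<cdot> j \<in> Hom C v (shO C u')" using cmp_closed[OF jk(1) delta_in] .
    let ?w = "(\<delta> \<cdot> j) \<cdot> \<alpha> d"
    obtain h where h: "h \<in> Hom C t (a d)" "k \<cdot> f = \<alpha> d \<cdot> h"
      using res_approximation[OF r t(1) cmp_closed[OF t(2) jk(2)]] by blast
    have "\<delta> \<cdot> f = (\<delta> \<cdot> j) \<cdot> (k \<cdot> f)"
      using cmp_section_retraction[OF t(2) delta_in jk(2,1)] jk(3) cmp_ident_left[OF t(2)] by simp
    then have "\<delta> \<cdot> f = ?w \<cdot> h" using h cmp_assoc[OF h(1) ad dj] by simp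
    then have nz: "?w \<noteq> 0" using t(3) cmp_zero_left[OF h(1)] by auto
    have "?B d = {scl C c ?w | c. True}"
    proof (intro equalityI subsetI)
      fix h assume "h \<in> ?B d"
      then obtain g where g: "g \<in> Hom C v u" "h = (\<delta> \<cdot> g) \<cdot> \<alpha> d" using rr(3) by (auto simp: post_image_def)
      then show "h \<in> {scl C c ?w | c. True}"
        using sp[OF cmp_closed[OF g(1) delta_in]] cmp_scl_left[OF ad dj] by auto
    next
      fix h assume "h \<in> {scl C c ?w | c. True}"
      moreover have "?w \<in> ?B d" using jk(1) rr(3) by (auto simp: post_image_def)
      ultimately show "h \<in> ?B d" using subspace_scale[OF boundary_sub(2)[where \<alpha> = \<alpha> and a = a and p = d, OF delta_in rr(4)[of d]]] by auto
    qed
    then show ?thesis using dim_line[OF nz] True by simp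
  qed
  have "altsum d (\<lambda>i. int (dim (?V i))) = int (dim (?V 0)) - int (dim (?B 0)) + (-1) ^ d * int (dim (?B d))"
    using post_image_euler[OF fin rr(1) x(1)] van_x[OF v] rr(3) x(3,4) by simp
  then have "altsum d (\<lambda>i. int (dim (?V i))) = (if isomorphic C v u then - 1 else 0)"
    unfolding start using stop odd_d by simp
  then show ?thesis
    using altsum_rev[of d "\<lambda>i. int (dim (?V i))"] odd_d by simp
qed

text \<open>
  If \<open>\<delta>\<^sub>* = 0\<close>, then \<open>\<delta>\<close> factors through \<open>\<Sigma>\<^sup>d a\<^sub>0\<close>, and the factor \<open>f\<^sub>0 : a\<^sub>0 \<rightarrow> u'\<close> gives the one class of
  homology of \<open>\<epsilon> Hom(a, u')\<close>, at the other end of the resolution.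
\<close>

lemma dual_epsilon:
  assumes zero: "\<And>t f. t \<in> addcat C T \<Longrightarrow> f \<in> Hom C t u \<Longrightarrow> \<delta> \<cdot> f = 0" and v: "v \<in> W" and r: "res a \<alpha> v"
  shows "altsum d (\<lambda>i. - int (dim (post_image C u' \<epsilon> (a (d - i))))) = (if isomorphic C v u then 1 else 0)"
proof -
  note rr = resD[OF r]
  let ?V = "\<lambda>i. post_image C u' \<epsilon> (a i)" and ?B = "boundary u' \<epsilon> a \<alpha>"
  have "post_image C u' \<epsilon> v = {0}"
    using van_u[OF v] post_image_in[OF epsilon_in, of v] subspace_0[OF post_image_subspace[OF epsilon_in, of v]] by blast
  then have stop: "dim (?B d) = 0" using rr(3) cmp_zero_left[OF rr(5)] dim_zero_space by simp
  have a0: "\<alpha> 0 \<in> Hom C (a 0) (a (Suc 0))" using rr(4) .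
  have sub: "?B 0 \<subseteq> ?V 0" "subspace (?B 0)"
    using boundary_sub[where \<alpha> = \<alpha> and a = a and p = 0, OF epsilon_in a0] by auto
  have extend: "\<epsilon> \<cdot> g \<in> ?B 0" if g: "g \<in> Hom C (a 0) u'" "shM C g \<cdot> \<alpha> (d + 1) = 0" for g
  proof -
    obtain g' where "g' \<in> Hom C (a (Suc 0)) u'" "g = g' \<cdot> \<alpha> 0" using angle_extend_first[OF rr(1) g(1)] g(2) by blast
    then show ?thesis using boundaryI[where \<alpha> = \<alpha> and a = a and p = 0, OF epsilon_in a0] by simp
  qed
  have start: "dim (?V 0) = dim (?B 0) + (if isomorphic C v u then 1 else 0)"
  proof (cases "isomorphic C v u")
    case False
    then have "Hom C v (shO C u') = {0}" using van_u'[OF v] by blast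
    then have "shM C g \<cdot> \<alpha> (d + 1) = 0" if "g \<in> Hom C (a 0) u'" for g
      using cmp_closed[OF rr(6) sh_in[OF that]] by simp
    then have "?V 0 \<subseteq> ?B 0"
      using extend unfolding post_image_def[of C u' \<epsilon> "a 0"] by blast
    then show ?thesis using sub(1) False by (simp add: subset_antisym)
  next
    case True
    then obtain j k where jk: "j \<in> Hom C v u" "\<delta> \<cdot> j \<noteq> 0"
      and sp: "\<And>g. g \<in> Hom C v (shO C u') \<Longrightarrow> \<exists>c. g = scl C c (\<delta> \<cdot> j)"
      using delta_iso by metis
    have dj: "\<delta> \<cdot> j \<in> Hom C v (shO C u')" using cmp_closed[OF jk(1) delta_in] .
    have "(\<delta> \<cdot> j) \<cdot> \<alpha> d = 0"
      using cmp_assoc[OF rr(5) jk(1) delta_in] zero[OF rr(2)[OF order_refl] cmp_closed[OF rr(5) jk(1)]] by simp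
    then obtain l where l: "l \<in> Hom C (shO C (a 0)) (shO C u')" "\<delta> \<cdot> j = l \<cdot> \<alpha> (d + 1)"
      using angle_exact_left[OF rr(1), of "\<delta> \<cdot> j" d] dj rr(3) angle_shO(1)[OF rr(1), of "d + 2" 0] by auto
    then obtain f0 where f0: "f0 \<in> Hom C (a 0) u'" "l = shM C f0" using sh_surj by blast
    \<comment> \<open>Correcting by a map through \<open>y\<^sub>d\<close>, a coboundary \<open>\<epsilon> f\<^sub>0\<close> would make \<open>f\<^sub>0\<close> extend over \<open>a\<^sub>1\<close>, and \<open>\<delta> j\<close> vanish.\<close>
    have not_bd: "\<epsilon> \<cdot> f0 \<notin> ?B 0"
    proof
      assume "\<epsilon> \<cdot> f0 \<in> ?B 0"
      then obtain g where g: "g \<in> Hom C (a (Suc 0)) u'" "\<epsilon> \<cdot> f0 = (\<epsilon> \<cdot> g) \<cdot> \<alpha> 0" by (auto simp: post_image_def)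
      have ga: "g \<cdot> \<alpha> 0 \<in> Hom C (a 0) u'" using cmp_closed[OF a0 g(1)] .
      have fg: "f0 - g \<cdot> \<alpha> 0 \<in> Hom C (a 0) u'" using diff_in[OF f0(1) ga] .
      have "\<epsilon> \<cdot> (f0 - g \<cdot> \<alpha> 0) = 0"
        using cmp_diff_right[OF f0(1) ga epsilon_in] cmp_assoc[OF a0 g(1) epsilon_in] g(2) by simp
      then obtain f' where f': "f' \<in> Hom C (a 0) (y d)" "f0 - g \<cdot> \<alpha> 0 = \<nu> d \<cdot> f'"
        using angle_exact_right[OF y(1), of "f0 - g \<cdot> \<alpha> 0" "a 0" d] fg y(3,4) by auto
      have nd: "\<nu> d \<in> Hom C (y d) u'" using angle_in[OF y(1), of d] y(3) by simp
      have "shM C f' \<cdot> \<alpha> (d + 1) = 0"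
        using van_y[OF v, of d] d_pos cmp_closed[OF rr(6) sh_in[OF f'(1)]] by auto
      then obtain g' where g': "g' \<in> Hom C (a (Suc 0)) (y d)" "f' = g' \<cdot> \<alpha> 0"
        using angle_extend_first[OF rr(1) f'(1)] by blast
      have ng: "\<nu> d \<cdot> g' \<in> Hom C (a (Suc 0)) u'" using cmp_closed[OF g'(1) nd] .
      have "f0 = g \<cdot> \<alpha> 0 + \<nu> d \<cdot> f'" using f'(2) by (simp add: algebra_simps)
      also have "\<dots> = (g + \<nu> d \<cdot> g') \<cdot> \<alpha> 0"
        using g'(2) cmp_add_left[OF a0 g(1) ng] cmp_assoc[OF a0 g'(1) nd] by simp
      finally have "shM C f0 \<cdot> \<alpha> (d + 1) = 0"
        using angle_extend_first[OF rr(1) f0(1)] add_in[OF g(1) ng] by blast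
      then show False using jk(2) l(2) f0(2) by simp
    qed
    have "\<exists>c. h - scl C c (\<epsilon> \<cdot> f0) \<in> ?B 0" if h: "h \<in> ?V 0" for h
    proof -
      obtain g where g: "g \<in> Hom C (a 0) u'" "h = \<epsilon> \<cdot> g" using h by (auto simp: post_image_def)
      obtain c where c: "shM C g \<cdot> \<alpha> (d + 1) = scl C c (\<delta> \<cdot> j)"
        using sp[OF cmp_closed[OF rr(6) sh_in[OF g(1)]]] by blast
      have cf: "scl C c f0 \<in> Hom C (a 0) u'" using scl_in[OF f0(1)] .
      have "shM C (g - scl C c f0) \<cdot> \<alpha> (d + 1) = 0"
        unfolding sh_diff[OF g(1) cf] sh_scl[OF f0(1)]
        using cmp_diff_left[OF rr(6) sh_in[OF g(1)] scl_in[OF sh_in[OF f0(1)]]] cmp_scl_left[OF rr(6) sh_in[OF f0(1)]]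
          c l(2) f0(2) by simp
      then have "\<epsilon> \<cdot> (g - scl C c f0) \<in> ?B 0" using extend[OF diff_in[OF g(1) cf]] by blast
      then show ?thesis
        using cmp_diff_right[OF g(1) cf epsilon_in] cmp_scl_right[OF f0(1) epsilon_in] g(2) by auto
    qed
    moreover obtain S where "finite S" "?V 0 \<subseteq> span S"
      using hom_finiteD[OF fin post_image_in[OF epsilon_in]] by blast
    moreover have "\<epsilon> \<cdot> f0 \<in> ?V 0" using f0(1) by (auto simp: post_image_def)
    ultimately have "dim (?V 0) = dim (?B 0) + 1"
      using sub not_bd post_image_subspace[OF epsilon_in]
      by (intro dim_insert_vector[of _ S "\<epsilon> \<cdot> f0"]) auto
    then show ?thesis using True by simp
  qed
  have "altsum d (\<lambda>i. int (dim (?V i))) = int (dim (?V 0)) - int (dim (?B 0)) + (-1) ^ d * int (dim (?B d))"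
    using post_image_euler[OF fin rr(1) y(1)] van_y[OF v] rr(3) y(3,4) by simp
  then have "altsum d (\<lambda>i. int (dim (?V i))) = (if isomorphic C v u then 1 else 0)"
    unfolding start stop by simp
  then show ?thesis
    using altsum_rev[of d "\<lambda>i. - int (dim (?V i))"] altsum_mult[of d "-1" "\<lambda>i. int (dim (?V i))"] odd_d by simp
qed

end

theorem theoremC:
  fixes C :: "('o, 'm::ab_group_add, 'k::alg_closed_field) angcat"
    and d :: nat
    and T U u u' :: 'o
    and \<delta> \<epsilon> :: 'm
  assumes "angulated_category C d"
    and "calabi_yau_2d C"
    and "hom_finite C"
    and "krull_schmidt C"
    and "OT_cluster_tilting C d T" and "basic C T"
    and "OT_cluster_tilting C d U" and "basic C U"
    and "odd d"
    and "is_mutation C d U u u'"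
    and "exchange_pair C d U u u'"
    and "exchange_angles C d U u u' \<delta> \<epsilon>"
  shows
    "(\<forall>t \<in> addcat C T.
        c_vector C d T U u (K0_class C (addcat C T) t) \<ge> 0 \<and>
        c_vector C d T U u (K0_class C (addcat C T) t)
          = int (End_hom_dim C T (F_obj C T t) (F_image C T u \<delta>))) \<or>
     (\<forall>t \<in> addcat C T.
        c_vector C d T U u (K0_class C (addcat C T) t) \<le> 0 \<and>
        c_vector C d T U u (K0_class C (addcat C T) t)
          = - int (End_hom_dim C T (F_obj C T t) (F_image C T u' \<epsilon>)))"
proof -
  interpret T: cluster_tilting C d T
    using assms by (simp add: cluster_tilting_def cluster_tilting_axioms_def)
  interpret U: cluster_tilting C d U
    using assms by (simp add: cluster_tilting_def cluster_tilting_axioms_def)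
  let ?W = "Indec C (addcat C U)"
  let ?E = "{v \<in> ?W. \<not> isomorphic C v u}"
  have thr: "angle_through C d ?E u' u \<delta>" "angle_through C d ?E u u' \<epsilon>"
    using assms(12) by (auto simp: exchange_angles_def Let_def)
  obtain x \<mu> where x: "T.angle x \<mu>" "x 0 = u'" "x (d + 1) = u" "\<mu> (d + 1) = \<delta>"
    "\<forall>s. 1 \<le> s \<longrightarrow> s \<le> d \<longrightarrow> (\<exists>xs. set xs \<subseteq> ?E \<and> direct_sum C xs (x s))"
    using angle_through_unroll[OF assms(1) thr(1)] by blast
  obtain y \<nu> where y: "T.angle y \<nu>" "y 0 = u" "y (d + 1) = u'" "\<nu> (d + 1) = \<epsilon>"
    "\<forall>s. 1 \<le> s \<longrightarrow> s \<le> d \<longrightarrow> (\<exists>xs. set xs \<subseteq> ?E \<and> direct_sum C xs (y s))"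
    using angle_through_unroll[OF assms(1) thr(2)] by blast
  obtain V where mut: "u \<in> indec_summands C U" "indecomposable C u'" "OT_cluster_tilting C d V"
    "indec_summands C V = {v \<in> indec_summands C U. \<not> isomorphic C v u} \<union> {v. isomorphic C v u'}"
    using assms(10) by (auto simp: is_mutation_def)
  interpret V: cluster_tilting C d V
    using assms(1) mut(3) by (simp add: cluster_tilting_def cluster_tilting_axioms_def)
  have summand_in: "w \<in> addcat C z" if "w \<in> indec_summands C z" for w z
    using T.addcat_summand[OF T.addcat_self] that by (auto simp: indec_summands_def)
  have u: "u \<in> ?W" "u \<in> addcat C U"
    using mut(1) summand_in by (auto simp: Indec_def indec_summands_def)
  have u': "u' \<in> addcat C V"
    using summand_in[of u' V] mut(4) T.isomorphic_refl by blast
  have rigid_U: "Hom C v (shO C e) = {0}" if "v \<in> addcat C U" "e \<in> addcat C U" for v e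
    using U.rigid[OF that] T.zero_in by blast
  have in_U: "e \<in> addcat C U" if "\<exists>xs. set xs \<subseteq> ?E \<and> direct_sum C xs e" for e
    using that T.addcat_direct_sum[of _ e U] by (auto simp: Indec_def subset_iff)
  have van_u': "Hom C v (shO C u') = {0}" if "v \<in> ?W" "\<not> isomorphic C v u" for v
  proof -
    have "v \<in> indec_summands C U"
      using T.indecomposable_in_addcat[OF assms(4)] that by (auto simp: Indec_def indec_summands_def)
    then have "v \<in> addcat C V" using mut(4) that(2) summand_in by blast
    then show ?thesis using V.rigid[OF _ u'] T.zero_in by blast
  qed
  interpret E: exchange C d T ?W u u' \<delta> \<epsilon> x y \<mu> \<nu>
  proof
    show "hom_finite C" "odd d" by fact+
    show "hom_dim C u (shO C u') = 1" using assms(11) by (simp add: exchange_pair_def)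
    show "T.angle x \<mu>" "x 0 = u'" "x (d + 1) = u" "\<mu> (d + 1) = \<delta>" by fact+
    show "T.angle y \<nu>" "y 0 = u" "y (d + 1) = u'" "\<nu> (d + 1) = \<epsilon>" by fact+
    show "u \<in> ?W" by fact
    fix v assume v: "v \<in> ?W"
    then have v_in: "v \<in> addcat C U" by (simp add: Indec_def)
    show "Hom C v (shO C u) = {0}" by (rule rigid_U[OF v_in u(2)])
    show "Hom C v (shO C u') = {0}" if "\<not> isomorphic C v u" by (rule van_u'[OF v that])
    fix s assume s: "1 \<le> s" "s \<le> d"
    show "Hom C v (shO C (x s)) = {0}" by (rule rigid_U[OF v_in in_U]) (use x(5) s in blast)
    show "Hom C v (shO C (y s)) = {0}" by (rule rigid_U[OF v_in in_U]) (use y(5) s in blast)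
  qed
  show ?thesis
  proof (cases "\<exists>t\<in>addcat C T. \<exists>f\<in>Hom C t u. \<delta> \<cdot>\<^bsub>C\<^esub> f \<noteq> 0")
    case True
    then obtain t0 f where f: "t0 \<in> addcat C T" "f \<in> Hom C t0 u" "\<delta> \<cdot>\<^bsub>C\<^esub> f \<noteq> 0" by blast
    have "c_vector C d T U u (K0_class C (addcat C T) t) = int (End_hom_dim C T (F_obj C T t) (F_image C T u \<delta>))"
      if "t \<in> addcat C T" for t
      using T.c_vector_eqI[OF assms(4,7) E.post_image_additive[OF E.delta_in] E.dual_delta[OF f] that]
        T.End_hom_dim_eq[OF assms(3) E.delta_in that] by simp
    then show ?thesis by auto
  next
    case False
    then have zero: "\<And>t f. t \<in> addcat C T \<Longrightarrow> f \<in> Hom C t u \<Longrightarrow> \<delta> \<cdot>\<^bsub>C\<^esub> f = 0" by blast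
    have add: "integer_additive_function C d T (\<lambda>t. - int (T.dim (post_image C u' \<epsilon> t)))"
    proof -
      interpret P: integer_additive_function C d T "\<lambda>t. int (T.dim (post_image C u' \<epsilon> t))"
        by (rule E.post_image_additive[OF E.epsilon_in])
      show ?thesis by unfold_locales (auto simp: P.f_additive)
    qed
    have "c_vector C d T U u (K0_class C (addcat C T) t) = - int (End_hom_dim C T (F_obj C T t) (F_image C T u' \<epsilon>))"
      if "t \<in> addcat C T" for t
      using T.c_vector_eqI[OF assms(4,7) add E.dual_epsilon[OF zero] that]
        T.End_hom_dim_eq[OF assms(3) E.epsilon_in that] by simp
    then show ?thesis by auto
  qed
qed

end
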